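(* Let $\mathfrak{A}$ be a small 2-category, $\mathfrak{H}$ a 2-category and $\mathcal{A},\mathcal{B}:\mathfrak{A}\to\mathfrak{H}$ pseudofunctors. There is a pseudonatural equivalence $$\int_{a\in\mathfrak{A}}\mathfrak{H}(\mathcal{A}(a),\mathcal{B}(a))\simeq[\mathfrak{A},\mathfrak{H}]_{PS}(\mathcal{A},\mathcal{B}).$$
   Context: $[\mathfrak{A},\mathfrak{H}]_{PS}$ denotes the 2-category of pseudofunctors $\mathfrak{A}\to\mathfrak{H}$, pseudonatural transformations (with invertible 2-cell components) and modifications, and $\mathsf{CAT}$ the 2-category of categories. The pseudoend of a pseudofunctor $T:\mathfrak{A}^{\mathrm{op}}\times\mathfrak{A}\to\mathsf{CAT}$ is the category $$\int_{a\in\mathfrak{A}}T(a,a)=\int_{\mathfrak{A}}T:=[\mathfrak{A}^{\mathrm{op}}\times\mathfrak{A},\mathsf{CAT}]_{PS}(\mathfrak{A}(-,-),T).$$ In the claim, $T=\mathfrak{H}(\mathcal{A}-,\mathcal{B}-)$. *)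

theory Defs
  imports "HOL-Library.FuncSet"
begin

record ('o, 'a) cat =
  Ob :: "'o set"
  Ar :: "'a set"
  Dom :: "'a \<Rightarrow> 'o"
  Cod :: "'a \<Rightarrow> 'o"
  Idn :: "'o \<Rightarrow> 'a"
  Cmp :: "'a \<Rightarrow> 'a \<Rightarrow> 'a"  \<comment> \<open>\<open>Cmp C g f\<close> is \<open>g\<close> after \<open>f\<close>\<close>

locale category =
  fixes C :: "('o, 'a) cat"
  assumes dom_in: "f \<in> Ar C \<Longrightarrow> Dom C f \<in> Ob C"
    and cod_in: "f \<in> Ar C \<Longrightarrow> Cod C f \<in> Ob C"
    and idn_in: "x \<in> Ob C \<Longrightarrow> Idn C x \<in> Ar C"
    and dom_idn: "x \<in> Ob C \<Longrightarrow> Dom C (Idn C x) = x"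
    and cod_idn: "x \<in> Ob C \<Longrightarrow> Cod C (Idn C x) = x"
    and cmp_in: "\<lbrakk>g \<in> Ar C; f \<in> Ar C; Dom C g = Cod C f\<rbrakk> \<Longrightarrow> Cmp C g f \<in> Ar C"
    and dom_cmp: "\<lbrakk>g \<in> Ar C; f \<in> Ar C; Dom C g = Cod C f\<rbrakk> \<Longrightarrow> Dom C (Cmp C g f) = Dom C f"
    and cod_cmp: "\<lbrakk>g \<in> Ar C; f \<in> Ar C; Dom C g = Cod C f\<rbrakk> \<Longrightarrow> Cod C (Cmp C g f) = Cod C g"
    and cmp_idn: "f \<in> Ar C \<Longrightarrow> Cmp C f (Idn C (Dom C f)) = f"
    and idn_cmp: "f \<in> Ar C \<Longrightarrow> Cmp C (Idn C (Cod C f)) f = f"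
    and cmp_assoc: "\<lbrakk>h \<in> Ar C; g \<in> Ar C; f \<in> Ar C; Dom C h = Cod C g; Dom C g = Cod C f\<rbrakk>
      \<Longrightarrow> Cmp C (Cmp C h g) f = Cmp C h (Cmp C g f)"

text \<open>Functors, transformations etc. carry their source and target, and all their component
  functions are extensional (\<open>undefined\<close> off the relevant carrier), so that HOL equality of such
  records is equality of the mathematical objects.\<close>

record ('o, 'a) ftr =
  FS :: "('o, 'a) cat"
  FT :: "('o, 'a) cat"
  FO :: "'o \<Rightarrow> 'o"
  FA :: "'a \<Rightarrow> 'a"

locale is_functor =
  fixes F :: "('o, 'a) ftr"
  assumes src_cat: "category (FS F)"
    and trg_cat: "category (FT F)"
    and fo_ext: "FO F \<in> extensional (Ob (FS F))"
    and fa_ext: "FA F \<in> extensional (Ar (FS F))"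
    and fo_in: "x \<in> Ob (FS F) \<Longrightarrow> FO F x \<in> Ob (FT F)"
    and fa_in: "f \<in> Ar (FS F) \<Longrightarrow> FA F f \<in> Ar (FT F)"
    and fa_dom: "f \<in> Ar (FS F) \<Longrightarrow> Dom (FT F) (FA F f) = FO F (Dom (FS F) f)"
    and fa_cod: "f \<in> Ar (FS F) \<Longrightarrow> Cod (FT F) (FA F f) = FO F (Cod (FS F) f)"
    and fa_idn: "x \<in> Ob (FS F) \<Longrightarrow> FA F (Idn (FS F) x) = Idn (FT F) (FO F x)"
    and fa_cmp: "\<lbrakk>g \<in> Ar (FS F); f \<in> Ar (FS F); Dom (FS F) g = Cod (FS F) f\<rbrakk>
      \<Longrightarrow> FA F (Cmp (FS F) g f) = Cmp (FT F) (FA F g) (FA F f)"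

definition ftr_id :: "('o, 'a) cat \<Rightarrow> ('o, 'a) ftr" where
  "ftr_id C = \<lparr>FS = C, FT = C, FO = (\<lambda>x\<in>Ob C. x), FA = (\<lambda>f\<in>Ar C. f)\<rparr>"

definition ftr_comp :: "('o, 'a) ftr \<Rightarrow> ('o, 'a) ftr \<Rightarrow> ('o, 'a) ftr" where
  "ftr_comp G F = \<lparr>FS = FS F, FT = FT G,
     FO = (\<lambda>x\<in>Ob (FS F). FO G (FO F x)), FA = (\<lambda>f\<in>Ar (FS F). FA G (FA F f))\<rparr>"

record ('o, 'a) ntr =
  TS :: "('o, 'a) ftr"
  TT :: "('o, 'a) ftr"
  TC :: "'o \<Rightarrow> 'a"

locale is_nat =
  fixes t :: "('o, 'a) ntr"
  assumes src_ftr: "is_functor (TS t)"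
    and trg_ftr: "is_functor (TT t)"
    and par_src: "FS (TT t) = FS (TS t)"
    and par_trg: "FT (TT t) = FT (TS t)"
    and tc_ext: "TC t \<in> extensional (Ob (FS (TS t)))"
    and tc_in: "x \<in> Ob (FS (TS t)) \<Longrightarrow> TC t x \<in> Ar (FT (TS t))"
    and tc_dom: "x \<in> Ob (FS (TS t)) \<Longrightarrow> Dom (FT (TS t)) (TC t x) = FO (TS t) x"
    and tc_cod: "x \<in> Ob (FS (TS t)) \<Longrightarrow> Cod (FT (TS t)) (TC t x) = FO (TT t) x"
    and tc_nat: "f \<in> Ar (FS (TS t)) \<Longrightarrow>
      Cmp (FT (TS t)) (TC t (Cod (FS (TS t)) f)) (FA (TS t) f)
        = Cmp (FT (TS t)) (FA (TT t) f) (TC t (Dom (FS (TS t)) f))"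

record ('o, 'f, 'c) two_cat =
  Obj :: "'o set"
  Cell1 :: "'f set"
  Cell2 :: "'c set"
  Src :: "'f \<Rightarrow> 'o"
  Trg :: "'f \<Rightarrow> 'o"
  Id1 :: "'o \<Rightarrow> 'f"
  Comp1 :: "'f \<Rightarrow> 'f \<Rightarrow> 'f"
  Dom2 :: "'c \<Rightarrow> 'f"
  Cod2 :: "'c \<Rightarrow> 'f"
  Id2 :: "'f \<Rightarrow> 'c"
  VComp :: "'c \<Rightarrow> 'c \<Rightarrow> 'c"
  HComp :: "'c \<Rightarrow> 'c \<Rightarrow> 'c"

locale two_category =
  fixes K :: "('o, 'f, 'c) two_cat"
  assumes cat1: "category \<lparr>Ob = Obj K, Ar = Cell1 K, Dom = Src K, Cod = Trg K,
      Idn = Id1 K, Cmp = Comp1 K\<rparr>"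
    and vert: "category \<lparr>Ob = Cell1 K, Ar = Cell2 K, Dom = Dom2 K, Cod = Cod2 K,
      Idn = Id2 K, Cmp = VComp K\<rparr>"
    and horiz: "category \<lparr>Ob = Obj K, Ar = Cell2 K, Dom = (\<lambda>\<alpha>. Src K (Dom2 K \<alpha>)),
      Cod = (\<lambda>\<alpha>. Trg K (Dom2 K \<alpha>)), Idn = (\<lambda>a. Id2 K (Id1 K a)), Cmp = HComp K\<rparr>"
    and src_cod2: "\<alpha> \<in> Cell2 K \<Longrightarrow> Src K (Cod2 K \<alpha>) = Src K (Dom2 K \<alpha>)"
    and trg_cod2: "\<alpha> \<in> Cell2 K \<Longrightarrow> Trg K (Cod2 K \<alpha>) = Trg K (Dom2 K \<alpha>)"
    and dom_hcomp: "\<lbrakk>\<beta> \<in> Cell2 K; \<alpha> \<in> Cell2 K; Src K (Dom2 K \<beta>) = Trg K (Dom2 K \<alpha>)\<rbrakk>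
      \<Longrightarrow> Dom2 K (HComp K \<beta> \<alpha>) = Comp1 K (Dom2 K \<beta>) (Dom2 K \<alpha>)"
    and cod_hcomp: "\<lbrakk>\<beta> \<in> Cell2 K; \<alpha> \<in> Cell2 K; Src K (Dom2 K \<beta>) = Trg K (Dom2 K \<alpha>)\<rbrakk>
      \<Longrightarrow> Cod2 K (HComp K \<beta> \<alpha>) = Comp1 K (Cod2 K \<beta>) (Cod2 K \<alpha>)"
    and hcomp_id2: "\<lbrakk>g \<in> Cell1 K; f \<in> Cell1 K; Src K g = Trg K f\<rbrakk>
      \<Longrightarrow> HComp K (Id2 K g) (Id2 K f) = Id2 K (Comp1 K g f)"
    and interchange: "\<lbrakk>\<alpha> \<in> Cell2 K; \<alpha>' \<in> Cell2 K; \<beta> \<in> Cell2 K; \<beta>' \<in> Cell2 K;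
        Dom2 K \<alpha>' = Cod2 K \<alpha>; Dom2 K \<beta>' = Cod2 K \<beta>; Src K (Dom2 K \<beta>) = Trg K (Dom2 K \<alpha>)\<rbrakk>
      \<Longrightarrow> HComp K (VComp K \<beta>' \<beta>) (VComp K \<alpha>' \<alpha>) = VComp K (HComp K \<beta>' \<alpha>') (HComp K \<beta> \<alpha>)"

definition homcat :: "('o, 'f, 'c) two_cat \<Rightarrow> 'o \<Rightarrow> 'o \<Rightarrow> ('f, 'c) cat" where
  "homcat K a b = \<lparr>Ob = {f \<in> Cell1 K. Src K f = a \<and> Trg K f = b},
     Ar = {\<alpha> \<in> Cell2 K. Src K (Dom2 K \<alpha>) = a \<and> Trg K (Dom2 K \<alpha>) = b},
     Dom = Dom2 K, Cod = Cod2 K, Idn = Id2 K, Cmp = VComp K\<rparr>"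

definition inverse2 :: "('o, 'f, 'c) two_cat \<Rightarrow> 'c \<Rightarrow> 'c \<Rightarrow> bool" where
  "inverse2 K \<alpha> \<beta> \<longleftrightarrow> \<alpha> \<in> Cell2 K \<and> \<beta> \<in> Cell2 K \<and>
     Dom2 K \<beta> = Cod2 K \<alpha> \<and> Cod2 K \<beta> = Dom2 K \<alpha> \<and>
     VComp K \<beta> \<alpha> = Id2 K (Dom2 K \<alpha>) \<and> VComp K \<alpha> \<beta> = Id2 K (Cod2 K \<alpha>)"

definition iso2 :: "('o, 'f, 'c) two_cat \<Rightarrow> 'c \<Rightarrow> bool" where
  "iso2 K \<alpha> \<longleftrightarrow> (\<exists>\<beta>. inverse2 K \<alpha> \<beta>)"

definition inv2 :: "('o, 'f, 'c) two_cat \<Rightarrow> 'c \<Rightarrow> 'c" where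
  "inv2 K \<alpha> = (SOME \<beta>. inverse2 K \<alpha> \<beta>)"

definition equivalence1 :: "('o, 'f, 'c) two_cat \<Rightarrow> 'f \<Rightarrow> bool" where
  "equivalence1 K f \<longleftrightarrow> f \<in> Cell1 K \<and>
     (\<exists>g \<eta> \<epsilon>. g \<in> Cell1 K \<and> Src K g = Trg K f \<and> Trg K g = Src K f \<and>
        iso2 K \<eta> \<and> Dom2 K \<eta> = Id1 K (Src K f) \<and> Cod2 K \<eta> = Comp1 K g f \<and>
        iso2 K \<epsilon> \<and> Dom2 K \<epsilon> = Comp1 K f g \<and> Cod2 K \<epsilon> = Id1 K (Trg K f))"

definition op2 :: "('o, 'f, 'c) two_cat \<Rightarrow> ('o, 'f, 'c) two_cat" where  \<comment> \<open>reverses 1-cells only\<close>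
  "op2 K = K\<lparr>Src := Trg K, Trg := Src K, Comp1 := (\<lambda>g f. Comp1 K f g),
     HComp := (\<lambda>\<beta> \<alpha>. HComp K \<alpha> \<beta>)\<rparr>"

definition prod2 :: "('o, 'f, 'c) two_cat \<Rightarrow> ('p, 'g, 'd) two_cat
    \<Rightarrow> ('o \<times> 'p, 'f \<times> 'g, 'c \<times> 'd) two_cat" where
  "prod2 K L = \<lparr>Obj = Obj K \<times> Obj L, Cell1 = Cell1 K \<times> Cell1 L, Cell2 = Cell2 K \<times> Cell2 L,
     Src = map_prod (Src K) (Src L), Trg = map_prod (Trg K) (Trg L),
     Id1 = map_prod (Id1 K) (Id1 L),
     Comp1 = (\<lambda>(g, g') (f, f'). (Comp1 K g f, Comp1 L g' f')),
     Dom2 = map_prod (Dom2 K) (Dom2 L), Cod2 = map_prod (Cod2 K) (Cod2 L),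
     Id2 = map_prod (Id2 K) (Id2 L),
     VComp = (\<lambda>(\<beta>, \<beta>') (\<alpha>, \<alpha>'). (VComp K \<beta> \<alpha>, VComp L \<beta>' \<alpha>')),
     HComp = (\<lambda>(\<beta>, \<beta>') (\<alpha>, \<alpha>'). (HComp K \<beta> \<alpha>, HComp L \<beta>' \<alpha>'))\<rparr>"

text \<open>The 2-category of categories whose objects and arrows are drawn from the types \<open>'o\<close> and
  \<open>'a\<close>, which play the role of the universe.\<close>

definition CAT :: "(('o, 'a) cat, ('o, 'a) ftr, ('o, 'a) ntr) two_cat" where
  "CAT = \<lparr>Obj = {C. category C}, Cell1 = {F. is_functor F}, Cell2 = {t. is_nat t},
     Src = FS, Trg = FT, Id1 = ftr_id, Comp1 = ftr_comp, Dom2 = TS, Cod2 = TT,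
     Id2 = (\<lambda>F. \<lparr>TS = F, TT = F, TC = (\<lambda>x\<in>Ob (FS F). Idn (FT F) (FO F x))\<rparr>),
     VComp = (\<lambda>s t. \<lparr>TS = TS t, TT = TT s,
        TC = (\<lambda>x\<in>Ob (FS (TS t)). Cmp (FT (TS t)) (TC s x) (TC t x))\<rparr>),
     HComp = (\<lambda>s t. \<lparr>TS = ftr_comp (TS s) (TS t), TT = ftr_comp (TT s) (TT t),
        TC = (\<lambda>x\<in>Ob (FS (TS t)).
          Cmp (FT (TS s)) (TC s (FO (TT t) x)) (FA (TS s) (TC t x)))\<rparr>)\<rparr>"

definition composable :: "('o, 'f, 'c) two_cat \<Rightarrow> ('f \<times> 'f) set" where
  "composable K = {(g, f). g \<in> Cell1 K \<and> f \<in> Cell1 K \<and> Src K g = Trg K f}"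

record ('o, 'f, 'c, 'p, 'g, 'd) psf =
  P0 :: "'o \<Rightarrow> 'p"
  P1 :: "'f \<Rightarrow> 'g"
  P2 :: "'c \<Rightarrow> 'd"
  PC :: "'f \<times> 'f \<Rightarrow> 'd"  \<comment> \<open>\<open>PC F (g, f) : F(g) F(f) \<Rightarrow> F(g f)\<close>\<close>
  PI :: "'o \<Rightarrow> 'd"       \<comment> \<open>\<open>PI F a : id \<Rightarrow> F(id)\<close>\<close>

locale pseudofunctor =
  fixes K :: "('o, 'f, 'c) two_cat" and L :: "('p, 'g, 'd) two_cat"
    and F :: "('o, 'f, 'c, 'p, 'g, 'd) psf"
  assumes p0_ext: "P0 F \<in> extensional (Obj K)"
    and p1_ext: "P1 F \<in> extensional (Cell1 K)"
    and p2_ext: "P2 F \<in> extensional (Cell2 K)"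
    and pc_ext: "PC F \<in> extensional (composable K)"
    and pi_ext: "PI F \<in> extensional (Obj K)"
    and p0_in: "a \<in> Obj K \<Longrightarrow> P0 F a \<in> Obj L"
    and p1_in: "f \<in> Cell1 K \<Longrightarrow> P1 F f \<in> Cell1 L"
    and p1_src: "f \<in> Cell1 K \<Longrightarrow> Src L (P1 F f) = P0 F (Src K f)"
    and p1_trg: "f \<in> Cell1 K \<Longrightarrow> Trg L (P1 F f) = P0 F (Trg K f)"
    and p2_in: "\<alpha> \<in> Cell2 K \<Longrightarrow> P2 F \<alpha> \<in> Cell2 L"
    and p2_dom: "\<alpha> \<in> Cell2 K \<Longrightarrow> Dom2 L (P2 F \<alpha>) = P1 F (Dom2 K \<alpha>)"
    and p2_cod: "\<alpha> \<in> Cell2 K \<Longrightarrow> Cod2 L (P2 F \<alpha>) = P1 F (Cod2 K \<alpha>)"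
    and p2_id: "f \<in> Cell1 K \<Longrightarrow> P2 F (Id2 K f) = Id2 L (P1 F f)"
    and p2_vcomp: "\<lbrakk>\<beta> \<in> Cell2 K; \<alpha> \<in> Cell2 K; Dom2 K \<beta> = Cod2 K \<alpha>\<rbrakk>
      \<Longrightarrow> P2 F (VComp K \<beta> \<alpha>) = VComp L (P2 F \<beta>) (P2 F \<alpha>)"
    and pc_iso: "(g, f) \<in> composable K \<Longrightarrow> iso2 L (PC F (g, f))"
    and pc_dom: "(g, f) \<in> composable K \<Longrightarrow> Dom2 L (PC F (g, f)) = Comp1 L (P1 F g) (P1 F f)"
    and pc_cod: "(g, f) \<in> composable K \<Longrightarrow> Cod2 L (PC F (g, f)) = P1 F (Comp1 K g f)"
    and pi_iso: "a \<in> Obj K \<Longrightarrow> iso2 L (PI F a)"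
    and pi_dom: "a \<in> Obj K \<Longrightarrow> Dom2 L (PI F a) = Id1 L (P0 F a)"
    and pi_cod: "a \<in> Obj K \<Longrightarrow> Cod2 L (PI F a) = P1 F (Id1 K a)"
    and pc_nat: "\<lbrakk>\<beta> \<in> Cell2 K; \<alpha> \<in> Cell2 K; Src K (Dom2 K \<beta>) = Trg K (Dom2 K \<alpha>)\<rbrakk>
      \<Longrightarrow> VComp L (P2 F (HComp K \<beta> \<alpha>)) (PC F (Dom2 K \<beta>, Dom2 K \<alpha>))
        = VComp L (PC F (Cod2 K \<beta>, Cod2 K \<alpha>)) (HComp L (P2 F \<beta>) (P2 F \<alpha>))"
    and pc_assoc: "\<lbrakk>(h, g) \<in> composable K; (g, f) \<in> composable K\<rbrakk>
      \<Longrightarrow> VComp L (PC F (Comp1 K h g, f)) (HComp L (PC F (h, g)) (Id2 L (P1 F f)))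
        = VComp L (PC F (h, Comp1 K g f)) (HComp L (Id2 L (P1 F h)) (PC F (g, f)))"
    and pi_right: "f \<in> Cell1 K \<Longrightarrow>
      VComp L (PC F (f, Id1 K (Src K f))) (HComp L (Id2 L (P1 F f)) (PI F (Src K f)))
        = Id2 L (P1 F f)"
    and pi_left: "f \<in> Cell1 K \<Longrightarrow>
      VComp L (PC F (Id1 K (Trg K f), f)) (HComp L (PI F (Trg K f)) (Id2 L (P1 F f)))
        = Id2 L (P1 F f)"

record ('o, 'f, 'c, 'p, 'g, 'd) psn =
  NS :: "('o, 'f, 'c, 'p, 'g, 'd) psf"
  NT :: "('o, 'f, 'c, 'p, 'g, 'd) psf"
  N1 :: "'o \<Rightarrow> 'g"
  N2 :: "'f \<Rightarrow> 'd"  \<comment> \<open>for \<open>f : a \<rightarrow> b\<close>, \<open>N2 f : T(f) N1(a) \<Rightarrow> N1(b) S(f)\<close> (\<open>S\<close>, \<open>T\<close> source and target)\<close>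

locale pseudonat =
  fixes K :: "('o, 'f, 'c) two_cat" and L :: "('p, 'g, 'd) two_cat"
    and n :: "('o, 'f, 'c, 'p, 'g, 'd) psn"
  assumes src_psf: "pseudofunctor K L (NS n)"
    and trg_psf: "pseudofunctor K L (NT n)"
    and n1_ext: "N1 n \<in> extensional (Obj K)"
    and n2_ext: "N2 n \<in> extensional (Cell1 K)"
    and n1_in: "a \<in> Obj K \<Longrightarrow> N1 n a \<in> Cell1 L"
    and n1_src: "a \<in> Obj K \<Longrightarrow> Src L (N1 n a) = P0 (NS n) a"
    and n1_trg: "a \<in> Obj K \<Longrightarrow> Trg L (N1 n a) = P0 (NT n) a"
    and n2_iso: "f \<in> Cell1 K \<Longrightarrow> iso2 L (N2 n f)"
    and n2_dom: "f \<in> Cell1 K \<Longrightarrow> Dom2 L (N2 n f) = Comp1 L (P1 (NT n) f) (N1 n (Src K f))"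
    and n2_cod: "f \<in> Cell1 K \<Longrightarrow> Cod2 L (N2 n f) = Comp1 L (N1 n (Trg K f)) (P1 (NS n) f)"
    and n2_nat: "\<alpha> \<in> Cell2 K \<Longrightarrow>
      VComp L (N2 n (Cod2 K \<alpha>)) (HComp L (P2 (NT n) \<alpha>) (Id2 L (N1 n (Src K (Dom2 K \<alpha>)))))
        = VComp L (HComp L (Id2 L (N1 n (Trg K (Dom2 K \<alpha>)))) (P2 (NS n) \<alpha>)) (N2 n (Dom2 K \<alpha>))"
    and n2_comp: "(g, f) \<in> composable K \<Longrightarrow>
      VComp L (N2 n (Comp1 K g f)) (HComp L (PC (NT n) (g, f)) (Id2 L (N1 n (Src K f))))
        = VComp L (HComp L (Id2 L (N1 n (Trg K g))) (PC (NS n) (g, f)))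
            (VComp L (HComp L (N2 n g) (Id2 L (P1 (NS n) f)))
                     (HComp L (Id2 L (P1 (NT n) g)) (N2 n f)))"
    and n2_id: "a \<in> Obj K \<Longrightarrow>
      VComp L (N2 n (Id1 K a)) (HComp L (PI (NT n) a) (Id2 L (N1 n a)))
        = HComp L (Id2 L (N1 n a)) (PI (NS n) a)"

record ('o, 'f, 'c, 'p, 'g, 'd) mdf =
  MS :: "('o, 'f, 'c, 'p, 'g, 'd) psn"
  MT :: "('o, 'f, 'c, 'p, 'g, 'd) psn"
  MC :: "'o \<Rightarrow> 'd"

locale modification =
  fixes K :: "('o, 'f, 'c) two_cat" and L :: "('p, 'g, 'd) two_cat"
    and m :: "('o, 'f, 'c, 'p, 'g, 'd) mdf"
  assumes src_psn: "pseudonat K L (MS m)"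
    and trg_psn: "pseudonat K L (MT m)"
    and par_ns: "NS (MT m) = NS (MS m)"
    and par_nt: "NT (MT m) = NT (MS m)"
    and mc_ext: "MC m \<in> extensional (Obj K)"
    and mc_in: "a \<in> Obj K \<Longrightarrow> MC m a \<in> Cell2 L"
    and mc_dom: "a \<in> Obj K \<Longrightarrow> Dom2 L (MC m a) = N1 (MS m) a"
    and mc_cod: "a \<in> Obj K \<Longrightarrow> Cod2 L (MC m a) = N1 (MT m) a"
    and mc_nat: "f \<in> Cell1 K \<Longrightarrow>
      VComp L (N2 (MT m) f) (HComp L (Id2 L (P1 (NT (MS m)) f)) (MC m (Src K f)))
        = VComp L (HComp L (MC m (Trg K f)) (Id2 L (P1 (NS (MS m)) f))) (N2 (MS m) f)"

definition psn_id :: "('o, 'f, 'c) two_cat \<Rightarrow> ('p, 'g, 'd) two_cat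
    \<Rightarrow> ('o, 'f, 'c, 'p, 'g, 'd) psf \<Rightarrow> ('o, 'f, 'c, 'p, 'g, 'd) psn" where
  "psn_id K L F = \<lparr>NS = F, NT = F, N1 = (\<lambda>a\<in>Obj K. Id1 L (P0 F a)),
     N2 = (\<lambda>f\<in>Cell1 K. Id2 L (P1 F f))\<rparr>"

definition psn_comp :: "('o, 'f, 'c) two_cat \<Rightarrow> ('p, 'g, 'd) two_cat
    \<Rightarrow> ('o, 'f, 'c, 'p, 'g, 'd) psn \<Rightarrow> ('o, 'f, 'c, 'p, 'g, 'd) psn
    \<Rightarrow> ('o, 'f, 'c, 'p, 'g, 'd) psn" where
  "psn_comp K L n' n = \<lparr>NS = NS n, NT = NT n',
     N1 = (\<lambda>a\<in>Obj K. Comp1 L (N1 n' a) (N1 n a)),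
     N2 = (\<lambda>f\<in>Cell1 K. VComp L (HComp L (Id2 L (N1 n' (Trg K f))) (N2 n f))
                                (HComp L (N2 n' f) (Id2 L (N1 n (Src K f)))))\<rparr>"

definition PS :: "('o, 'f, 'c) two_cat \<Rightarrow> ('p, 'g, 'd) two_cat
    \<Rightarrow> (('o, 'f, 'c, 'p, 'g, 'd) psf, ('o, 'f, 'c, 'p, 'g, 'd) psn,
        ('o, 'f, 'c, 'p, 'g, 'd) mdf) two_cat" where
  "PS K L = \<lparr>Obj = {F. pseudofunctor K L F}, Cell1 = {n. pseudonat K L n},
     Cell2 = {m. modification K L m},
     Src = NS, Trg = NT, Id1 = psn_id K L, Comp1 = psn_comp K L, Dom2 = MS, Cod2 = MT,
     Id2 = (\<lambda>n. \<lparr>MS = n, MT = n, MC = (\<lambda>a\<in>Obj K. Id2 L (N1 n a))\<rparr>),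
     VComp = (\<lambda>m' m. \<lparr>MS = MS m, MT = MT m',
        MC = (\<lambda>a\<in>Obj K. VComp L (MC m' a) (MC m a))\<rparr>),
     HComp = (\<lambda>m' m. \<lparr>MS = psn_comp K L (MS m') (MS m), MT = psn_comp K L (MT m') (MT m),
        MC = (\<lambda>a\<in>Obj K. HComp L (MC m' a) (MC m a))\<rparr>)\<rparr>"

text \<open>A pseudofunctor with identity coherence cells (a 2-functor) from its action on cells.\<close>

definition strict_psf :: "('o, 'f, 'c) two_cat \<Rightarrow> ('p, 'g, 'd) two_cat
    \<Rightarrow> ('o \<Rightarrow> 'p) \<Rightarrow> ('f \<Rightarrow> 'g) \<Rightarrow> ('c \<Rightarrow> 'd) \<Rightarrow> ('o, 'f, 'c, 'p, 'g, 'd) psf" where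
  "strict_psf K L F0 F1 F2 = \<lparr>P0 = restrict F0 (Obj K), P1 = restrict F1 (Cell1 K),
     P2 = restrict F2 (Cell2 K),
     PC = restrict (\<lambda>(g, f). Id2 L (F1 (Comp1 K g f))) (composable K),
     PI = restrict (\<lambda>a. Id2 L (F1 (Id1 K a))) (Obj K)\<rparr>"

text \<open>For \<open>f : a' \<rightarrow> a\<close> and \<open>g : b \<rightarrow> b'\<close>, the functor
  \<open>K(f, g) = (x \<mapsto> g x f) : K(a, b) \<rightarrow> K(a', b')\<close>; for \<open>\<phi> : f \<Rightarrow> f'\<close> and \<open>\<psi> : g \<Rightarrow> g'\<close>, the
  natural transformation \<open>K(\<phi>, \<psi>) : K(f, g) \<Rightarrow> K(f', g')\<close>.\<close>

definition hom_ftr :: "('o, 'f, 'c) two_cat \<Rightarrow> 'f \<Rightarrow> 'f \<Rightarrow> ('f, 'c) ftr" where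
  "hom_ftr K f g = \<lparr>FS = homcat K (Trg K f) (Src K g), FT = homcat K (Src K f) (Trg K g),
     FO = (\<lambda>x\<in>Ob (homcat K (Trg K f) (Src K g)). Comp1 K g (Comp1 K x f)),
     FA = (\<lambda>\<xi>\<in>Ar (homcat K (Trg K f) (Src K g)). HComp K (Id2 K g) (HComp K \<xi> (Id2 K f)))\<rparr>"

definition hom_ntr :: "('o, 'f, 'c) two_cat \<Rightarrow> 'c \<Rightarrow> 'c \<Rightarrow> ('f, 'c) ntr" where
  "hom_ntr K \<phi> \<psi> = \<lparr>TS = hom_ftr K (Dom2 K \<phi>) (Dom2 K \<psi>), TT = hom_ftr K (Cod2 K \<phi>) (Cod2 K \<psi>),
     TC = (\<lambda>x\<in>Ob (homcat K (Trg K (Dom2 K \<phi>)) (Src K (Dom2 K \<psi>))).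
        HComp K \<psi> (HComp K (Id2 K x) \<phi>))\<rparr>"

definition hom_psf :: "('o, 'f, 'c) two_cat
    \<Rightarrow> ('o \<times> 'o, 'f \<times> 'f, 'c \<times> 'c, ('f, 'c) cat, ('f, 'c) ftr, ('f, 'c) ntr) psf" where
  "hom_psf K = strict_psf (prod2 (op2 K) K) CAT
     (\<lambda>(a, b). homcat K a b) (\<lambda>(f, g). hom_ftr K f g) (\<lambda>(\<phi>, \<psi>). hom_ntr K \<phi> \<psi>)"

text \<open>\<open>H(A-, B-)\<close>, i.e. the composite of \<open>hom_psf H\<close> with \<open>A\<^sup>o\<^sup>p \<times> B\<close>, and its (2-functorial)
  dependence on \<open>A\<close> and \<open>B\<close>. Since \<open>N2 \<gamma> u\<close> for \<open>\<gamma> : A' \<Rightarrow> A\<close> points against the direction needed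
  for \<open>H(A-, B-) \<Rightarrow> H(A'-, B'-)\<close>, its inverse appears.\<close>

definition hom_comp_psf :: "('o, 'f, 'c) two_cat \<Rightarrow> ('p, 'g, 'd) two_cat
    \<Rightarrow> ('o, 'f, 'c, 'p, 'g, 'd) psf \<Rightarrow> ('o, 'f, 'c, 'p, 'g, 'd) psf
    \<Rightarrow> ('o \<times> 'o, 'f \<times> 'f, 'c \<times> 'c, ('g, 'd) cat, ('g, 'd) ftr, ('g, 'd) ntr) psf" where
  "hom_comp_psf K H A B = \<lparr>
     P0 = (\<lambda>(a, b)\<in>Obj (prod2 (op2 K) K). homcat H (P0 A a) (P0 B b)),
     P1 = (\<lambda>(u, v)\<in>Cell1 (prod2 (op2 K) K). hom_ftr H (P1 A u) (P1 B v)),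
     P2 = (\<lambda>(\<phi>, \<psi>)\<in>Cell2 (prod2 (op2 K) K). hom_ntr H (P2 A \<phi>) (P2 B \<psi>)),
     PC = (\<lambda>((u', v'), (u, v))\<in>composable (prod2 (op2 K) K).
             hom_ntr H (PC A (u, u')) (PC B (v', v))),
     PI = (\<lambda>(a, b)\<in>Obj (prod2 (op2 K) K). hom_ntr H (PI A a) (PI B b))\<rparr>"

definition hom_comp_psn :: "('o, 'f, 'c) two_cat \<Rightarrow> ('p, 'g, 'd) two_cat
    \<Rightarrow> ('o, 'f, 'c, 'p, 'g, 'd) psn \<Rightarrow> ('o, 'f, 'c, 'p, 'g, 'd) psn
    \<Rightarrow> ('o \<times> 'o, 'f \<times> 'f, 'c \<times> 'c, ('g, 'd) cat, ('g, 'd) ftr, ('g, 'd) ntr) psn" where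
  "hom_comp_psn K H \<gamma> \<delta> = \<lparr>
     NS = hom_comp_psf K H (NT \<gamma>) (NS \<delta>), NT = hom_comp_psf K H (NS \<gamma>) (NT \<delta>),
     N1 = (\<lambda>(a, b)\<in>Obj (prod2 (op2 K) K). hom_ftr H (N1 \<gamma> a) (N1 \<delta> b)),
     N2 = (\<lambda>(u, v)\<in>Cell1 (prod2 (op2 K) K). hom_ntr H (inv2 H (N2 \<gamma> u)) (N2 \<delta> v))\<rparr>"

definition hom_comp_mdf :: "('o, 'f, 'c) two_cat \<Rightarrow> ('p, 'g, 'd) two_cat
    \<Rightarrow> ('o, 'f, 'c, 'p, 'g, 'd) mdf \<Rightarrow> ('o, 'f, 'c, 'p, 'g, 'd) mdf
    \<Rightarrow> ('o \<times> 'o, 'f \<times> 'f, 'c \<times> 'c, ('g, 'd) cat, ('g, 'd) ftr, ('g, 'd) ntr) mdf" where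
  "hom_comp_mdf K H m m' = \<lparr>
     MS = hom_comp_psn K H (MS m) (MS m'), MT = hom_comp_psn K H (MT m) (MT m'),
     MC = (\<lambda>(a, b)\<in>Obj (prod2 (op2 K) K). hom_ntr H (MC m a) (MC m' b))\<rparr>"

text \<open>Two pseudofunctors with values in \<open>CAT\<close> over different types are compared after being
  transported along injections \<open>i\<close>, \<open>j\<close> (below always \<open>Inl\<close> or \<open>Inr\<close>) of objects and arrows
  into a common type; this replaces a category by an isomorphic copy.\<close>

definition cat_map :: "('o \<Rightarrow> 'p) \<Rightarrow> ('a \<Rightarrow> 'b) \<Rightarrow> ('o, 'a) cat \<Rightarrow> ('p, 'b) cat" where
  "cat_map i j C = \<lparr>Ob = i ` Ob C, Ar = j ` Ar C,
     Dom = (\<lambda>f. i (Dom C (inv j f))), Cod = (\<lambda>f. i (Cod C (inv j f))),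
     Idn = (\<lambda>x. j (Idn C (inv i x))), Cmp = (\<lambda>g f. j (Cmp C (inv j g) (inv j f)))\<rparr>"

definition ftr_map :: "('o \<Rightarrow> 'p) \<Rightarrow> ('a \<Rightarrow> 'b) \<Rightarrow> ('o, 'a) ftr \<Rightarrow> ('p, 'b) ftr" where
  "ftr_map i j F = \<lparr>FS = cat_map i j (FS F), FT = cat_map i j (FT F),
     FO = (\<lambda>x\<in>i ` Ob (FS F). i (FO F (inv i x))),
     FA = (\<lambda>f\<in>j ` Ar (FS F). j (FA F (inv j f)))\<rparr>"

definition ntr_map :: "('o \<Rightarrow> 'p) \<Rightarrow> ('a \<Rightarrow> 'b) \<Rightarrow> ('o, 'a) ntr \<Rightarrow> ('p, 'b) ntr" where
  "ntr_map i j t = \<lparr>TS = ftr_map i j (TS t), TT = ftr_map i j (TT t),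
     TC = (\<lambda>x\<in>i ` Ob (FS (TS t)). j (TC t (inv i x)))\<rparr>"

definition psf_map :: "('x \<Rightarrow> 'y) \<Rightarrow> ('a \<Rightarrow> 'b) \<Rightarrow> ('o, 'f, 'c) two_cat
    \<Rightarrow> ('o, 'f, 'c, ('x, 'a) cat, ('x, 'a) ftr, ('x, 'a) ntr) psf
    \<Rightarrow> ('o, 'f, 'c, ('y, 'b) cat, ('y, 'b) ftr, ('y, 'b) ntr) psf" where
  "psf_map i j K T = \<lparr>P0 = (\<lambda>a\<in>Obj K. cat_map i j (P0 T a)),
     P1 = (\<lambda>f\<in>Cell1 K. ftr_map i j (P1 T f)), P2 = (\<lambda>\<alpha>\<in>Cell2 K. ntr_map i j (P2 T \<alpha>)),
     PC = (\<lambda>p\<in>composable K. ntr_map i j (PC T p)), PI = (\<lambda>a\<in>Obj K. ntr_map i j (PI T a))\<rparr>"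

definition psn_map :: "('x \<Rightarrow> 'y) \<Rightarrow> ('a \<Rightarrow> 'b) \<Rightarrow> ('o, 'f, 'c) two_cat
    \<Rightarrow> ('o, 'f, 'c, ('x, 'a) cat, ('x, 'a) ftr, ('x, 'a) ntr) psn
    \<Rightarrow> ('o, 'f, 'c, ('y, 'b) cat, ('y, 'b) ftr, ('y, 'b) ntr) psn" where
  "psn_map i j K n = \<lparr>NS = psf_map i j K (NS n), NT = psf_map i j K (NT n),
     N1 = (\<lambda>a\<in>Obj K. ftr_map i j (N1 n a)), N2 = (\<lambda>f\<in>Cell1 K. ntr_map i j (N2 n f))\<rparr>"

definition mdf_map :: "('x \<Rightarrow> 'y) \<Rightarrow> ('a \<Rightarrow> 'b) \<Rightarrow> ('o, 'f, 'c) two_cat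
    \<Rightarrow> ('o, 'f, 'c, ('x, 'a) cat, ('x, 'a) ftr, ('x, 'a) ntr) mdf
    \<Rightarrow> ('o, 'f, 'c, ('y, 'b) cat, ('y, 'b) ftr, ('y, 'b) ntr) mdf" where
  "mdf_map i j K m = \<lparr>MS = psn_map i j K (MS m), MT = psn_map i j K (MT m),
     MC = (\<lambda>a\<in>Obj K. ntr_map i j (MC m a))\<rparr>"

text \<open>The ambient 2-category \<open>[K\<^sup>o\<^sup>p \<times> K, CAT]\<^sub>P\<^sub>S\<close>, with \<open>CAT\<close> over a universe containing both the
  cells of \<open>K\<close> and the values of \<open>T\<close>.\<close>

abbreviation PE :: "('o, 'f, 'c) two_cat \<Rightarrow>
   (('o \<times> 'o, 'f \<times> 'f, 'c \<times> 'c, ('f + 'x, 'c + 'y) cat, ('f + 'x, 'c + 'y) ftr, ('f + 'x, 'c + 'y) ntr) psf,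
    ('o \<times> 'o, 'f \<times> 'f, 'c \<times> 'c, ('f + 'x, 'c + 'y) cat, ('f + 'x, 'c + 'y) ftr, ('f + 'x, 'c + 'y) ntr) psn,
    ('o \<times> 'o, 'f \<times> 'f, 'c \<times> 'c, ('f + 'x, 'c + 'y) cat, ('f + 'x, 'c + 'y) ftr, ('f + 'x, 'c + 'y) ntr) mdf)
   two_cat" where
  "PE K \<equiv> PS (prod2 (op2 K) K) CAT"

abbreviation hom_PE :: "('o, 'f, 'c) two_cat \<Rightarrow>
    ('o \<times> 'o, 'f \<times> 'f, 'c \<times> 'c, ('f + 'x, 'c + 'y) cat, ('f + 'x, 'c + 'y) ftr, ('f + 'x, 'c + 'y) ntr) psf"
  where "hom_PE K \<equiv> psf_map Inl Inl (prod2 (op2 K) K) (hom_psf K)"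

definition pseudoend where
  "pseudoend K T = homcat (PE K) (hom_PE K) (psf_map Inr Inr (prod2 (op2 K) K) T)"

text \<open>Functoriality of the pseudoend in \<open>T\<close>, by postcomposition.\<close>

definition pseudoend_ftr where
  "pseudoend_ftr K n =
     hom_ftr (PE K) (Id1 (PE K) (hom_PE K)) (psn_map Inr Inr (prod2 (op2 K) K) n)"

definition pseudoend_ntr where
  "pseudoend_ntr K m =
     hom_ntr (PE K) (Id2 (PE K) (Id1 (PE K) (hom_PE K))) (mdf_map Inr Inr (prod2 (op2 K) K) m)"

text \<open>\<open>(A, B) \<mapsto> \<integral>\<^sub>a H(A a, B a)\<close> as a pseudofunctor \<open>([K, H]\<^sub>P\<^sub>S)\<^sup>o\<^sup>p \<times> [K, H]\<^sub>P\<^sub>S \<rightarrow> CAT\<close>.\<close>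

definition pseudoend_hom_psf where
  "pseudoend_hom_psf K H = strict_psf (prod2 (op2 (PS K H)) (PS K H)) CAT
     (\<lambda>(A, B). pseudoend K (hom_comp_psf K H A B))
     (\<lambda>(\<gamma>, \<delta>). pseudoend_ftr K (hom_comp_psn K H \<gamma> \<delta>))
     (\<lambda>(m, m'). pseudoend_ntr K (hom_comp_mdf K H m m'))"

text \<open>Equivalences in \<open>CAT\<close> being equivalences of categories, for \<open>L = CAT\<close> this says that the
  component of \<open>n\<close> at every object is an equivalence of categories.\<close>

definition pseudonat_equivalence where
  "pseudonat_equivalence K L S T n \<longleftrightarrow>
     pseudonat K L n \<and> NS n = S \<and> NT n = T \<and> (\<forall>a\<in>Obj K. equivalence1 L (N1 n a))"

end

theory Submission
  imports Defs
begin

text \<open>An object \<open>x\<close> of the pseudoend assigns to \<open>u : a \<rightarrow> b\<close> a 1-cell \<open>X u : A a \<rightarrow> B b\<close>, with invertible coherent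
  cells \<open>B g \<odot> X u \<Rightarrow> X (g \<odot> u)\<close> and \<open>X u \<odot> A f \<Rightarrow> X (u \<odot> f)\<close>. Evaluation at identities sends it to the
  pseudonatural transformation with components \<open>X (id a)\<close>, whose cell at \<open>u\<close> is the composite
  \<open>B u \<odot> X (id a) \<Rightarrow> X u \<Rightarrow> X (id b) \<odot> A u\<close>. This functor is strictly natural in \<open>A\<close> and \<open>B\<close>. As in the Yoneda
  lemma, a quasi-inverse sends \<open>\<sigma> : A \<Rightarrow> B\<close> to the image under \<open>\<sigma>\<close> of the action of \<open>A\<close> on hom categories: since
  evaluation is natural, its composite with evaluation is whiskering by the isomorphism \<open>PI A\<close>, and the other
  composite is isomorphic to the identity by the cells \<open>X (id b) \<odot> A u \<Rightarrow> X u\<close>.\<close>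

section \<open>Calculus in a 2-category\<close>

text \<open>What shapes the argument is the amount of coherence in an object of the pseudoend, whose
  structure cell \<open>\<theta> f g u\<close> mixes both variables. Units separate it into a left
  action by \<open>g\<close> and a right action by \<open>f\<close>; these commute, and the right
  action is invertible. Cells containing an inverse are therefore hardly ever manipulated: an
  equation about them is composed with an invertible right action and then becomes a statement about
  naturality, associativity, commutation or units of the actions. The weakness of A and B does not
  spread to the dependence on the pair (A, B): both sides of the equivalence are 2-functors of that
  pair, and evaluation commutes with whiskering on the nose. The resulting transformation can be
  completed by identity 2-cells, so the real work lies in its components. A further constraint is
  typing. \<open>CAT\<close> fixes one type of objects and one of arrows, whereas a pseudoend and a
  category of transformations live over different types. They are compared as bare functions, and
  tagged with \<open>Inl\<close> and \<open>Inr\<close> only to be placed in one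
  \<open>CAT\<close>.\<close>

notation Comp1 (infixr "\<odot>\<index>" 75)
  and HComp (infixr "\<star>\<index>" 70)
  and VComp (infixr "\<cdot>\<index>" 60)
  and Id2 ("\<iota>\<index>")

context two_category
begin

lemma cell1_simps [simp]:
  "f \<in> Cell1 K \<Longrightarrow> Src K f \<in> Obj K"
  "f \<in> Cell1 K \<Longrightarrow> Trg K f \<in> Obj K"
  "a \<in> Obj K \<Longrightarrow> Id1 K a \<in> Cell1 K"
  "a \<in> Obj K \<Longrightarrow> Src K (Id1 K a) = a"
  "a \<in> Obj K \<Longrightarrow> Trg K (Id1 K a) = a"
  "\<lbrakk>g \<in> Cell1 K; f \<in> Cell1 K; Src K g = Trg K f\<rbrakk> \<Longrightarrow> Comp1 K g f \<in> Cell1 K"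
  "\<lbrakk>g \<in> Cell1 K; f \<in> Cell1 K; Src K g = Trg K f\<rbrakk> \<Longrightarrow> Src K (Comp1 K g f) = Src K f"
  "\<lbrakk>g \<in> Cell1 K; f \<in> Cell1 K; Src K g = Trg K f\<rbrakk> \<Longrightarrow> Trg K (Comp1 K g f) = Trg K g"
  "\<lbrakk>f \<in> Cell1 K; a = Src K f\<rbrakk> \<Longrightarrow> Comp1 K f (Id1 K a) = f"
  "\<lbrakk>f \<in> Cell1 K; a = Trg K f\<rbrakk> \<Longrightarrow> Comp1 K (Id1 K a) f = f"
  using cat1 by (simp_all add: category_def)

lemma comp1_assoc [simp]:
  "\<lbrakk>h \<in> Cell1 K; g \<in> Cell1 K; f \<in> Cell1 K; Src K h = Trg K g; Src K g = Trg K f\<rbrakk>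
    \<Longrightarrow> Comp1 K (Comp1 K h g) f = Comp1 K h (Comp1 K g f)"
  using cat1 by (simp add: category_def)

lemma cell2_simps [simp]:
  "\<alpha> \<in> Cell2 K \<Longrightarrow> Dom2 K \<alpha> \<in> Cell1 K"
  "\<alpha> \<in> Cell2 K \<Longrightarrow> Cod2 K \<alpha> \<in> Cell1 K"
  "f \<in> Cell1 K \<Longrightarrow> Id2 K f \<in> Cell2 K"
  "f \<in> Cell1 K \<Longrightarrow> Dom2 K (Id2 K f) = f"
  "f \<in> Cell1 K \<Longrightarrow> Cod2 K (Id2 K f) = f"
  "\<lbrakk>\<beta> \<in> Cell2 K; \<alpha> \<in> Cell2 K; Dom2 K \<beta> = Cod2 K \<alpha>\<rbrakk> \<Longrightarrow> VComp K \<beta> \<alpha> \<in> Cell2 K"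
  "\<lbrakk>\<beta> \<in> Cell2 K; \<alpha> \<in> Cell2 K; Dom2 K \<beta> = Cod2 K \<alpha>\<rbrakk> \<Longrightarrow> Dom2 K (VComp K \<beta> \<alpha>) = Dom2 K \<alpha>"
  "\<lbrakk>\<beta> \<in> Cell2 K; \<alpha> \<in> Cell2 K; Dom2 K \<beta> = Cod2 K \<alpha>\<rbrakk> \<Longrightarrow> Cod2 K (VComp K \<beta> \<alpha>) = Cod2 K \<beta>"
  "\<lbrakk>\<alpha> \<in> Cell2 K; f = Dom2 K \<alpha>\<rbrakk> \<Longrightarrow> VComp K \<alpha> (Id2 K f) = \<alpha>"
  "\<lbrakk>\<alpha> \<in> Cell2 K; f = Cod2 K \<alpha>\<rbrakk> \<Longrightarrow> VComp K (Id2 K f) \<alpha> = \<alpha>"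
  using vert by (simp_all add: category_def)

lemma vcomp_assoc [simp]:
  "\<lbrakk>\<gamma> \<in> Cell2 K; \<beta> \<in> Cell2 K; \<alpha> \<in> Cell2 K; Dom2 K \<gamma> = Cod2 K \<beta>; Dom2 K \<beta> = Cod2 K \<alpha>\<rbrakk>
    \<Longrightarrow> VComp K (VComp K \<gamma> \<beta>) \<alpha> = VComp K \<gamma> (VComp K \<beta> \<alpha>)"
  using vert by (simp add: category_def)

declare src_cod2 [simp] trg_cod2 [simp] dom_hcomp [simp] cod_hcomp [simp] hcomp_id2 [simp]

lemma hcomp_simps [simp]:
  "\<lbrakk>\<beta> \<in> Cell2 K; \<alpha> \<in> Cell2 K; Src K (Dom2 K \<beta>) = Trg K (Dom2 K \<alpha>)\<rbrakk> \<Longrightarrow> HComp K \<beta> \<alpha> \<in> Cell2 K"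
  "\<lbrakk>\<alpha> \<in> Cell2 K; a = Src K (Dom2 K \<alpha>)\<rbrakk> \<Longrightarrow> HComp K \<alpha> (Id2 K (Id1 K a)) = \<alpha>"
  "\<lbrakk>\<alpha> \<in> Cell2 K; a = Trg K (Dom2 K \<alpha>)\<rbrakk> \<Longrightarrow> HComp K (Id2 K (Id1 K a)) \<alpha> = \<alpha>"
  using horiz by (simp_all add: category_def)

lemma hcomp_assoc [simp]:
  "\<lbrakk>\<gamma> \<in> Cell2 K; \<beta> \<in> Cell2 K; \<alpha> \<in> Cell2 K; Src K (Dom2 K \<gamma>) = Trg K (Dom2 K \<beta>);
      Src K (Dom2 K \<beta>) = Trg K (Dom2 K \<alpha>)\<rbrakk>
    \<Longrightarrow> HComp K (HComp K \<gamma> \<beta>) \<alpha> = HComp K \<gamma> (HComp K \<beta> \<alpha>)"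
  using horiz by (simp add: category_def)

lemma hcomp_vcomp:
  "\<lbrakk>\<alpha> \<in> Cell2 K; \<alpha>' \<in> Cell2 K; \<beta> \<in> Cell2 K; \<beta>' \<in> Cell2 K;
     Dom2 K \<alpha>' = Cod2 K \<alpha>; Dom2 K \<beta>' = Cod2 K \<beta>; Src K (Dom2 K \<beta>) = Trg K (Dom2 K \<alpha>)\<rbrakk>
   \<Longrightarrow> VComp K (HComp K \<beta>' \<alpha>') (HComp K \<beta> \<alpha>) = HComp K (VComp K \<beta>' \<beta>) (VComp K \<alpha>' \<alpha>)"
  by (simp add: interchange)

lemma whisker_left:
  "\<lbrakk>g \<in> Cell1 K; \<beta> \<in> Cell2 K; \<alpha> \<in> Cell2 K; Dom2 K \<beta> = Cod2 K \<alpha>; Src K g = Trg K (Dom2 K \<alpha>)\<rbrakk>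
    \<Longrightarrow> HComp K (Id2 K g) (VComp K \<beta> \<alpha>) = VComp K (HComp K (Id2 K g) \<beta>) (HComp K (Id2 K g) \<alpha>)"
  using interchange [of \<alpha> \<beta> "Id2 K g" "Id2 K g"] by simp

lemma whisker_right:
  "\<lbrakk>f \<in> Cell1 K; \<beta> \<in> Cell2 K; \<alpha> \<in> Cell2 K; Dom2 K \<beta> = Cod2 K \<alpha>; Src K (Dom2 K \<alpha>) = Trg K f\<rbrakk>
    \<Longrightarrow> HComp K (VComp K \<beta> \<alpha>) (Id2 K f) = VComp K (HComp K \<beta> (Id2 K f)) (HComp K \<alpha> (Id2 K f))"
  using interchange [of "Id2 K f" "Id2 K f" \<alpha> \<beta>] by simp

lemma inverse2_unique:
  assumes "inverse2 K \<alpha> \<beta>" "inverse2 K \<alpha> \<gamma>"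
  shows "\<beta> = \<gamma>"
proof -
  have "VComp K (VComp K \<beta> \<alpha>) \<gamma> = VComp K \<beta> (VComp K \<alpha> \<gamma>)"
    using assms by (intro vcomp_assoc) (auto simp: inverse2_def)
  then show ?thesis
    using assms by (simp add: inverse2_def)
qed

lemma inv2_eq: "inverse2 K \<alpha> \<beta> \<Longrightarrow> inv2 K \<alpha> = \<beta>"
  unfolding inv2_def using inverse2_unique by (metis someI)

lemma inverse2_inv2: "iso2 K \<alpha> \<Longrightarrow> inverse2 K \<alpha> (inv2 K \<alpha>)"
  unfolding iso2_def inv2_def by (rule someI_ex)

lemma inverse2_sym: "inverse2 K \<alpha> \<beta> \<Longrightarrow> inverse2 K \<beta> \<alpha>"
  by (auto simp: inverse2_def)

lemma iso2_cell2 [dest]: "iso2 K \<alpha> \<Longrightarrow> \<alpha> \<in> Cell2 K"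
  by (auto simp: iso2_def inverse2_def)

lemma inv2_simps [simp]:
  assumes "iso2 K \<alpha>"
  shows "iso2 K (inv2 K \<alpha>)" "inv2 K \<alpha> \<in> Cell2 K" "Dom2 K (inv2 K \<alpha>) = Cod2 K \<alpha>"
    "Cod2 K (inv2 K \<alpha>) = Dom2 K \<alpha>"
    "VComp K (inv2 K \<alpha>) \<alpha> = Id2 K (Dom2 K \<alpha>)" "VComp K \<alpha> (inv2 K \<alpha>) = Id2 K (Cod2 K \<alpha>)"
proof -
  show "iso2 K (inv2 K \<alpha>)"
    unfolding iso2_def by (blast intro: inverse2_sym inverse2_inv2 assms)
qed (use inverse2_inv2 [OF assms] in \<open>simp_all add: inverse2_def\<close>)

lemma inverse2_id2: "f \<in> Cell1 K \<Longrightarrow> inverse2 K (Id2 K f) (Id2 K f)"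
  by (simp add: inverse2_def)

lemma inverse2_vcomp:
  assumes "inverse2 K \<beta> \<beta>'" "inverse2 K \<alpha> \<alpha>'" "Dom2 K \<beta> = Cod2 K \<alpha>"
  shows "inverse2 K (VComp K \<beta> \<alpha>) (VComp K \<alpha>' \<beta>')"
proof -
  note d = assms [unfolded inverse2_def]
  have "VComp K \<alpha>' (VComp K \<beta>' (VComp K \<beta> \<alpha>)) = VComp K \<alpha>' (VComp K (VComp K \<beta>' \<beta>) \<alpha>)"
    using d by (subst vcomp_assoc) simp_all
  moreover have "VComp K \<beta> (VComp K \<alpha> (VComp K \<alpha>' \<beta>')) = VComp K \<beta> (VComp K (VComp K \<alpha> \<alpha>') \<beta>')"
    using d by (subst vcomp_assoc) simp_all
  ultimately show ?thesis
    using d by (simp add: inverse2_def)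
qed

lemma inverse2_hcomp:
  assumes "inverse2 K \<beta> \<beta>'" "inverse2 K \<alpha> \<alpha>'" "Src K (Dom2 K \<beta>) = Trg K (Dom2 K \<alpha>)"
  shows "inverse2 K (HComp K \<beta> \<alpha>) (HComp K \<beta>' \<alpha>')"
  using assms by (auto simp: inverse2_def hcomp_vcomp)

lemma iso2_id2 [simp]: "f \<in> Cell1 K \<Longrightarrow> iso2 K (Id2 K f)"
  unfolding iso2_def by (blast intro: inverse2_id2)

lemma iso2_vcomp [simp]:
  "\<lbrakk>iso2 K \<beta>; iso2 K \<alpha>; Dom2 K \<beta> = Cod2 K \<alpha>\<rbrakk> \<Longrightarrow> iso2 K (VComp K \<beta> \<alpha>)"
  unfolding iso2_def by (blast intro: inverse2_vcomp)

lemma iso2_hcomp [simp]: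
  "\<lbrakk>iso2 K \<beta>; iso2 K \<alpha>; Src K (Dom2 K \<beta>) = Trg K (Dom2 K \<alpha>)\<rbrakk> \<Longrightarrow> iso2 K (HComp K \<beta> \<alpha>)"
  unfolding iso2_def by (blast intro: inverse2_hcomp)

text \<open>Invertible cells are monic. Equations about a cell defined with \<open>inv2\<close> are
  reduced to equations free of inverses by composing with the cell that was inverted.\<close>

lemma iso2_cancel_left:
  assumes "iso2 K \<gamma>" "\<alpha> \<in> Cell2 K" "\<beta> \<in> Cell2 K" "Cod2 K \<alpha> = Dom2 K \<gamma>" "Cod2 K \<beta> = Dom2 K \<gamma>"
    and eq: "VComp K \<gamma> \<alpha> = VComp K \<gamma> \<beta>"
  shows "\<alpha> = \<beta>"
proof -
  have g: "\<gamma> \<in> Cell2 K" using assms(1) by blast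
  have "VComp K (VComp K (inv2 K \<gamma>) \<gamma>) \<alpha> = VComp K (VComp K (inv2 K \<gamma>) \<gamma>) \<beta>"
    using assms g by (simp del: inv2_simps(5,6))
  then show ?thesis using assms by simp
qed

lemma inv2_vcomp_eq:
  assumes "iso2 K \<gamma>" "\<alpha> \<in> Cell2 K" "Cod2 K \<alpha> = Cod2 K \<gamma>"
  shows "VComp K \<gamma> (VComp K (inv2 K \<gamma>) \<alpha>) = \<alpha>"
  using assms iso2_cell2 [OF assms(1)] by (simp flip: vcomp_assoc)

lemma hcomp_id2_merge [simp]:
  "\<lbrakk>h \<in> Cell1 K; g \<in> Cell1 K; \<alpha> \<in> Cell2 K; Src K h = Trg K g; Src K g = Trg K (Dom2 K \<alpha>)\<rbrakk>
    \<Longrightarrow> HComp K (Id2 K h) (HComp K (Id2 K g) \<alpha>) = HComp K (Id2 K (Comp1 K h g)) \<alpha>"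
  by (simp flip: hcomp_assoc hcomp_id2)

text \<open>Vertical composites are normalised to the right, so an equation for
  \<open>\<gamma>\<close> after \<open>\<beta>\<close> does not match inside a longer chain. This
  form rewrites such a pair in the middle of a chain.\<close>

lemma vcomp_reassoc:
  "\<lbrakk>VComp K \<gamma> \<beta> = \<delta>; \<gamma> \<in> Cell2 K; \<beta> \<in> Cell2 K; \<alpha> \<in> Cell2 K; Dom2 K \<gamma> = Cod2 K \<beta>; Dom2 K \<beta> = Cod2 K \<alpha>\<rbrakk>
    \<Longrightarrow> VComp K \<gamma> (VComp K \<beta> \<alpha>) = VComp K \<delta> \<alpha>"
  using vcomp_assoc by metis

lemma exchange:
  "\<lbrakk>\<beta> \<in> Cell2 K; \<alpha> \<in> Cell2 K; Src K (Dom2 K \<beta>) = Trg K (Dom2 K \<alpha>)\<rbrakk>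
    \<Longrightarrow> VComp K (HComp K (Id2 K (Cod2 K \<beta>)) \<alpha>) (HComp K \<beta> (Id2 K (Dom2 K \<alpha>)))
      = VComp K (HComp K \<beta> (Id2 K (Cod2 K \<alpha>))) (HComp K (Id2 K (Dom2 K \<beta>)) \<alpha>)"
  by (simp add: hcomp_vcomp)

text \<open>Since \<open>\<pi>\<close> starts at an identity 1-cell, \<open>\<rho>\<close> may be
  viewed as horizontally composed with the identity of that 1-cell, and interchange applies. In this
  way the unit cells \<open>PI\<close> occurring in the two actions are absorbed into neighbouring
  cells.\<close>

lemma unit_right:
  "\<lbrakk>\<rho> \<in> Cell2 K; \<pi> \<in> Cell2 K; Dom2 K \<pi> = Id1 K (Src K (Dom2 K \<rho>)); c = Cod2 K \<rho>\<rbrakk>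
    \<Longrightarrow> VComp K (HComp K (Id2 K c) \<pi>) \<rho> = HComp K \<rho> \<pi>"
  using hcomp_vcomp [of "Id2 K (Id1 K (Src K (Dom2 K \<rho>)))" \<pi> \<rho> "Id2 K c"] by simp

lemma unit_left:
  "\<lbrakk>\<rho> \<in> Cell2 K; \<pi> \<in> Cell2 K; Dom2 K \<pi> = Id1 K (Trg K (Dom2 K \<rho>)); c = Cod2 K \<rho>\<rbrakk>
    \<Longrightarrow> VComp K (HComp K \<pi> (Id2 K c)) \<rho> = HComp K \<pi> \<rho>"
  using hcomp_vcomp [of \<rho> "Id2 K c" "Id2 K (Id1 K (Trg K (Dom2 K \<rho>)))" \<pi>] by simp

text \<open>Interchange concentrated in the middle factor. It brings a whiskered cell and the unit
  cells around it into the shape in which \<open>left_act\<close> and \<open>right_act\<close> are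
  defined.\<close>

lemma whisker_both:
  "\<lbrakk>\<alpha> \<in> Cell2 K; \<beta> \<in> Cell2 K; \<gamma> \<in> Cell2 K; \<delta> \<in> Cell2 K; Dom2 K \<alpha> = Cod2 K \<beta>; g = Cod2 K \<gamma>; h = Cod2 K \<delta>;
     Src K (Dom2 K \<gamma>) = Trg K (Dom2 K \<beta>); Src K (Dom2 K \<beta>) = Trg K (Dom2 K \<delta>)\<rbrakk>
    \<Longrightarrow> VComp K (HComp K (Id2 K g) (HComp K \<alpha> (Id2 K h))) (HComp K \<gamma> (HComp K \<beta> \<delta>))
      = HComp K \<gamma> (HComp K (VComp K \<alpha> \<beta>) \<delta>)"
  by (simp add: hcomp_vcomp)

lemma hcomp_whisker:
  "\<lbrakk>\<beta> \<in> Cell2 K; \<alpha> \<in> Cell2 K; Src K (Dom2 K \<beta>) = Trg K (Dom2 K \<alpha>)\<rbrakk>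
    \<Longrightarrow> HComp K \<beta> \<alpha> = VComp K (HComp K (Id2 K (Cod2 K \<beta>)) \<alpha>) (HComp K \<beta> (Id2 K (Dom2 K \<alpha>)))"
  "\<lbrakk>\<beta> \<in> Cell2 K; \<alpha> \<in> Cell2 K; Src K (Dom2 K \<beta>) = Trg K (Dom2 K \<alpha>)\<rbrakk>
    \<Longrightarrow> HComp K \<beta> \<alpha> = VComp K (HComp K \<beta> (Id2 K (Cod2 K \<alpha>))) (HComp K (Id2 K (Dom2 K \<beta>)) \<alpha>)"
  by (simp_all add: hcomp_vcomp)

text \<open>A commuting square with two invertible opposite sides can be read backwards along them.
  This yields the axioms for the inverted squares of the contravariant variable and for the inverse
  of a modification.\<close>

lemma inv2_conjugate:
  assumes "VComp K \<beta> \<xi> = VComp K \<zeta> \<alpha>" "iso2 K \<alpha>" "iso2 K \<beta>" "\<xi> \<in> Cell2 K" "\<zeta> \<in> Cell2 K"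
    "Dom2 K \<xi> = Dom2 K \<alpha>" "Cod2 K \<xi> = Dom2 K \<beta>" "Dom2 K \<zeta> = Cod2 K \<alpha>" "Cod2 K \<zeta> = Cod2 K \<beta>"
  shows "VComp K (inv2 K \<beta>) \<zeta> = VComp K \<xi> (inv2 K \<alpha>)"
proof (rule iso2_cancel_left [of \<beta>])
  have "VComp K (VComp K \<beta> \<xi>) (inv2 K \<alpha>) = VComp K (VComp K \<zeta> \<alpha>) (inv2 K \<alpha>)"
    by (simp only: assms(1))
  then show "VComp K \<beta> (VComp K (inv2 K \<beta>) \<zeta>) = VComp K \<beta> (VComp K \<xi> (inv2 K \<alpha>))"
    using assms(2-) iso2_cell2 [OF assms(2)] iso2_cell2 [OF assms(3)] by (simp add: inv2_vcomp_eq)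
qed (use assms iso2_cell2 [OF assms(2)] iso2_cell2 [OF assms(3)] in simp_all)

lemma inv2_distrib:
  "\<lbrakk>iso2 K \<beta>; iso2 K \<alpha>; Dom2 K \<beta> = Cod2 K \<alpha>\<rbrakk> \<Longrightarrow> inv2 K (VComp K \<beta> \<alpha>) = VComp K (inv2 K \<alpha>) (inv2 K \<beta>)"
  "\<lbrakk>iso2 K \<beta>; iso2 K \<alpha>; Src K (Dom2 K \<beta>) = Trg K (Dom2 K \<alpha>)\<rbrakk>
    \<Longrightarrow> inv2 K (HComp K \<beta> \<alpha>) = HComp K (inv2 K \<beta>) (inv2 K \<alpha>)"
  "f \<in> Cell1 K \<Longrightarrow> inv2 K (Id2 K f) = Id2 K f"
  by (intro inv2_eq inverse2_vcomp inverse2_hcomp inverse2_id2 inverse2_inv2; simp)+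

text \<open>Grouped so that they can be removed from the simplifier: interchange has to see the
  factors of a horizontal composite before associativity and the merging of identities regroup
  them.\<close>

lemmas hcomp_normalize = hcomp_assoc hcomp_id2_merge hcomp_id2

lemma category_homcat: "category (homcat K a b)"
  by unfold_locales (auto simp: homcat_def)

end

lemma two_category_op2:
  assumes "two_category K"
  shows "two_category (op2 K)"
proof -
  interpret two_category K by fact
  show ?thesis
    by (intro two_category.intro category.intro) (auto simp: op2_def interchange)
qed

lemma two_category_prod2:
  assumes "two_category K" "two_category L"
  shows "two_category (prod2 K L)"
proof -
  interpret K: two_category K by fact
  interpret L: two_category L by fact
  show ?thesis
    by (intro two_category.intro category.intro)
      (auto simp: prod2_def K.interchange L.interchange)
qed

section \<open>The 2-category of categories\<close>

lemma ftr_eqI: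
  fixes F G :: "('o, 'a) ftr"
  assumes "is_functor F" "is_functor G" "FS F = FS G" "FT F = FT G"
    "\<And>x. x \<in> Ob (FS F) \<Longrightarrow> FO F x = FO G x" "\<And>f. f \<in> Ar (FS F) \<Longrightarrow> FA F f = FA G f"
  shows "F = G"
proof (rule ftr.equality)
  show "FO F = FO G"
    using assms by (intro extensionalityI [of _ "Ob (FS G)"]) (auto dest: is_functor.fo_ext)
  show "FA F = FA G"
    using assms by (intro extensionalityI [of _ "Ar (FS G)"]) (auto dest: is_functor.fa_ext)
qed (use assms in simp_all)

lemma ntr_eqI:
  fixes s t :: "('o, 'a) ntr"
  assumes "is_nat s" "is_nat t" "TS s = TS t" "TT s = TT t"
    "\<And>x. x \<in> Ob (FS (TS s)) \<Longrightarrow> TC s x = TC t x"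
  shows "s = t"
proof (rule ntr.equality)
  show "TC s = TC t"
    using assms by (intro extensionalityI [of _ "Ob (FS (TS t))"]) (auto dest: is_nat.tc_ext)
qed (use assms in simp_all)

type_synonym ('o, 'a) CAT = "(('o, 'a) cat, ('o, 'a) ftr, ('o, 'a) ntr) two_cat"

lemma CAT_simps:
  "Obj CAT = {C. category C}" "Cell1 CAT = {F. is_functor F}" "Cell2 CAT = {t. is_nat t}"
  "Src CAT = FS" "Trg CAT = FT" "Dom2 CAT = TS" "Cod2 CAT = TT"
  "Id1 CAT = ftr_id" "Comp1 CAT = ftr_comp"
  "Id2 CAT F = \<lparr>TS = F, TT = F, TC = (\<lambda>x\<in>Ob (FS F). Idn (FT F) (FO F x))\<rparr>"
  "VComp CAT s t = \<lparr>TS = TS t, TT = TT s,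
        TC = (\<lambda>x\<in>Ob (FS (TS t)). Cmp (FT (TS t)) (TC s x) (TC t x))\<rparr>"
  "HComp CAT s t = \<lparr>TS = ftr_comp (TS s) (TS t), TT = ftr_comp (TT s) (TT t),
        TC = (\<lambda>x\<in>Ob (FS (TS t)). Cmp (FT (TS s)) (TC s (FO (TT t) x)) (FA (TS s) (TC t x)))\<rparr>"
  by (simp_all add: CAT_def)

lemma cat_rules:
  assumes "category C"
  shows "f \<in> Ar C \<Longrightarrow> Dom C f \<in> Ob C" "f \<in> Ar C \<Longrightarrow> Cod C f \<in> Ob C"
    "x \<in> Ob C \<Longrightarrow> Idn C x \<in> Ar C" "x \<in> Ob C \<Longrightarrow> Dom C (Idn C x) = x" "x \<in> Ob C \<Longrightarrow> Cod C (Idn C x) = x"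
    "\<lbrakk>g \<in> Ar C; f \<in> Ar C; Dom C g = Cod C f\<rbrakk> \<Longrightarrow> Cmp C g f \<in> Ar C"
    "\<lbrakk>g \<in> Ar C; f \<in> Ar C; Dom C g = Cod C f\<rbrakk> \<Longrightarrow> Dom C (Cmp C g f) = Dom C f"
    "\<lbrakk>g \<in> Ar C; f \<in> Ar C; Dom C g = Cod C f\<rbrakk> \<Longrightarrow> Cod C (Cmp C g f) = Cod C g"
    "\<lbrakk>f \<in> Ar C; x = Dom C f\<rbrakk> \<Longrightarrow> Cmp C f (Idn C x) = f"
    "\<lbrakk>f \<in> Ar C; x = Cod C f\<rbrakk> \<Longrightarrow> Cmp C (Idn C x) f = f"
    "\<lbrakk>h \<in> Ar C; g \<in> Ar C; f \<in> Ar C; Dom C h = Cod C g; Dom C g = Cod C f\<rbrakk>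
      \<Longrightarrow> Cmp C (Cmp C h g) f = Cmp C h (Cmp C g f)"
  using assms by (simp_all add: category_def)

lemma ftr_simps [simp]:
  "FS (ftr_id C) = C" "FT (ftr_id C) = C" "FS (ftr_comp G F) = FS F" "FT (ftr_comp G F) = FT G"
  "FO (ftr_id C) = (\<lambda>x\<in>Ob C. x)" "FA (ftr_id C) = (\<lambda>f\<in>Ar C. f)"
  "FO (ftr_comp G F) = (\<lambda>x\<in>Ob (FS F). FO G (FO F x))" "FA (ftr_comp G F) = (\<lambda>f\<in>Ar (FS F). FA G (FA F f))"
  by (simp_all add: ftr_id_def ftr_comp_def)

text \<open>The categories occur as separate variables so that these rules apply whichever of the provably
  equal expressions for a category is present.\<close>

lemma ftr_rules:
  assumes "is_functor F"
  shows "category (FS F)" "category (FT F)"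
    "\<lbrakk>C = FS F; x \<in> Ob C; D = FT F\<rbrakk> \<Longrightarrow> FO F x \<in> Ob D"
    "\<lbrakk>C = FS F; f \<in> Ar C; D = FT F\<rbrakk> \<Longrightarrow> FA F f \<in> Ar D"
    "\<lbrakk>D = FT F; f \<in> Ar (FS F)\<rbrakk> \<Longrightarrow> Dom D (FA F f) = FO F (Dom (FS F) f)"
    "\<lbrakk>D = FT F; f \<in> Ar (FS F)\<rbrakk> \<Longrightarrow> Cod D (FA F f) = FO F (Cod (FS F) f)"
    "\<lbrakk>C = FS F; x \<in> Ob C\<rbrakk> \<Longrightarrow> FA F (Idn C x) = Idn (FT F) (FO F x)"
    "\<lbrakk>C = FS F; g \<in> Ar C; f \<in> Ar C; Dom C g = Cod C f\<rbrakk>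
      \<Longrightarrow> FA F (Cmp C g f) = Cmp (FT F) (FA F g) (FA F f)"
  using assms by (simp_all add: is_functor_def)

lemma ntr_rules:
  assumes "is_nat t"
  shows "is_functor (TS t)" "is_functor (TT t)" "FS (TT t) = FS (TS t)" "FT (TT t) = FT (TS t)"
    "\<lbrakk>C = FS (TS t); x \<in> Ob C; D = FT (TS t)\<rbrakk> \<Longrightarrow> TC t x \<in> Ar D"
    "\<lbrakk>D = FT (TS t); x \<in> Ob (FS (TS t))\<rbrakk> \<Longrightarrow> Dom D (TC t x) = FO (TS t) x"
    "\<lbrakk>D = FT (TS t); x \<in> Ob (FS (TS t))\<rbrakk> \<Longrightarrow> Cod D (TC t x) = FO (TT t) x"
  using assms by (simp_all add: is_nat_def)

lemma ntr_nat:
  "\<lbrakk>is_nat t; C = FS (TS t); D = FT (TS t); f \<in> Ar C\<rbrakk>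
    \<Longrightarrow> Cmp D (TC t (Cod C f)) (FA (TS t) f) = Cmp D (FA (TT t) f) (TC t (Dom C f))"
  by (simp add: is_nat.tc_nat)

lemma functor_id: "category C \<Longrightarrow> is_functor (ftr_id C)"
  by (intro is_functor.intro) (simp_all add: cat_rules)

lemma functor_comp:
  assumes "is_functor G" "is_functor F" "FS G = FT F"
  shows "is_functor (ftr_comp G F)"
  using assms by (intro is_functor.intro) (simp_all add: ftr_rules cat_rules)

lemma nat_id: "is_functor F \<Longrightarrow> is_nat (Id2 CAT F)"
  by (intro is_nat.intro) (simp_all add: CAT_simps ftr_rules cat_rules)

lemma nat_vcomp:
  assumes "is_nat s" "is_nat t" "TS s = TT t"
  shows "is_nat (VComp CAT s t)"
proof (rule is_nat.intro, goal_cases)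
  case f: (9 f)
  interpret s: is_nat s by fact
  interpret t: is_nat t by fact
  interpret D: category "FT (TS t)" using t.src_ftr is_functor.trg_cat by blast
  note d = ftr_rules cat_rules ntr_rules
  let ?D = "FT (TS t)" let ?x = "Dom (FS (TS t)) f" let ?y = "Cod (FS (TS t)) f"
  have f': "f \<in> Ar (FS (TS t))" using f by (simp add: CAT_simps)
  have "Cmp ?D (Cmp ?D (TC s ?y) (TC t ?y)) (FA (TS t) f) = Cmp ?D (TC s ?y) (Cmp ?D (FA (TT t) f) (TC t ?x))"
    using assms f' s.tc_nat [of f] t.tc_nat [of f] by (simp add: d)
  also have "\<dots> = Cmp ?D (Cmp ?D (TC s ?y) (FA (TS s) f)) (TC t ?x)"
    using assms f' by (simp add: d)
  also have "\<dots> = Cmp ?D (FA (TT s) f) (Cmp ?D (TC s ?x) (TC t ?x))"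
    using assms f' s.tc_nat [of f] by (simp add: d)
  finally show ?case
    using f' assms by (simp add: CAT_simps d)
qed (use assms in \<open>simp_all add: CAT_simps ftr_rules cat_rules ntr_rules\<close>)

lemma nat_hcomp:
  assumes "is_nat s" "is_nat t" "FS (TS s) = FT (TS t)"
  shows "is_nat (HComp CAT s t)"
proof (rule is_nat.intro, goal_cases)
  case f: (9 f)
  interpret s: is_nat s by fact
  interpret t: is_nat t by fact
  note d = ftr_rules cat_rules ntr_rules
  let ?D = "FT (TS s)" let ?x = "Dom (FS (TS t)) f" let ?y = "Cod (FS (TS t)) f"
  have f': "f \<in> Ar (FS (TS t))" using f by (simp add: CAT_simps)
  have "Cmp ?D (Cmp ?D (TC s (FO (TT t) ?y)) (FA (TS s) (TC t ?y))) (FA (TS s) (FA (TS t) f))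
    = Cmp ?D (TC s (FO (TT t) ?y)) (FA (TS s) (Cmp (FT (TS t)) (TC t ?y) (FA (TS t) f)))"
    using assms f' by (simp add: d)
  also have "\<dots> = Cmp ?D (Cmp ?D (TC s (FO (TT t) ?y)) (FA (TS s) (FA (TT t) f))) (FA (TS s) (TC t ?x))"
    using assms f' by (simp add: t.tc_nat d)
  also have "\<dots> = Cmp ?D (FA (TT s) (FA (TT t) f)) (Cmp ?D (TC s (FO (TT t) ?x)) (FA (TS s) (TC t ?x)))"
    using assms f' s.tc_nat [of "FA (TT t) f"] by (simp add: d)
  finally show ?case
    using f' assms by (simp add: CAT_simps d)
qed (use assms in \<open>simp_all add: CAT_simps functor_comp ftr_rules cat_rules ntr_rules\<close>)

lemma ntr_eta:
  "is_nat t \<Longrightarrow> C = Ob (FS (TS t)) \<Longrightarrow> F = TS t \<Longrightarrow> G = TT t \<Longrightarrow> \<lparr>TS = F, TT = G, TC = restrict (TC t) C\<rparr> = t"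
  by (cases t) (auto dest!: is_nat.tc_ext simp: extensional_restrict)

lemma ftr_eta:
  "\<lbrakk>is_functor F; C = FS F\<rbrakk> \<Longrightarrow> ftr_comp F (ftr_id C) = F"
  "\<lbrakk>is_functor F; C = FT F\<rbrakk> \<Longrightarrow> ftr_comp (ftr_id C) F = F"
  by (auto intro!: ftr_eqI simp: ftr_rules functor_id functor_comp)

lemma ftr_comp_assoc:
  "\<lbrakk>is_functor F; is_functor G; is_functor H; FS H = FT G; FS G = FT F\<rbrakk>
    \<Longrightarrow> ftr_comp (ftr_comp H G) F = ftr_comp H (ftr_comp G F)"
  by (intro ftr_eqI) (simp_all add: ftr_rules functor_comp)

lemma two_category_CAT: "two_category (CAT :: ('o, 'a) CAT)"
proof -
  note d = ftr_rules cat_rules ntr_rules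
  note c = CAT_simps functor_id functor_comp ftr_eta ftr_comp_assoc ntr_eta
    nat_id [unfolded CAT_simps] nat_vcomp [unfolded CAT_simps] nat_hcomp [unfolded CAT_simps]
  have i: "is_nat \<lparr>TS = ftr_id C, TT = ftr_id C, TC = restrict (Idn C) (Ob C)\<rparr>"
    if "category C" for C :: "('o, 'a) cat"
    using nat_id [OF functor_id, OF that] by (simp add: CAT_simps cong: restrict_cong)
  \<comment> \<open>Composition is normalised to the right, so the naturality square is also needed
    with a further arrow \<open>h\<close> preceding it.\<close>
  have n: "Cmp D (TC t y) (Cmp D (FA (TS t) f) h) = Cmp D (FA (TT t) f) (Cmp D (TC t x) h)"
    if "is_nat t" "D = FT (TS t)" "f \<in> Ar (FS (TS t))" "y = Cod (FS (TS t)) f" "x = Dom (FS (TS t)) f"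
      "h \<in> Ar (FT (TS t))" "Cod (FT (TS t)) h = FO (TS t) x"
    for t :: "('o, 'a) ntr" and D f h x y
  proof -
    have "Cmp D (Cmp D (TC t y) (FA (TS t) f)) h = Cmp D (Cmp D (FA (TT t) f) (TC t x)) h"
      using that by (simp add: ntr_nat)
    then show ?thesis
      using that by (simp add: d)
  qed
  show ?thesis
  proof (intro two_category.intro category.intro, goal_cases)
  qed (simp_all add: c d i n cong: restrict_cong)
qed

section \<open>The 2-category of pseudofunctors\<close>

lemma mem_composable [simp]: "(g, f) \<in> composable K \<longleftrightarrow> g \<in> Cell1 K \<and> f \<in> Cell1 K \<and> Src K g = Trg K f"
  by (simp add: composable_def)

lemma PS_simps:
  "Obj (PS K L) = {F. pseudofunctor K L F}" "Cell1 (PS K L) = {n. pseudonat K L n}"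
  "Cell2 (PS K L) = {m. modification K L m}"
  "Src (PS K L) = NS" "Trg (PS K L) = NT" "Dom2 (PS K L) = MS" "Cod2 (PS K L) = MT"
  "Id1 (PS K L) = psn_id K L" "Comp1 (PS K L) = psn_comp K L"
  "Id2 (PS K L) n = \<lparr>MS = n, MT = n, MC = (\<lambda>a\<in>Obj K. Id2 L (N1 n a))\<rparr>"
  "VComp (PS K L) m' m = \<lparr>MS = MS m, MT = MT m', MC = (\<lambda>a\<in>Obj K. VComp L (MC m' a) (MC m a))\<rparr>"
  "HComp (PS K L) m' m = \<lparr>MS = psn_comp K L (MS m') (MS m), MT = psn_comp K L (MT m') (MT m),
        MC = (\<lambda>a\<in>Obj K. HComp L (MC m' a) (MC m a))\<rparr>"
  by (simp_all add: PS_def)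

lemma psn_simps [simp]:
  "NS (psn_id K L F) = F" "NT (psn_id K L F) = F"
  "N1 (psn_id K L F) = (\<lambda>a\<in>Obj K. Id1 L (P0 F a))" "N2 (psn_id K L F) = (\<lambda>f\<in>Cell1 K. Id2 L (P1 F f))"
  "NS (psn_comp K L n' n) = NS n" "NT (psn_comp K L n' n) = NT n'"
  "N1 (psn_comp K L n' n) = (\<lambda>a\<in>Obj K. Comp1 L (N1 n' a) (N1 n a))"
  "N2 (psn_comp K L n' n) = (\<lambda>f\<in>Cell1 K. VComp L (HComp L (Id2 L (N1 n' (Trg K f))) (N2 n f))
      (HComp L (N2 n' f) (Id2 L (N1 n (Src K f)))))"
  by (simp_all add: psn_id_def psn_comp_def)

lemma psn_eqI:
  fixes m n :: "('o, 'f, 'c, 'p, 'g, 'd) psn"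
  assumes "pseudonat K L m" "pseudonat K L n" "NS m = NS n" "NT m = NT n"
    "\<And>a. a \<in> Obj K \<Longrightarrow> N1 m a = N1 n a" "\<And>f. f \<in> Cell1 K \<Longrightarrow> N2 m f = N2 n f"
  shows "m = n"
proof (rule psn.equality)
  show "N1 m = N1 n"
    using assms by (intro extensionalityI [of _ "Obj K"]) (auto dest: pseudonat.n1_ext)
  show "N2 m = N2 n"
    using assms by (intro extensionalityI [of _ "Cell1 K"]) (auto dest: pseudonat.n2_ext)
qed (use assms in simp_all)

lemma mdf_eqI:
  fixes m n :: "('o, 'f, 'c, 'p, 'g, 'd) mdf"
  assumes "modification K L m" "modification K L n" "MS m = MS n" "MT m = MT n"
    "\<And>a. a \<in> Obj K \<Longrightarrow> MC m a = MC n a"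
  shows "m = n"
proof (rule mdf.equality)
  show "MC m = MC n"
    using assms by (intro extensionalityI [of _ "Obj K"]) (auto dest: modification.mc_ext)
qed (use assms in simp_all)

lemma mdf_eta:
  "modification K L m \<Longrightarrow> n = MS m \<Longrightarrow> n' = MT m \<Longrightarrow> \<lparr>MS = n, MT = n', MC = restrict (MC m) (Obj K)\<rparr> = m"
  by (cases m) (auto dest!: modification.mc_ext simp: extensional_restrict)

locale two_categories = K: two_category K + L: two_category L
  for K :: "('o, 'f, 'c) two_cat" and L :: "('p, 'g, 'd) two_cat" (structure)
begin

lemma psf_rules:
  assumes "pseudofunctor K L F"
  shows "a \<in> Obj K \<Longrightarrow> P0 F a \<in> Obj L"
    "f \<in> Cell1 K \<Longrightarrow> P1 F f \<in> Cell1 L"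
    "f \<in> Cell1 K \<Longrightarrow> Src L (P1 F f) = P0 F (Src K f)"
    "f \<in> Cell1 K \<Longrightarrow> Trg L (P1 F f) = P0 F (Trg K f)"
    "\<alpha> \<in> Cell2 K \<Longrightarrow> P2 F \<alpha> \<in> Cell2 L"
    "\<alpha> \<in> Cell2 K \<Longrightarrow> Dom2 L (P2 F \<alpha>) = P1 F (Dom2 K \<alpha>)"
    "\<alpha> \<in> Cell2 K \<Longrightarrow> Cod2 L (P2 F \<alpha>) = P1 F (Cod2 K \<alpha>)"
    "f \<in> Cell1 K \<Longrightarrow> P2 F (Id2 K f) = Id2 L (P1 F f)"
    "\<lbrakk>\<beta> \<in> Cell2 K; \<alpha> \<in> Cell2 K; Dom2 K \<beta> = Cod2 K \<alpha>\<rbrakk>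
      \<Longrightarrow> P2 F (VComp K \<beta> \<alpha>) = VComp L (P2 F \<beta>) (P2 F \<alpha>)"
    "\<lbrakk>g \<in> Cell1 K; f \<in> Cell1 K; Src K g = Trg K f\<rbrakk> \<Longrightarrow> iso2 L (PC F (g, f))"
    "\<lbrakk>g \<in> Cell1 K; f \<in> Cell1 K; Src K g = Trg K f\<rbrakk> \<Longrightarrow> PC F (g, f) \<in> Cell2 L"
    "\<lbrakk>g \<in> Cell1 K; f \<in> Cell1 K; Src K g = Trg K f\<rbrakk> \<Longrightarrow> Dom2 L (PC F (g, f)) = Comp1 L (P1 F g) (P1 F f)"
    "\<lbrakk>g \<in> Cell1 K; f \<in> Cell1 K; Src K g = Trg K f\<rbrakk> \<Longrightarrow> Cod2 L (PC F (g, f)) = P1 F (Comp1 K g f)"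
    "a \<in> Obj K \<Longrightarrow> iso2 L (PI F a)"
    "a \<in> Obj K \<Longrightarrow> PI F a \<in> Cell2 L"
    "a \<in> Obj K \<Longrightarrow> Dom2 L (PI F a) = Id1 L (P0 F a)"
    "a \<in> Obj K \<Longrightarrow> Cod2 L (PI F a) = P1 F (Id1 K a)"
  using assms by (auto simp: pseudofunctor_def iso2_def inverse2_def)

lemma psn_rules:
  assumes "pseudonat K L n"
  shows "pseudofunctor K L (NS n)" "pseudofunctor K L (NT n)"
    "a \<in> Obj K \<Longrightarrow> N1 n a \<in> Cell1 L"
    "a \<in> Obj K \<Longrightarrow> Src L (N1 n a) = P0 (NS n) a"
    "a \<in> Obj K \<Longrightarrow> Trg L (N1 n a) = P0 (NT n) a"
    "f \<in> Cell1 K \<Longrightarrow> iso2 L (N2 n f)"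
    "f \<in> Cell1 K \<Longrightarrow> N2 n f \<in> Cell2 L"
    "f \<in> Cell1 K \<Longrightarrow> Dom2 L (N2 n f) = Comp1 L (P1 (NT n) f) (N1 n (Src K f))"
    "f \<in> Cell1 K \<Longrightarrow> Cod2 L (N2 n f) = Comp1 L (N1 n (Trg K f)) (P1 (NS n) f)"
  using assms by (auto simp: pseudonat_def iso2_def inverse2_def)

lemma mdf_rules:
  assumes "modification K L m"
  shows "pseudonat K L (MS m)" "pseudonat K L (MT m)" "NS (MT m) = NS (MS m)" "NT (MT m) = NT (MS m)"
    "a \<in> Obj K \<Longrightarrow> MC m a \<in> Cell2 L"
    "a \<in> Obj K \<Longrightarrow> Dom2 L (MC m a) = N1 (MS m) a"
    "a \<in> Obj K \<Longrightarrow> Cod2 L (MC m a) = N1 (MT m) a"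
  using assms by (simp_all add: modification_def)

lemma pseudonat_id:
  assumes "pseudofunctor K L F"
  shows "pseudonat K L (psn_id K L F)"
  using assms by (intro pseudonat.intro) (simp_all add: psf_rules)

text \<open>The square of the composite at \<open>f\<close> pastes the squares of \<open>n'\<close>
  and \<open>n\<close>. Each axiom follows by whiskering the axiom of \<open>n'\<close> with a
  component of \<open>n\<close> on the right and that of \<open>n\<close> with a component of
  \<open>n'\<close> on the left, and joining the two along the middle pseudofunctor.\<close>

lemma pseudonat_comp:
  assumes n': "pseudonat K L n'" and n: "pseudonat K L n" and eq: "NS n' = NT n"
  shows "pseudonat K L (psn_comp K L n' n)"
proof (rule pseudonat.intro, goal_cases)
  case (8 f)
  then show ?case by (simp add: assms psn_rules psf_rules)
next
  note r = assms psn_rules psf_rules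
  case \<alpha>: (11 \<alpha>)
  let ?a = "Src K (Dom2 K \<alpha>)" and ?b = "Trg K (Dom2 K \<alpha>)"
  have 1: "N2 n' (Cod2 K \<alpha>) \<star> \<iota> (N1 n ?a) \<cdot> P2 (NT n') \<alpha> \<star> \<iota> (N1 n' ?a \<odot> N1 n ?a)
    = \<iota> (N1 n' ?b) \<star> P2 (NT n) \<alpha> \<star> \<iota> (N1 n ?a) \<cdot> N2 n' (Dom2 K \<alpha>) \<star> \<iota> (N1 n ?a)"
    using arg_cong [OF pseudonat.n2_nat [OF n' \<alpha>], of "\<lambda>x. x \<star> \<iota> (N1 n ?a)"] \<alpha>
    by (simp add: r L.whisker_right)
  have 2: "\<iota> (N1 n' ?b) \<star> N2 n (Cod2 K \<alpha>) \<cdot> \<iota> (N1 n' ?b) \<star> P2 (NT n) \<alpha> \<star> \<iota> (N1 n ?a)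
    = \<iota> (N1 n' ?b \<odot> N1 n ?b) \<star> P2 (NS n) \<alpha> \<cdot> \<iota> (N1 n' ?b) \<star> N2 n (Dom2 K \<alpha>)"
    using arg_cong [OF pseudonat.n2_nat [OF n \<alpha>], of "\<lambda>x. \<iota> (N1 n' ?b) \<star> x"] \<alpha>
    by (simp add: r L.whisker_left)
  show ?case
    using \<alpha> by (simp add: r 1 L.vcomp_reassoc [OF 2])
next
  note r = assms psn_rules psf_rules
  case gf: (12 g f)
  then have c: "g \<in> Cell1 K" "f \<in> Cell1 K" "Src K g = Trg K f" by simp_all
  let ?a = "Src K f" and ?b = "Trg K f" and ?c = "Trg K g"
  have 1: "N2 n' (Comp1 K g f) \<star> \<iota> (N1 n ?a) \<cdot> PC (NT n') (g, f) \<star> \<iota> (N1 n' ?a \<odot> N1 n ?a)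
    = \<iota> (N1 n' ?c) \<star> PC (NT n) (g, f) \<star> \<iota> (N1 n ?a) \<cdot>
      N2 n' g \<star> \<iota> (P1 (NT n) f \<odot> N1 n ?a) \<cdot> \<iota> (P1 (NT n') g) \<star> N2 n' f \<star> \<iota> (N1 n ?a)"
    using arg_cong [OF pseudonat.n2_comp [OF n' gf], of "\<lambda>x. x \<star> \<iota> (N1 n ?a)"] c
    by (simp add: r L.whisker_right)
  have 2: "\<iota> (N1 n' ?c) \<star> N2 n (Comp1 K g f) \<cdot> \<iota> (N1 n' ?c) \<star> PC (NT n) (g, f) \<star> \<iota> (N1 n ?a)
    = \<iota> (N1 n' ?c \<odot> N1 n ?c) \<star> PC (NS n) (g, f) \<cdot>
      \<iota> (N1 n' ?c) \<star> N2 n g \<star> \<iota> (P1 (NS n) f) \<cdot> \<iota> (N1 n' ?c \<odot> P1 (NT n) g) \<star> N2 n f"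
    using arg_cong [OF pseudonat.n2_comp [OF n gf], of "\<lambda>x. \<iota> (N1 n' ?c) \<star> x"] c
    by (simp add: r L.whisker_left)
  \<comment> \<open>The square of \<open>n'\<close> at \<open>g\<close> and that of \<open>n\<close>
    at \<open>f\<close> act on disjoint factors, so interchange reorders them.\<close>
  have 3: "\<iota> (N1 n' ?c \<odot> P1 (NT n) g) \<star> N2 n f \<cdot> N2 n' g \<star> \<iota> (P1 (NT n) f \<odot> N1 n ?a)
    = N2 n' g \<star> \<iota> (N1 n ?b \<odot> P1 (NS n) f) \<cdot> \<iota> (P1 (NT n') g \<odot> N1 n' ?b) \<star> N2 n f"
    using L.exchange [of "N2 n' g" "N2 n f"] c by (simp add: r)
  show ?case
    using c by (simp add: r L.whisker_left L.whisker_right 1 L.vcomp_reassoc [OF 2] L.vcomp_reassoc [OF 3])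
next
  note r = assms psn_rules psf_rules
  case a: (13 a)
  have 1: "N2 n' (Id1 K a) \<star> \<iota> (N1 n a) \<cdot> PI (NT n') a \<star> \<iota> (N1 n' a \<odot> N1 n a)
    = \<iota> (N1 n' a) \<star> PI (NT n) a \<star> \<iota> (N1 n a)"
    using arg_cong [OF pseudonat.n2_id [OF n' a], of "\<lambda>x. x \<star> \<iota> (N1 n a)"] a
    by (simp add: r L.whisker_right)
  have 2: "\<iota> (N1 n' a) \<star> N2 n (Id1 K a) \<cdot> \<iota> (N1 n' a) \<star> PI (NT n) a \<star> \<iota> (N1 n a)
    = \<iota> (N1 n' a \<odot> N1 n a) \<star> PI (NS n) a"
    using arg_cong [OF pseudonat.n2_id [OF n a], of "\<lambda>x. \<iota> (N1 n' a) \<star> x"] a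
    by (simp add: r L.whisker_left)
  show ?case
    using a by (simp add: r 1 2)
qed (use assms in \<open>simp_all add: psn_rules psf_rules\<close>)

lemma modification_id: "pseudonat K L n \<Longrightarrow> modification K L (Id2 (PS K L) n)"
  by (intro modification.intro) (simp_all add: PS_simps psn_rules psf_rules)

lemma modification_vcomp:
  assumes m': "modification K L m'" and m: "modification K L m" and eq: "MS m' = MT m"
  shows "modification K L (VComp (PS K L) m' m)"
proof (rule modification.intro, goal_cases)
  note r = assms mdf_rules psn_rules psf_rules
  case f: (9 f)
  show ?case
    using f modification.mc_nat [OF m f] L.vcomp_reassoc [OF modification.mc_nat [OF m' f]]
    by (simp add: r PS_simps L.whisker_left L.whisker_right)
qed (use assms in \<open>simp_all add: PS_simps mdf_rules psn_rules psf_rules\<close>)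

lemma modification_hcomp:
  assumes m': "modification K L m'" and m: "modification K L m" and eq: "NS (MS m') = NT (MS m)"
  shows "modification K L (HComp (PS K L) m' m)"
proof (rule modification.intro, goal_cases)
  note r = assms mdf_rules psn_rules psf_rules
  case f: (9 f)
  let ?a = "Src K f" and ?b = "Trg K f"
  let ?q = "N2 (MT m') f" and ?p = "N2 (MT m) f"
  have "(\<iota> (N1 (MT m') ?b) \<star> ?p \<cdot> ?q \<star> \<iota> (N1 (MT m) ?a)) \<cdot> \<iota> (P1 (NT (MS m')) f) \<star> MC m' ?a \<star> MC m ?a
    = \<iota> (N1 (MT m') ?b) \<star> ?p \<cdot> (?q \<cdot> \<iota> (P1 (NT (MS m')) f) \<star> MC m' ?a) \<star> MC m ?a"
    using f by (simp add: r L.hcomp_vcomp flip: L.hcomp_assoc)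
  \<comment> \<open>A vertical identity is inserted so that interchange can separate the part of
    \<open>m\<close> from that of \<open>m'\<close>. The identity laws
    \<open>cell2_simps(9,10)\<close> are switched off in the interchange steps to keep such
    identities in place.\<close>
  also have "\<dots> = \<iota> (N1 (MT m') ?b) \<star> ?p \<cdot> (MC m' ?b \<star> \<iota> (P1 (NT (MS m)) f) \<cdot> N2 (MS m') f) \<star> (MC m ?a \<cdot> \<iota> (N1 (MS m) ?a))"
    using f modification.mc_nat [OF m' f] by (simp add: r)
  also have "\<dots> = (\<iota> (N1 (MT m') ?b) \<cdot> MC m' ?b) \<star> (?p \<cdot> \<iota> (P1 (NT (MS m)) f) \<star> MC m ?a) \<cdot> N2 (MS m') f \<star> \<iota> (N1 (MS m) ?a)"
    using f by (simp add: r L.interchange del: L.cell2_simps(9,10))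
  also have "\<dots> = (MC m' ?b \<cdot> \<iota> (N1 (MS m') ?b)) \<star> (MC m ?b \<star> \<iota> (P1 (NS (MS m)) f) \<cdot> N2 (MS m) f) \<cdot> N2 (MS m') f \<star> \<iota> (N1 (MS m) ?a)"
    using f modification.mc_nat [OF m f] by (simp add: r)
  also have "\<dots> = (MC m' ?b \<star> MC m ?b) \<star> \<iota> (P1 (NS (MS m)) f) \<cdot> \<iota> (N1 (MS m') ?b) \<star> N2 (MS m) f \<cdot> N2 (MS m') f \<star> \<iota> (N1 (MS m) ?a)"
    using f by (simp add: r L.interchange del: L.cell2_simps(9,10))
  finally show ?case
    using f by (simp add: r PS_simps)
qed (use assms in \<open>simp_all add: PS_simps pseudonat_comp mdf_rules psn_rules psf_rules\<close>)

lemma psn_comp_id: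
  assumes "pseudonat K L n"
  shows "F = NS n \<Longrightarrow> psn_comp K L n (psn_id K L F) = n" "F = NT n \<Longrightarrow> psn_comp K L (psn_id K L F) n = n"
  using assms by (auto intro!: psn_eqI pseudonat_comp pseudonat_id simp: psn_rules psf_rules)

lemma psn_comp_assoc:
  assumes "pseudonat K L n''" "pseudonat K L n'" "pseudonat K L n" "NS n'' = NT n'" "NS n' = NT n"
  shows "psn_comp K L (psn_comp K L n'' n') n = psn_comp K L n'' (psn_comp K L n' n)"
  using assms by (intro psn_eqI [of K L])
    (simp_all add: pseudonat_comp psn_rules psf_rules L.whisker_left L.whisker_right)

lemma two_category_PS: "two_category (PS K L)"
proof -
  note d = psf_rules psn_rules mdf_rules
  note c = PS_simps pseudonat_id pseudonat_comp psn_comp_id psn_comp_assoc mdf_eta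
    modification_id [unfolded PS_simps] modification_vcomp [unfolded PS_simps] modification_hcomp [unfolded PS_simps]
  have i: "modification K L \<lparr>MS = psn_id K L F, MT = psn_id K L F, MC = \<lambda>a\<in>Obj K. \<iota> (Id1 L (P0 F a))\<rparr>"
    if "pseudofunctor K L F" for F
    using modification_id [OF pseudonat_id, OF that] by (simp add: PS_simps cong: restrict_cong)
  show ?thesis
    by (intro two_category.intro category.intro) (simp_all add: c d i L.interchange cong: restrict_cong)
qed

end

section \<open>Strict 2-functors\<close>

text \<open>2-functors as bare actions on cells, without a \<open>psf\<close> record: preservation
  of composites is an equation the simplifier can use, and 2-functors compose as plain functions.
  The constructions depending on a pair of pseudofunctors are of this strict kind even when the
  pseudofunctors are not.\<close>

locale strict_two_functor = two_categories K L
  for K :: "('o, 'f, 'c) two_cat" and L :: "('p, 'g, 'd) two_cat" (structure) +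
  fixes Q0 :: "'o \<Rightarrow> 'p" and Q1 :: "'f \<Rightarrow> 'g" and Q2 :: "'c \<Rightarrow> 'd"
  assumes q0_in [simp]: "a \<in> Obj K \<Longrightarrow> Q0 a \<in> Obj L"
    and q1_in [simp]: "f \<in> Cell1 K \<Longrightarrow> Q1 f \<in> Cell1 L"
    and q1_src [simp]: "f \<in> Cell1 K \<Longrightarrow> Src L (Q1 f) = Q0 (Src K f)"
    and q1_trg [simp]: "f \<in> Cell1 K \<Longrightarrow> Trg L (Q1 f) = Q0 (Trg K f)"
    and q2_in [simp]: "\<alpha> \<in> Cell2 K \<Longrightarrow> Q2 \<alpha> \<in> Cell2 L"
    and q2_dom [simp]: "\<alpha> \<in> Cell2 K \<Longrightarrow> Dom2 L (Q2 \<alpha>) = Q1 (Dom2 K \<alpha>)"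
    and q2_cod [simp]: "\<alpha> \<in> Cell2 K \<Longrightarrow> Cod2 L (Q2 \<alpha>) = Q1 (Cod2 K \<alpha>)"
    and q1_id [simp]: "a \<in> Obj K \<Longrightarrow> Q1 (Id1 K a) = Id1 L (Q0 a)"
    and q1_comp [simp]: "\<lbrakk>g \<in> Cell1 K; f \<in> Cell1 K; Src K g = Trg K f\<rbrakk>
      \<Longrightarrow> Q1 (Comp1 K g f) = Comp1 L (Q1 g) (Q1 f)"
    and q2_id [simp]: "f \<in> Cell1 K \<Longrightarrow> Q2 (Id2 K f) = Id2 L (Q1 f)"
    and q2_vcomp [simp]: "\<lbrakk>\<beta> \<in> Cell2 K; \<alpha> \<in> Cell2 K; Dom2 K \<beta> = Cod2 K \<alpha>\<rbrakk>
      \<Longrightarrow> Q2 (VComp K \<beta> \<alpha>) = VComp L (Q2 \<beta>) (Q2 \<alpha>)"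
    and q2_hcomp [simp]: "\<lbrakk>\<beta> \<in> Cell2 K; \<alpha> \<in> Cell2 K; Src K (Dom2 K \<beta>) = Trg K (Dom2 K \<alpha>)\<rbrakk>
      \<Longrightarrow> Q2 (HComp K \<beta> \<alpha>) = HComp L (Q2 \<beta>) (Q2 \<alpha>)"
begin

lemma pseudofunctor_strict: "pseudofunctor K L (strict_psf K L Q0 Q1 Q2)"
  by (intro pseudofunctor.intro) (auto simp: strict_psf_def)

lemma iso2_strict [simp]:
  assumes "iso2 K \<alpha>"
  shows "iso2 L (Q2 \<alpha>)"
proof -
  obtain \<beta> where "inverse2 K \<alpha> \<beta>" using assms by (auto simp: iso2_def)
  then have "inverse2 L (Q2 \<alpha>) (Q2 \<beta>)"
    by (auto simp: inverse2_def simp flip: q2_vcomp)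
  then show ?thesis by (auto simp: iso2_def)
qed

end

text \<open>Postcomposition with a 2-functor. Both \<open>psf_map\<close> and the passage from A^op
  x B to \<open>hom_comp_psf\<close> are instances, so a single proof of 2-functoriality covers
  them.\<close>

definition psf_post :: "('o, 'f, 'c) two_cat \<Rightarrow> ('p \<Rightarrow> 'q) \<Rightarrow> ('g \<Rightarrow> 'h) \<Rightarrow> ('d \<Rightarrow> 'e)
    \<Rightarrow> ('o, 'f, 'c, 'p, 'g, 'd) psf \<Rightarrow> ('o, 'f, 'c, 'q, 'h, 'e) psf" where
  "psf_post J Q0 Q1 Q2 F = \<lparr>P0 = (\<lambda>a\<in>Obj J. Q0 (P0 F a)), P1 = (\<lambda>f\<in>Cell1 J. Q1 (P1 F f)),
     P2 = (\<lambda>\<alpha>\<in>Cell2 J. Q2 (P2 F \<alpha>)), PC = (\<lambda>p\<in>composable J. Q2 (PC F p)), PI = (\<lambda>a\<in>Obj J. Q2 (PI F a))\<rparr>"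

definition psn_post :: "('o, 'f, 'c) two_cat \<Rightarrow> ('p \<Rightarrow> 'q) \<Rightarrow> ('g \<Rightarrow> 'h) \<Rightarrow> ('d \<Rightarrow> 'e)
    \<Rightarrow> ('o, 'f, 'c, 'p, 'g, 'd) psn \<Rightarrow> ('o, 'f, 'c, 'q, 'h, 'e) psn" where
  "psn_post J Q0 Q1 Q2 n = \<lparr>NS = psf_post J Q0 Q1 Q2 (NS n), NT = psf_post J Q0 Q1 Q2 (NT n),
     N1 = (\<lambda>a\<in>Obj J. Q1 (N1 n a)), N2 = (\<lambda>f\<in>Cell1 J. Q2 (N2 n f))\<rparr>"

definition mdf_post :: "('o, 'f, 'c) two_cat \<Rightarrow> ('p \<Rightarrow> 'q) \<Rightarrow> ('g \<Rightarrow> 'h) \<Rightarrow> ('d \<Rightarrow> 'e)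
    \<Rightarrow> ('o, 'f, 'c, 'p, 'g, 'd) mdf \<Rightarrow> ('o, 'f, 'c, 'q, 'h, 'e) mdf" where
  "mdf_post J Q0 Q1 Q2 m = \<lparr>MS = psn_post J Q0 Q1 Q2 (MS m), MT = psn_post J Q0 Q1 Q2 (MT m),
     MC = (\<lambda>a\<in>Obj J. Q2 (MC m a))\<rparr>"

lemma post_simps [simp]:
  "P0 (psf_post J Q0 Q1 Q2 F) = (\<lambda>a\<in>Obj J. Q0 (P0 F a))" "P1 (psf_post J Q0 Q1 Q2 F) = (\<lambda>f\<in>Cell1 J. Q1 (P1 F f))"
  "P2 (psf_post J Q0 Q1 Q2 F) = (\<lambda>\<alpha>\<in>Cell2 J. Q2 (P2 F \<alpha>))"
  "PC (psf_post J Q0 Q1 Q2 F) = (\<lambda>p\<in>composable J. Q2 (PC F p))" "PI (psf_post J Q0 Q1 Q2 F) = (\<lambda>a\<in>Obj J. Q2 (PI F a))"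
  "NS (psn_post J Q0 Q1 Q2 n) = psf_post J Q0 Q1 Q2 (NS n)" "NT (psn_post J Q0 Q1 Q2 n) = psf_post J Q0 Q1 Q2 (NT n)"
  "N1 (psn_post J Q0 Q1 Q2 n) = (\<lambda>a\<in>Obj J. Q1 (N1 n a))" "N2 (psn_post J Q0 Q1 Q2 n) = (\<lambda>f\<in>Cell1 J. Q2 (N2 n f))"
  "MS (mdf_post J Q0 Q1 Q2 m) = psn_post J Q0 Q1 Q2 (MS m)" "MT (mdf_post J Q0 Q1 Q2 m) = psn_post J Q0 Q1 Q2 (MT m)"
  "MC (mdf_post J Q0 Q1 Q2 m) = (\<lambda>a\<in>Obj J. Q2 (MC m a))"
  by (simp_all add: psf_post_def psn_post_def mdf_post_def)

text \<open>A 2-functor preserves every operation in the axioms of pseudofunctors, transformations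
  and modifications, so applying \<open>Q2\<close> to such an axiom gives the axiom for the
  image.\<close>

lemma (in strict_two_functor) strict_two_functor_post:
  fixes J :: "('x, 'y, 'z) two_cat"
  assumes J: "two_category J"
  shows "strict_two_functor (PS J K) (PS J L) (psf_post J Q0 Q1 Q2) (psn_post J Q0 Q1 Q2) (mdf_post J Q0 Q1 Q2)"
proof -
  interpret J: two_category J by (rule J)
  interpret JK: two_categories J K ..
  interpret JL: two_categories J L ..
  note r = JK.psf_rules JK.psn_rules JK.mdf_rules
  have F: "pseudofunctor J L (psf_post J Q0 Q1 Q2 F)" if F: "pseudofunctor J K F" for F
  proof (rule pseudofunctor.intro, goal_cases)
    case (21 \<beta> \<alpha>)
    then show ?case using arg_cong [OF pseudofunctor.pc_nat [OF F 21], of Q2] by (simp add: r F)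
  next
    case (22 h g f)
    then show ?case using arg_cong [OF pseudofunctor.pc_assoc [OF F 22], of Q2] by (simp add: r F)
  next
    case (23 f)
    then show ?case using arg_cong [OF pseudofunctor.pi_right [OF F 23], of Q2] by (simp add: r F)
  next
    case (24 f)
    then show ?case using arg_cong [OF pseudofunctor.pi_left [OF F 24], of Q2] by (simp add: r F)
  qed (simp_all add: r F)
  have n: "pseudonat J L (psn_post J Q0 Q1 Q2 n)" if n: "pseudonat J K n" for n
  proof (rule pseudonat.intro, goal_cases)
    case (11 \<alpha>)
    then show ?case using arg_cong [OF pseudonat.n2_nat [OF n 11], of Q2] by (simp add: r n)
  next
    case (12 g f)
    then show ?case using arg_cong [OF pseudonat.n2_comp [OF n 12], of Q2] by (simp add: r n)
  next
    case (13 a)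
    then show ?case using arg_cong [OF pseudonat.n2_id [OF n 13], of Q2] by (simp add: r n)
  qed (simp_all add: r n F)
  have m: "modification J L (mdf_post J Q0 Q1 Q2 m)" if m: "modification J K m" for m
  proof (rule modification.intro, goal_cases)
    case (9 f)
    then show ?case using arg_cong [OF modification.mc_nat [OF m 9], of Q2] by (simp add: r m)
  qed (simp_all add: r m n)
  have id: "psn_post J Q0 Q1 Q2 (psn_id J K F) = psn_id J L (psf_post J Q0 Q1 Q2 F)" if "pseudofunctor J K F" for F
    using that by (intro psn_eqI [of J L] n JK.pseudonat_id JL.pseudonat_id F) (simp_all add: r)
  have cmp: "psn_post J Q0 Q1 Q2 (psn_comp J K g f) = psn_comp J L (psn_post J Q0 Q1 Q2 g) (psn_post J Q0 Q1 Q2 f)"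
    if "pseudonat J K g" "pseudonat J K f" "NS g = NT f" for g f
    using that by (intro psn_eqI [of J L] n JK.pseudonat_comp JL.pseudonat_comp) (simp_all add: r)
  interpret P: two_category "PS J K" by (rule JK.two_category_PS)
  interpret Q: two_category "PS J L" by (rule JL.two_category_PS)
  show ?thesis
  proof (intro strict_two_functor.intro two_categories.intro P.two_category_axioms Q.two_category_axioms
      strict_two_functor_axioms.intro)
  qed (simp_all add: PS_simps F n m m [unfolded mdf_post_def] id cmp r mdf_post_def cong: restrict_cong)
qed

section \<open>The 2-functor sending a pair (A, B) of pseudofunctors to A^op x B\<close>

abbreviation opprod :: "('o, 'f, 'c) two_cat \<Rightarrow> ('o \<times> 'o, 'f \<times> 'f, 'c \<times> 'c) two_cat" where
  "opprod K \<equiv> prod2 (op2 K) K"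

lemma opprod_simps [simp]:
  "Obj (opprod K) = Obj K \<times> Obj K" "Cell1 (opprod K) = Cell1 K \<times> Cell1 K" "Cell2 (opprod K) = Cell2 K \<times> Cell2 K"
  "Src (opprod K) (f, g) = (Trg K f, Src K g)" "Trg (opprod K) (f, g) = (Src K f, Trg K g)"
  "Id1 (opprod K) (a, b) = (Id1 K a, Id1 K b)"
  "Comp1 (opprod K) (f, g) (f', g') = (Comp1 K f' f, Comp1 K g g')"
  "Dom2 (opprod K) (\<phi>, \<psi>) = (Dom2 K \<phi>, Dom2 K \<psi>)" "Cod2 (opprod K) (\<phi>, \<psi>) = (Cod2 K \<phi>, Cod2 K \<psi>)"
  "Id2 (opprod K) (f, g) = (Id2 K f, Id2 K g)"
  "VComp (opprod K) (\<phi>, \<psi>) (\<phi>', \<psi>') = (VComp K \<phi> \<phi>', VComp K \<psi> \<psi>')"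
  "HComp (opprod K) (\<phi>, \<psi>) (\<phi>', \<psi>') = (HComp K \<phi>' \<phi>, HComp K \<psi> \<psi>')"
  by (simp_all add: prod2_def op2_def)

lemma inverse2_opprod [simp]:
  "inverse2 (opprod K) (\<phi>, \<psi>) (\<phi>', \<psi>') \<longleftrightarrow> inverse2 K \<phi> \<phi>' \<and> inverse2 K \<psi> \<psi>'"
  by (auto simp: inverse2_def)

lemma iso2_opprod [simp]: "iso2 (opprod K) (\<phi>, \<psi>) \<longleftrightarrow> iso2 K \<phi> \<and> iso2 K \<psi>"
  by (auto simp: iso2_def)

lemma two_category_opprod: "two_category K \<Longrightarrow> two_category (opprod K)"
  by (simp add: two_category_op2 two_category_prod2)

definition psf_opprod :: "('o, 'f, 'c) two_cat \<Rightarrow> ('o, 'f, 'c, 'p, 'g, 'd) psf \<Rightarrow> ('o, 'f, 'c, 'p, 'g, 'd) psf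
    \<Rightarrow> ('o \<times> 'o, 'f \<times> 'f, 'c \<times> 'c, 'p \<times> 'p, 'g \<times> 'g, 'd \<times> 'd) psf" where
  "psf_opprod K A B = \<lparr>P0 = (\<lambda>(a, b)\<in>Obj (opprod K). (P0 A a, P0 B b)),
     P1 = (\<lambda>(u, v)\<in>Cell1 (opprod K). (P1 A u, P1 B v)),
     P2 = (\<lambda>(\<phi>, \<psi>)\<in>Cell2 (opprod K). (P2 A \<phi>, P2 B \<psi>)),
     PC = (\<lambda>((u', v'), (u, v))\<in>composable (opprod K). (PC A (u, u'), PC B (v', v))),
     PI = (\<lambda>(a, b)\<in>Obj (opprod K). (PI A a, PI B b))\<rparr>"

text \<open>In the first coordinate 1-cells are reversed but 2-cells are not. The source and target
  required of a square at \<open>u\<close> are therefore exchanged, and the inverse of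
  \<open>N2 \<gamma> u\<close> is the cell that fits.\<close>

definition psn_opprod where
  "psn_opprod K H \<gamma> \<delta> = \<lparr>NS = psf_opprod K (NT \<gamma>) (NS \<delta>), NT = psf_opprod K (NS \<gamma>) (NT \<delta>),
     N1 = (\<lambda>(a, b)\<in>Obj (opprod K). (N1 \<gamma> a, N1 \<delta> b)),
     N2 = (\<lambda>(u, v)\<in>Cell1 (opprod K). (inv2 H (N2 \<gamma> u), N2 \<delta> v))\<rparr>"

definition mdf_opprod where
  "mdf_opprod K H m m' = \<lparr>MS = psn_opprod K H (MS m) (MS m'), MT = psn_opprod K H (MT m) (MT m'),
     MC = (\<lambda>(a, b)\<in>Obj (opprod K). (MC m a, MC m' b))\<rparr>"

lemma psf_opprod_simps [simp]:
  "P0 (psf_opprod K A B) = (\<lambda>(a, b)\<in>Obj (opprod K). (P0 A a, P0 B b))"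
  "P1 (psf_opprod K A B) = (\<lambda>(u, v)\<in>Cell1 (opprod K). (P1 A u, P1 B v))"
  "P2 (psf_opprod K A B) = (\<lambda>(\<phi>, \<psi>)\<in>Cell2 (opprod K). (P2 A \<phi>, P2 B \<psi>))"
  "PC (psf_opprod K A B) = (\<lambda>((u', v'), (u, v))\<in>composable (opprod K). (PC A (u, u'), PC B (v', v)))"
  "PI (psf_opprod K A B) = (\<lambda>(a, b)\<in>Obj (opprod K). (PI A a, PI B b))"
  by (simp_all add: psf_opprod_def)

lemma psn_opprod_simps [simp]:
  "NS (psn_opprod K H \<gamma> \<delta>) = psf_opprod K (NT \<gamma>) (NS \<delta>)"
  "NT (psn_opprod K H \<gamma> \<delta>) = psf_opprod K (NS \<gamma>) (NT \<delta>)"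
  "N1 (psn_opprod K H \<gamma> \<delta>) = (\<lambda>(a, b)\<in>Obj (opprod K). (N1 \<gamma> a, N1 \<delta> b))"
  "N2 (psn_opprod K H \<gamma> \<delta>) = (\<lambda>(u, v)\<in>Cell1 (opprod K). (inv2 H (N2 \<gamma> u), N2 \<delta> v))"
  "MS (mdf_opprod K H m m') = psn_opprod K H (MS m) (MS m')"
  "MT (mdf_opprod K H m m') = psn_opprod K H (MT m) (MT m')"
  "MC (mdf_opprod K H m m') = (\<lambda>(a, b)\<in>Obj (opprod K). (MC m a, MC m' b))"
  by (simp_all add: psn_opprod_def mdf_opprod_def)

context two_categories
begin

lemma pseudofunctor_opprod:
  assumes A: "pseudofunctor K L A" and B: "pseudofunctor K L B"
  shows "pseudofunctor (opprod K) (opprod L) (psf_opprod K A B)"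
  by (rule pseudofunctor.intro)
    (auto simp: psf_rules assms pseudofunctor.pc_nat [OF A] pseudofunctor.pc_nat [OF B]
      pseudofunctor.pc_assoc [OF A] pseudofunctor.pc_assoc [OF B]
      pseudofunctor.pi_left [OF A] pseudofunctor.pi_left [OF B]
      pseudofunctor.pi_right [OF A] pseudofunctor.pi_right [OF B])

text \<open>In the second coordinate the axioms of \<open>\<delta>\<close> apply as they stand. In
  the first, each axiom of \<open>\<gamma>\<close> is a square with invertible sides built from
  \<open>N2 \<gamma>\<close>, and \<open>inv2_conjugate\<close> turns it into the axiom for the
  inverses.\<close>

lemma pseudonat_opprod:
  assumes g: "pseudonat K L \<gamma>" and d: "pseudonat K L \<delta>"
  shows "pseudonat (opprod K) (opprod L) (psn_opprod K L \<gamma> \<delta>)"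
proof (rule pseudonat.intro, goal_cases)
  note r = psn_rules psf_rules g d
  case (11 p)
  then obtain \<phi> \<psi> where p: "p = (\<phi>, \<psi>)" and c: "\<phi> \<in> Cell2 K" "\<psi> \<in> Cell2 K" by auto
  show ?case
    using c L.inv2_conjugate [OF pseudonat.n2_nat [OF g c(1)]]
    by (simp add: p r pseudonat.n2_nat [OF d])
next
  note r = psn_rules psf_rules g d
  case (12 q p)
  then obtain u v u' v' where p: "q = (u', v')" "p = (u, v)" and c: "u \<in> Cell1 K" "v \<in> Cell1 K" "u' \<in> Cell1 K" "v' \<in> Cell1 K"
    "Src K u = Trg K u'" "Src K v' = Trg K v" by (cases q, cases p) auto
  then have uu': "(u, u') \<in> composable K" by simp
  show ?case
    using c L.inv2_conjugate [OF pseudonat.n2_comp [OF g uu']]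
    by (simp add: p r L.inv2_distrib pseudonat.n2_comp [OF d])
next
  note r = psn_rules psf_rules g d
  case (13 p)
  then obtain a b where p: "p = (a, b)" and c: "a \<in> Obj K" "b \<in> Obj K" by auto
  show ?case
    \<comment> \<open>The unit axiom is a triangle; with an identity as fourth side it becomes a
      square to which \<open>inv2_conjugate\<close> applies.\<close>
    using c pseudonat.n2_id [OF g c(1)] pseudonat.n2_id [OF d c(2)]
     L.inv2_conjugate [of "N2 \<gamma> (Id1 K a)" "PI (NT \<gamma>) a \<star> \<iota> (N1 \<gamma> a)"
      "\<iota> (N1 \<gamma> a) \<star> PI (NS \<gamma>) a" "\<iota> (N1 \<gamma> a)"]
    by (simp add: p r L.inv2_distrib)
qed (use assms in \<open>auto simp: psn_rules psf_rules pseudofunctor_opprod\<close>)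

lemma modification_opprod:
  assumes m: "modification K L m" and m': "modification K L m'"
  shows "modification (opprod K) (opprod L) (mdf_opprod K L m m')"
proof (rule modification.intro, goal_cases)
  note r = mdf_rules psn_rules psf_rules m m'
  case (9 p)
  then obtain u v where p: "p = (u, v)" and c: "u \<in> Cell1 K" "v \<in> Cell1 K" by auto
  show ?case
    using c L.inv2_conjugate [OF modification.mc_nat [OF m c(1)]]
    by (simp add: p r modification.mc_nat [OF m'])
qed (use assms in \<open>auto simp: mdf_rules psn_rules psf_rules pseudonat_opprod\<close>)

lemma strict_two_functor_opprod:
  "strict_two_functor (opprod (PS K L)) (PS (opprod K) (opprod L))
    (\<lambda>(A, B). psf_opprod K A B) (\<lambda>(\<gamma>, \<delta>). psn_opprod K L \<gamma> \<delta>) (\<lambda>(m, m'). mdf_opprod K L m m')"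
proof -
  interpret P: two_category "opprod (PS K L)" by (intro two_category_opprod two_category_PS)
  interpret oK: two_category "opprod K" by (intro two_category_opprod K.two_category_axioms)
  interpret oL: two_category "opprod L" by (intro two_category_opprod L.two_category_axioms)
  interpret oo: two_categories "opprod K" "opprod L" ..
  interpret Q: two_category "PS (opprod K) (opprod L)" by (rule oo.two_category_PS)
  note r = mdf_rules psn_rules psf_rules pseudofunctor_opprod pseudonat_opprod modification_opprod
  have id: "psn_opprod K L (psn_id K L A) (psn_id K L B) = psn_id (opprod K) (opprod L) (psf_opprod K A B)"
    if "pseudofunctor K L A" "pseudofunctor K L B" for A B
    using that by (intro psn_eqI [of "opprod K" "opprod L"])
      (auto simp: r pseudonat_id oo.pseudonat_id L.inv2_distrib)
  have cmp: "psn_opprod K L (psn_comp K L \<gamma> \<gamma>') (psn_comp K L \<delta>' \<delta>)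
      = psn_comp (opprod K) (opprod L) (psn_opprod K L \<gamma>' \<delta>') (psn_opprod K L \<gamma> \<delta>)"
    if "pseudonat K L \<gamma>" "pseudonat K L \<gamma>'" "NS \<gamma> = NT \<gamma>'" "pseudonat K L \<delta>" "pseudonat K L \<delta>'" "NS \<delta>' = NT \<delta>"
    for \<gamma> \<gamma>' \<delta> \<delta>'
    using that by (intro psn_eqI [of "opprod K" "opprod L"])
      (auto simp: r pseudonat_comp oo.pseudonat_comp L.inv2_distrib)
  show ?thesis
  proof (intro strict_two_functor.intro two_categories.intro P.two_category_axioms Q.two_category_axioms
      strict_two_functor_axioms.intro)
  qed (auto simp: PS_simps r id cmp intro!: mdf.equality ext)
qed

end

section \<open>Hom categories as a 2-functor into CAT\<close>

lemma homcat_simps [simp]: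
  "f \<in> Ob (homcat K a b) \<longleftrightarrow> f \<in> Cell1 K \<and> Src K f = a \<and> Trg K f = b"
  "\<alpha> \<in> Ar (homcat K a b) \<longleftrightarrow> \<alpha> \<in> Cell2 K \<and> Src K (Dom2 K \<alpha>) = a \<and> Trg K (Dom2 K \<alpha>) = b"
  "Dom (homcat K a b) = Dom2 K" "Cod (homcat K a b) = Cod2 K" "Idn (homcat K a b) = Id2 K"
  "Cmp (homcat K a b) = VComp K"
  by (auto simp: homcat_def)

lemma hom_ftr_simps [simp]:
  "FS (hom_ftr K f g) = homcat K (Trg K f) (Src K g)" "FT (hom_ftr K f g) = homcat K (Src K f) (Trg K g)"
  "FO (hom_ftr K f g) = (\<lambda>x\<in>Ob (homcat K (Trg K f) (Src K g)). Comp1 K g (Comp1 K x f))"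
  "FA (hom_ftr K f g) = (\<lambda>\<xi>\<in>Ar (homcat K (Trg K f) (Src K g)). HComp K (Id2 K g) (HComp K \<xi> (Id2 K f)))"
  "TS (hom_ntr K \<phi> \<psi>) = hom_ftr K (Dom2 K \<phi>) (Dom2 K \<psi>)" "TT (hom_ntr K \<phi> \<psi>) = hom_ftr K (Cod2 K \<phi>) (Cod2 K \<psi>)"
  "TC (hom_ntr K \<phi> \<psi>) = (\<lambda>x\<in>Ob (homcat K (Trg K (Dom2 K \<phi>)) (Src K (Dom2 K \<psi>))).
        HComp K \<psi> (HComp K (Id2 K x) \<phi>))"
  by (simp_all add: hom_ftr_def hom_ntr_def)

context two_category
begin

lemma functor_hom_ftr: "f \<in> Cell1 K \<Longrightarrow> g \<in> Cell1 K \<Longrightarrow> is_functor (hom_ftr K f g)"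
  by (intro is_functor.intro) (auto simp: category_homcat whisker_left whisker_right)

lemma nat_hom_ntr: "\<phi> \<in> Cell2 K \<Longrightarrow> \<psi> \<in> Cell2 K \<Longrightarrow> is_nat (hom_ntr K \<phi> \<psi>)"
  by (intro is_nat.intro) (auto simp: functor_hom_ftr hcomp_vcomp)

lemma strict_two_functor_hom:
  "strict_two_functor (opprod K) CAT (\<lambda>(a, b). homcat K a b) (\<lambda>(f, g). hom_ftr K f g) (\<lambda>(\<phi>, \<psi>). hom_ntr K \<phi> \<psi>)"
proof -
  interpret oK: two_category "opprod K" by (intro two_category_opprod two_category_axioms)
  interpret C: two_category "CAT :: ('f, 'c) CAT" by (rule two_category_CAT)
  have 1: "hom_ftr K (Id1 K a) (Id1 K b) = ftr_id (homcat K a b)" if "a \<in> Obj K" "b \<in> Obj K" for a b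
    using that by (intro ftr_eqI functor_hom_ftr functor_id category_homcat) auto
  have 2: "hom_ftr K (Comp1 K f f') (Comp1 K g' g) = ftr_comp (hom_ftr K f' g') (hom_ftr K f g)"
    if "f \<in> Cell1 K" "f' \<in> Cell1 K" "g \<in> Cell1 K" "g' \<in> Cell1 K" "Src K f = Trg K f'" "Src K g' = Trg K g" for f f' g g'
    using that by (intro ftr_eqI functor_hom_ftr functor_comp) auto
  have 3: "hom_ntr K (Id2 K f) (Id2 K g) = Id2 CAT (hom_ftr K f g)"
    if "f \<in> Cell1 K" "g \<in> Cell1 K" for f g
    using that by (intro ntr_eqI nat_hom_ntr nat_id functor_hom_ftr) (auto simp: CAT_simps)
  have 4: "hom_ntr K (VComp K \<phi>' \<phi>) (VComp K \<psi>' \<psi>) = VComp CAT (hom_ntr K \<phi>' \<psi>') (hom_ntr K \<phi> \<psi>)"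
    if "\<phi> \<in> Cell2 K" "\<phi>' \<in> Cell2 K" "\<psi> \<in> Cell2 K" "\<psi>' \<in> Cell2 K" "Dom2 K \<phi>' = Cod2 K \<phi>" "Dom2 K \<psi>' = Cod2 K \<psi>" for \<phi> \<phi>' \<psi> \<psi>'
    using that by (intro ntr_eqI nat_hom_ntr nat_vcomp) (auto simp: CAT_simps hcomp_vcomp)
  have 5: "hom_ntr K (HComp K \<phi> \<phi>') (HComp K \<psi>' \<psi>) = HComp CAT (hom_ntr K \<phi>' \<psi>') (hom_ntr K \<phi> \<psi>)"
    if "\<phi> \<in> Cell2 K" "\<phi>' \<in> Cell2 K" "\<psi> \<in> Cell2 K" "\<psi>' \<in> Cell2 K" "Src K (Dom2 K \<phi>) = Trg K (Dom2 K \<phi>')"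
      "Src K (Dom2 K \<psi>') = Trg K (Dom2 K \<psi>)" for \<phi> \<phi>' \<psi> \<psi>'
  proof -
    \<comment> \<open>A component of a horizontal composite in \<open>CAT\<close> is a component of
      the second transformation after the image of a component of the first. This interchange merges
      the two; \<open>X\<close> is later instantiated with the component of the first
      transformation.\<close>
    have X: "VComp K (HComp K \<psi>' (HComp K (Id2 K (Cod2 K X)) \<phi>'))
          (HComp K (Id2 K (Dom2 K \<psi>')) (HComp K X (Id2 K (Dom2 K \<phi>')))) = HComp K \<psi>' (HComp K X \<phi>')"
      if "X \<in> Cell2 K" "Src K (Dom2 K X) = Trg K (Dom2 K \<phi>')" "Trg K (Dom2 K X) = Src K (Dom2 K \<psi>')" for X
      using that \<open>\<phi>' \<in> Cell2 K\<close> \<open>\<psi>' \<in> Cell2 K\<close> by (simp add: hcomp_vcomp)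
    have "HComp K (HComp K \<psi>' \<psi>) (HComp K (Id2 K x) (HComp K \<phi> \<phi>'))
      = VComp K (HComp K \<psi>' (HComp K (Id2 K (Comp1 K (Cod2 K \<psi>) (Comp1 K x (Cod2 K \<phi>)))) \<phi>'))
          (HComp K (Id2 K (Dom2 K \<psi>')) (HComp K (HComp K \<psi> (HComp K (Id2 K x) \<phi>)) (Id2 K (Dom2 K \<phi>'))))"
      if "x \<in> Cell1 K" "Src K x = Trg K (Dom2 K \<phi>)" "Trg K x = Src K (Dom2 K \<psi>)" for x
      using X [of "HComp K \<psi> (HComp K (Id2 K x) \<phi>)"] that \<open>\<phi> \<in> Cell2 K\<close> \<open>\<phi>' \<in> Cell2 K\<close> \<open>\<psi> \<in> Cell2 K\<close> \<open>\<psi>' \<in> Cell2 K\<close> \<open>Src K (Dom2 K \<phi>) = Trg K (Dom2 K \<phi>')\<close>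
      \<open>Src K (Dom2 K \<psi>') = Trg K (Dom2 K \<psi>)\<close>
      by simp
    then show ?thesis
      using that by (intro ntr_eqI nat_hom_ntr nat_hcomp) (auto simp: CAT_simps 2)
  qed
  show ?thesis
    by (intro strict_two_functor.intro two_categories.intro oK.two_category_axioms C.two_category_axioms
        strict_two_functor_axioms.intro)
      (auto simp: 1 2 3 [unfolded CAT_simps] 4 [unfolded CAT_simps] 5 [unfolded CAT_simps] CAT_simps category_homcat functor_hom_ftr nat_hom_ntr)
qed

text \<open>The hom 2-functor with its contravariant variable frozen at \<open>c\<close> by
  identities. For \<open>c = hom_PE K\<close> in \<open>PE K\<close> it is the pseudoend as a
  2-functor of its integrand.\<close>

lemma strict_two_functor_covariant_hom:
  assumes c: "c \<in> Obj K"
  shows "strict_two_functor K CAT (homcat K c) (hom_ftr K (Id1 K c)) (hom_ntr K (Id2 K (Id1 K c)))"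
proof -
  interpret h: strict_two_functor "opprod K" CAT "\<lambda>(a, b). homcat K a b" "\<lambda>(f, g). hom_ftr K f g"
    "\<lambda>(\<phi>, \<psi>). hom_ntr K \<phi> \<psi>" by (rule strict_two_functor_hom)
  let ?i = "Id1 K c" let ?j = "Id2 K ?i"
  show ?thesis
    using c h.q0_in [of "(c, _)"] h.q1_in [of "(?i, _)"] h.q1_src [of "(?i, _)"] h.q1_trg [of "(?i, _)"]
      h.q2_in [of "(?j, _)"] h.q2_dom [of "(?j, _)"] h.q2_cod [of "(?j, _)"] h.q1_id [of "(c, _)"]
      h.q1_comp [of "(?i, _)" "(?i, _)"] h.q2_id [of "(?i, _)"] h.q2_vcomp [of "(?j, _)" "(?j, _)"]
      h.q2_hcomp [of "(?j, _)" "(?j, _)"]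
    by (intro strict_two_functor.intro two_categories.intro two_category_axioms two_category_CAT
        strict_two_functor_axioms.intro) simp_all
qed

end

lemma strict_two_functor_comp:
  assumes "strict_two_functor K L Q0 Q1 Q2" "strict_two_functor L M R0 R1 R2"
  shows "strict_two_functor K M (\<lambda>x. R0 (Q0 x)) (\<lambda>x. R1 (Q1 x)) (\<lambda>x. R2 (Q2 x))"
proof -
  interpret Q: strict_two_functor K L Q0 Q1 Q2 by fact
  interpret R: strict_two_functor L M R0 R1 R2 by fact
  show ?thesis by unfold_locales simp_all
qed

section \<open>Transport of categories along injections\<close>

lemma cat_map_simps [simp]:
  "Ob (cat_map i j C) = i ` Ob C" "Ar (cat_map i j C) = j ` Ar C"
  "Dom (cat_map i j C) = (\<lambda>f. i (Dom C (inv j f)))" "Cod (cat_map i j C) = (\<lambda>f. i (Cod C (inv j f)))"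
  "Idn (cat_map i j C) = (\<lambda>x. j (Idn C (inv i x)))"
  "Cmp (cat_map i j C) = (\<lambda>g f. j (Cmp C (inv j g) (inv j f)))"
  "FS (ftr_map i j F) = cat_map i j (FS F)" "FT (ftr_map i j F) = cat_map i j (FT F)"
  "FO (ftr_map i j F) = (\<lambda>x\<in>i ` Ob (FS F). i (FO F (inv i x)))"
  "FA (ftr_map i j F) = (\<lambda>f\<in>j ` Ar (FS F). j (FA F (inv j f)))"
  "TS (ntr_map i j t) = ftr_map i j (TS t)" "TT (ntr_map i j t) = ftr_map i j (TT t)"
  "TC (ntr_map i j t) = (\<lambda>x\<in>i ` Ob (FS (TS t)). j (TC t (inv i x)))"
  by (simp_all add: cat_map_def ftr_map_def ntr_map_def)

lemma strict_two_functor_map: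
  fixes i :: "'o \<Rightarrow> 'p" and j :: "'a \<Rightarrow> 'b"
  assumes i: "inj i" and j: "inj j"
  shows "strict_two_functor CAT CAT (cat_map i j) (ftr_map i j) (ntr_map i j)"
proof -
  interpret C: two_category "CAT :: ('o, 'a) CAT" by (rule two_category_CAT)
  interpret D: two_category "CAT :: ('p, 'b) CAT" by (rule two_category_CAT)
  note s = i j inj_eq [OF i] inj_eq [OF j] ftr_rules cat_rules ntr_rules
  have c: "category (cat_map i j C)" if "category C" for C
    using that by (intro category.intro) (auto simp: s)
  have f: "is_functor (ftr_map i j F)" if "is_functor F" for F
    using that by (intro is_functor.intro) (auto simp: s c)
  have t: "is_nat (ntr_map i j t)" if "is_nat t" for t
    using that by (intro is_nat.intro) (auto simp: s f ntr_nat)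
  have 1: "ftr_map i j (ftr_id C) = ftr_id (cat_map i j C)" if "category C" for C
    using that by (intro ftr_eqI f functor_id c) (auto simp: s)
  have 2: "ftr_map i j (ftr_comp G F) = ftr_comp (ftr_map i j G) (ftr_map i j F)"
    if "is_functor F" "is_functor G" "FS G = FT F" for F G
    using that by (intro ftr_eqI f functor_comp) (auto simp: s)
  have 3: "ntr_map i j (Id2 CAT F) = Id2 CAT (ftr_map i j F)" if "is_functor F" for F
    using that by (intro ntr_eqI t nat_id f) (auto simp: s CAT_simps)
  have 4: "ntr_map i j (VComp CAT t' t) = VComp CAT (ntr_map i j t') (ntr_map i j t)"
    if "is_nat t" "is_nat t'" "TS t' = TT t" for t t'
    using that by (intro ntr_eqI t nat_vcomp) (auto simp: s CAT_simps)
  have 5: "ntr_map i j (HComp CAT t' t) = HComp CAT (ntr_map i j t') (ntr_map i j t)"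
    if "is_nat t" "is_nat t'" "FS (TS t') = FT (TS t)" for t t'
    using that by (intro ntr_eqI t nat_hcomp) (auto simp: s CAT_simps 2)
  show ?thesis
    by (intro strict_two_functor.intro two_categories.intro C.two_category_axioms D.two_category_axioms
        strict_two_functor_axioms.intro)
      (auto simp: c f t 1 2 3 [unfolded CAT_simps] 4 [unfolded CAT_simps] 5 [unfolded CAT_simps] CAT_simps ntr_rules)
qed

lemma functor_map: "\<lbrakk>inj i; inj j; is_functor F\<rbrakk> \<Longrightarrow> is_functor (ftr_map i j F)"
  and nat_map: "\<lbrakk>inj i; inj j; is_nat t\<rbrakk> \<Longrightarrow> is_nat (ntr_map i j t)"
  using strict_two_functor.q1_in [OF strict_two_functor_map] strict_two_functor.q2_in [OF strict_two_functor_map]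
  by (auto simp: CAT_simps(1-3))

lemma map_eq_post:
  "psf_map i j K = psf_post K (cat_map i j) (ftr_map i j) (ntr_map i j)"
  "psn_map i j K = psn_post K (cat_map i j) (ftr_map i j) (ntr_map i j)"
  "mdf_map i j K = mdf_post K (cat_map i j) (ftr_map i j) (ntr_map i j)"
proof -
  show 1: "psf_map i j K = psf_post K (cat_map i j) (ftr_map i j) (ntr_map i j)"
    by (auto simp: psf_map_def psf_post_def)
  show 2: "psn_map i j K = psn_post K (cat_map i j) (ftr_map i j) (ntr_map i j)"
    by (auto simp: psn_map_def psn_post_def 1)
  show "mdf_map i j K = mdf_post K (cat_map i j) (ftr_map i j) (ntr_map i j)"
    by (auto simp: mdf_map_def mdf_post_def 2)
qed

lemma hom_comp_eq_post:
  fixes H :: "('p, 'g, 'd) two_cat"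
  defines "h0 \<equiv> \<lambda>(a, b). homcat H a b" and "h1 \<equiv> \<lambda>(f, g). hom_ftr H f g" and "h2 \<equiv> \<lambda>(\<phi>, \<psi>). hom_ntr H \<phi> \<psi>"
  shows "hom_comp_psf K H A B = psf_post (opprod K) h0 h1 h2 (psf_opprod K A B)"
    "hom_comp_psn K H \<gamma> \<delta> = psn_post (opprod K) h0 h1 h2 (psn_opprod K H \<gamma> \<delta>)"
    "hom_comp_mdf K H m m' = mdf_post (opprod K) h0 h1 h2 (mdf_opprod K H m m')"
proof -
  show 1: "hom_comp_psf K H A B = psf_post (opprod K) h0 h1 h2 (psf_opprod K A B)" for A B
    unfolding hom_comp_psf_def psf_post_def
    by (auto simp: h0_def h1_def h2_def fun_eq_iff restrict_def)
  show 2: "hom_comp_psn K H \<gamma> \<delta> = psn_post (opprod K) h0 h1 h2 (psn_opprod K H \<gamma> \<delta>)" for \<gamma> \<delta>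
    unfolding hom_comp_psn_def psn_post_def 1
    by (auto simp: h0_def h1_def h2_def fun_eq_iff restrict_def)
  show "hom_comp_mdf K H m m' = mdf_post (opprod K) h0 h1 h2 (mdf_opprod K H m m')"
    unfolding hom_comp_mdf_def mdf_post_def 2
    by (auto simp: h0_def h1_def h2_def fun_eq_iff restrict_def)
qed

lemma pseudofunctor_hom_psf: "two_category K \<Longrightarrow> pseudofunctor (opprod K) CAT (hom_psf K)"
  unfolding hom_psf_def
  by (intro strict_two_functor.pseudofunctor_strict two_category.strict_two_functor_hom)

lemma strict_two_functor_map_post:
  assumes "two_category J" "inj i" "inj j"
  shows "strict_two_functor (PS J CAT) (PS J CAT) (psf_map i j J) (psn_map i j J) (mdf_map i j J)"
  unfolding map_eq_post using assms
  by (intro strict_two_functor.strict_two_functor_post strict_two_functor_map)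

lemma pseudofunctor_map:
  assumes "two_category J" "inj i" "inj j" "pseudofunctor J CAT T"
  shows "pseudofunctor J CAT (psf_map i j J T)"
  using strict_two_functor.q0_in [OF strict_two_functor_map_post, OF assms(1-3), of T] assms(4)
  by (simp add: PS_simps)

context two_categories
begin

text \<open>\<open>(A, B) \<mapsto> H(A-, B-)\<close> is the composite of \<open>(A, B) \<mapsto> A\<^sup>o\<^sup>p \<times> B\<close> with postcomposition by \<open>hom\<close>.\<close>

lemma strict_two_functor_hom_comp:
  "strict_two_functor (opprod (PS K L)) (PE K)
    (\<lambda>(A, B). psf_map Inr Inr (opprod K) (hom_comp_psf K L A B))
    (\<lambda>(\<gamma>, \<delta>). psn_map Inr Inr (opprod K) (hom_comp_psn K L \<gamma> \<delta>))
    (\<lambda>(m, m'). mdf_map Inr Inr (opprod K) (hom_comp_mdf K L m m'))"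
proof -
  have o: "two_category (opprod K)" by (intro two_category_opprod K.two_category_axioms)
  note s = strict_two_functor_comp [OF strict_two_functor_comp, OF strict_two_functor_opprod
      strict_two_functor.strict_two_functor_post [OF L.strict_two_functor_hom o]
      strict_two_functor_map_post [OF o]]
  show ?thesis
    using s [of Inr Inr] by (simp add: hom_comp_eq_post case_prod_unfold)
qed

lemma hom_PE_obj: "hom_PE K \<in> Obj (PE K)"
  by (simp add: PS_simps pseudofunctor_map pseudofunctor_hom_psf two_category_opprod K.two_category_axioms)

text \<open>Taking pseudoends is the covariant hom 2-functor at \<open>hom_PE K\<close>, composed
  here with the dependence of the integrand on A and B. Strictness of both factors justifies the
  identity coherence cells in \<open>pseudoend_hom_psf\<close>.\<close>

lemma strict_two_functor_pseudoend_hom: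
  "strict_two_functor (opprod (PS K L)) CAT
     (\<lambda>(A, B). pseudoend K (hom_comp_psf K L A B))
     (\<lambda>(\<gamma>, \<delta>). pseudoend_ftr K (hom_comp_psn K L \<gamma> \<delta>))
     (\<lambda>(m, m'). pseudoend_ntr K (hom_comp_mdf K L m m'))"
proof -
  have PE: "two_category (PE K)"
    by (intro two_categories.two_category_PS two_categories.intro two_category_opprod K.two_category_axioms two_category_CAT)
  show ?thesis
    using strict_two_functor_comp [OF strict_two_functor_hom_comp
        two_category.strict_two_functor_covariant_hom [OF PE hom_PE_obj]]
    by (simp add: pseudoend_def pseudoend_ftr_def pseudoend_ntr_def case_prod_unfold)
qed

end

section \<open>Equivalences of categories over different types\<close>

definition iso_arr :: "('o, 'a) cat \<Rightarrow> 'a \<Rightarrow> bool" where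
  "iso_arr C f \<longleftrightarrow> f \<in> Ar C \<and> (\<exists>g. g \<in> Ar C \<and> Dom C g = Cod C f \<and> Cod C g = Dom C f \<and>
     Cmp C g f = Idn C (Dom C f) \<and> Cmp C f g = Idn C (Cod C f))"

lemma iso_arr_cat_map:
  "\<lbrakk>inj i; inj j; category C; f \<in> Ar C\<rbrakk> \<Longrightarrow> iso_arr (cat_map i j C) (j f) \<longleftrightarrow> iso_arr C f"
  by (auto simp: iso_arr_def inj_eq cat_rules)

lemma iso_arr_homcat:
  assumes "two_category K" "\<alpha> \<in> Ar (homcat K a b)"
  shows "iso_arr (homcat K a b) \<alpha> \<longleftrightarrow> iso2 K \<alpha>"
proof -
  interpret two_category K by fact
  have "Src K (Dom2 K \<beta>) = a" "Trg K (Dom2 K \<beta>) = b"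
    if "\<beta> \<in> Cell2 K" "Dom2 K \<beta> = Cod2 K \<alpha>" for \<beta>
    using assms(2) that by simp_all
  then show ?thesis
    using assms(2) by (auto simp: iso_arr_def iso2_def inverse2_def)
qed

text \<open>Naturality of inverses is automatic: conjugating the naturality square of
  \<open>t\<close> by componentwise inverses gives the square for the chosen family. Invertibility
  can thus be tested object by object.\<close>

lemma iso2_CAT_iff:
  assumes t: "is_nat t"
  shows "iso2 CAT t \<longleftrightarrow> (\<forall>x\<in>Ob (FS (TS t)). iso_arr (FT (TS t)) (TC t x))"
proof
  assume "iso2 CAT t"
  then obtain s where s: "inverse2 CAT t s" by (auto simp: iso2_def)
  show "\<forall>x\<in>Ob (FS (TS t)). iso_arr (FT (TS t)) (TC t x)"
  proof
    fix x assume x: "x \<in> Ob (FS (TS t))"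
    have s': "is_nat s" "TS s = TT t" "TT s = TS t"
      and 1: "VComp CAT s t = Id2 CAT (TS t)" and 2: "VComp CAT t s = Id2 CAT (TT t)"
      using s by (auto simp: inverse2_def CAT_simps)
    show "iso_arr (FT (TS t)) (TC t x)"
      unfolding iso_arr_def
      using t s' x arg_cong [OF 1, of "\<lambda>t. TC t x"] arg_cong [OF 2, of "\<lambda>t. TC t x"]
      by (auto intro!: exI [of _ "TC s x"] simp: CAT_simps ntr_rules)
  qed
next
  assume iso: "\<forall>x\<in>Ob (FS (TS t)). iso_arr (FT (TS t)) (TC t x)"
  note d = ntr_rules ftr_rules cat_rules
  let ?D = "FT (TS t)" and ?C = "FS (TS t)"
  have "\<forall>x\<in>Ob ?C. \<exists>g. g \<in> Ar ?D \<and> Dom ?D g = FO (TT t) x \<and> Cod ?D g = FO (TS t) x \<and>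
     Cmp ?D g (TC t x) = Idn ?D (FO (TS t) x) \<and> Cmp ?D (TC t x) g = Idn ?D (FO (TT t) x)"
    using iso t by (auto simp: iso_arr_def d)
  then obtain g where g: "\<And>x. x \<in> Ob ?C \<Longrightarrow> g x \<in> Ar ?D \<and> Dom ?D (g x) = FO (TT t) x \<and> Cod ?D (g x) = FO (TS t) x \<and>
     Cmp ?D (g x) (TC t x) = Idn ?D (FO (TS t) x) \<and> Cmp ?D (TC t x) (g x) = Idn ?D (FO (TT t) x)"
    by metis
  let ?s = "\<lparr>TS = TT t, TT = TS t, TC = restrict g (Ob ?C)\<rparr>"
  have "is_nat ?s"
  proof (rule is_nat.intro, goal_cases)
    case (9 f)
    then have f: "f \<in> Ar ?C" using t by (simp add: d)
    let ?x = "Dom ?C f" and ?y = "Cod ?C f"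
    have xy: "?x \<in> Ob ?C" "?y \<in> Ob ?C" using f t by (simp_all add: d)
    have "Cmp ?D (g ?y) (FA (TT t) f) = Cmp ?D (g ?y) (Cmp ?D (FA (TT t) f) (Cmp ?D (TC t ?x) (g ?x)))"
      using f t g [OF xy(1)] by (simp add: d)
    also have "\<dots> = Cmp ?D (g ?y) (Cmp ?D (Cmp ?D (FA (TT t) f) (TC t ?x)) (g ?x))"
      using f t g [OF xy(1)] xy by (simp add: d)
    also have "\<dots> = Cmp ?D (g ?y) (Cmp ?D (Cmp ?D (TC t ?y) (FA (TS t) f)) (g ?x))"
      using f t by (simp add: ntr_nat)
    also have "\<dots> = Cmp ?D (Cmp ?D (g ?y) (TC t ?y)) (Cmp ?D (FA (TS t) f) (g ?x))"
      using f t g [OF xy(1)] conjunct1 [OF g [OF xy(2)]] conjunct1 [OF conjunct2 [OF g [OF xy(2)]]] xy by (simp add: d)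
    also have "\<dots> = Cmp ?D (FA (TS t) f) (g ?x)"
      using f t g [OF xy(1)] g [OF xy(2)] by (simp add: d)
    finally show ?case
      using t xy by (simp add: d)
  qed (use t g in \<open>simp_all add: d\<close>)
  moreover have "VComp CAT ?s t = Id2 CAT (TS t)" "VComp CAT t ?s = Id2 CAT (TT t)"
    using t g by (auto simp: CAT_simps d intro!: restrict_ext)
  ultimately have "inverse2 CAT t ?s"
    using t by (auto simp: inverse2_def CAT_simps)
  then show "iso2 CAT t" by (auto simp: iso2_def)
qed

context two_categories
begin

text \<open>As in \<open>CAT\<close>, componentwise inverses satisfy the required axiom by
  themselves, here by \<open>inv2_conjugate\<close>. Invertibility of the unit and the counit is
  thereby reduced to that of their components.\<close>

lemma iso2_PS_iff:
  assumes m: "modification K L m"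
  shows "iso2 (PS K L) m \<longleftrightarrow> (\<forall>a\<in>Obj K. iso2 L (MC m a))"
proof
  assume "iso2 (PS K L) m"
  then obtain n where n: "inverse2 (PS K L) m n" by (auto simp: iso2_def)
  then have n': "modification K L n" "MS n = MT m" "MT n = MS m"
    and 1: "VComp (PS K L) n m = Id2 (PS K L) (MS m)" and 2: "VComp (PS K L) m n = Id2 (PS K L) (MT m)"
    by (auto simp: inverse2_def PS_simps)
  show "\<forall>a\<in>Obj K. iso2 L (MC m a)"
  proof
    fix a assume "a \<in> Obj K"
    then have "inverse2 L (MC m a) (MC n a)"
      using m n' arg_cong [OF 1, of "\<lambda>m. MC m a"] arg_cong [OF 2, of "\<lambda>m. MC m a"]
      by (simp add: inverse2_def PS_simps mdf_rules)
    then show "iso2 L (MC m a)" by (auto simp: iso2_def)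
  qed
next
  assume iso: "\<forall>a\<in>Obj K. iso2 L (MC m a)"
  note r = m mdf_rules psn_rules psf_rules
  let ?n = "\<lparr>MS = MT m, MT = MS m, MC = (\<lambda>a\<in>Obj K. inv2 L (MC m a))\<rparr>"
  have "modification K L ?n"
  proof (rule modification.intro, goal_cases)
    case f: (9 f)
    let ?X = "MC m (Trg K f) \<star> \<iota> (P1 (NS (MS m)) f)" and ?Y = "\<iota> (P1 (NT (MS m)) f) \<star> MC m (Src K f)"
    have "inv2 L ?X \<cdot> N2 (MT m) f = N2 (MS m) f \<cdot> inv2 L ?Y"
      using f iso modification.mc_nat [OF m f] by (intro L.inv2_conjugate) (simp_all add: r)
    then show ?case
      using f iso by (simp add: r L.inv2_distrib)
  qed (use iso in \<open>simp_all add: r\<close>)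
  moreover have "VComp (PS K L) ?n m = Id2 (PS K L) (MS m)" "VComp (PS K L) m ?n = Id2 (PS K L) (MT m)"
    using iso by (auto simp: PS_simps r intro!: restrict_ext)
  ultimately have "inverse2 (PS K L) m ?n"
    using m by (auto simp: inverse2_def PS_simps)
  then show "iso2 (PS K L) m" by (auto simp: iso2_def)
qed

end

text \<open>A functor \<open>C \<rightarrow> D\<close> between categories over different types, transported to a common type.\<close>

definition het_ftr :: "('o \<Rightarrow> 'z) \<Rightarrow> ('a \<Rightarrow> 'w) \<Rightarrow> ('p \<Rightarrow> 'z) \<Rightarrow> ('b \<Rightarrow> 'w) \<Rightarrow> ('o, 'a) cat \<Rightarrow> ('p, 'b) cat
    \<Rightarrow> ('o \<Rightarrow> 'p) \<Rightarrow> ('a \<Rightarrow> 'b) \<Rightarrow> ('z, 'w) ftr" where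
  "het_ftr i j k l C D e0 e1 = \<lparr>FS = cat_map i j C, FT = cat_map k l D,
     FO = (\<lambda>x\<in>i ` Ob C. k (e0 (inv i x))), FA = (\<lambda>f\<in>j ` Ar C. l (e1 (inv j f)))\<rparr>"

lemma het_ftr_simps [simp]:
  "FS (het_ftr i j k l C D e0 e1) = cat_map i j C" "FT (het_ftr i j k l C D e0 e1) = cat_map k l D"
  "FO (het_ftr i j k l C D e0 e1) = (\<lambda>x\<in>i ` Ob C. k (e0 (inv i x)))"
  "FA (het_ftr i j k l C D e0 e1) = (\<lambda>f\<in>j ` Ar C. l (e1 (inv j f)))"
  by (simp_all add: het_ftr_def)

text \<open>The record \<open>ftr\<close> forces source and target to share their types of objects
  and arrows. Here the types may differ, so a functor is a bare pair of functions, to be tagged by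
  \<open>het_ftr\<close> when an arrow of \<open>CAT\<close> is needed.\<close>

definition functorial :: "('o, 'a) cat \<Rightarrow> ('p, 'b) cat \<Rightarrow> ('o \<Rightarrow> 'p) \<Rightarrow> ('a \<Rightarrow> 'b) \<Rightarrow> bool" where
  "functorial C D e0 e1 \<longleftrightarrow> category C \<and> category D \<and> (\<forall>x\<in>Ob C. e0 x \<in> Ob D) \<and>
     (\<forall>f\<in>Ar C. e1 f \<in> Ar D \<and> Dom D (e1 f) = e0 (Dom C f) \<and> Cod D (e1 f) = e0 (Cod C f)) \<and>
     (\<forall>x\<in>Ob C. e1 (Idn C x) = Idn D (e0 x)) \<and>
     (\<forall>g\<in>Ar C. \<forall>f\<in>Ar C. Dom C g = Cod C f \<longrightarrow> e1 (Cmp C g f) = Cmp D (e1 g) (e1 f))"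

lemma category_cat_map: "inj i \<Longrightarrow> inj j \<Longrightarrow> category C \<Longrightarrow> category (cat_map i j C)"
  using strict_two_functor.q0_in [OF strict_two_functor_map] by (auto simp: CAT_simps)

lemma functor_het:
  assumes "functorial C D e0 e1" "inj i" "inj j" "inj k" "inj l"
  shows "is_functor (het_ftr i j k l C D e0 e1)"
  using assms by (intro is_functor.intro) (auto simp: functorial_def category_cat_map inj_eq cat_rules)

text \<open>The natural isomorphisms are given as families of arrows in the untagged categories.
  They point from the composite \<open>g0 e0\<close> to the identity and from the identity to
  \<open>e0 g0\<close>; \<open>equivalence1\<close> asks for the opposite orientations, hence the
  inverses supplied as witnesses.\<close>

lemma equivalence1_het:
  fixes i :: "'o \<Rightarrow> 'z" and j :: "'a \<Rightarrow> 'w" and k :: "'p \<Rightarrow> 'z" and l :: "'b \<Rightarrow> 'w"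
  assumes E: "functorial C D e0 e1" and G: "functorial D C g0 g1"
    and inj: "inj i" "inj j" "inj k" "inj l"
    and \<kappa>: "\<And>x. x \<in> Ob C \<Longrightarrow> \<kappa> x \<in> Ar C \<and> Dom C (\<kappa> x) = g0 (e0 x) \<and> Cod C (\<kappa> x) = x \<and> iso_arr C (\<kappa> x)"
    and \<kappa>_nat: "\<And>f. f \<in> Ar C \<Longrightarrow> Cmp C (\<kappa> (Cod C f)) (g1 (e1 f)) = Cmp C f (\<kappa> (Dom C f))"
    and \<epsilon>: "\<And>y. y \<in> Ob D \<Longrightarrow> \<epsilon> y \<in> Ar D \<and> Dom D (\<epsilon> y) = y \<and> Cod D (\<epsilon> y) = e0 (g0 y) \<and> iso_arr D (\<epsilon> y)"
    and \<epsilon>_nat: "\<And>f. f \<in> Ar D \<Longrightarrow> Cmp D (\<epsilon> (Cod D f)) f = Cmp D (e1 (g1 f)) (\<epsilon> (Dom D f))"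
  shows "equivalence1 CAT (het_ftr i j k l C D e0 e1)"
proof -
  interpret Z: two_category "CAT :: ('z, 'w) CAT" by (rule two_category_CAT)
  let ?E = "het_ftr i j k l C D e0 e1" and ?G = "het_ftr k l i j D C g0 g1"
  let ?k = "\<lparr>TS = ftr_comp ?G ?E, TT = ftr_id (cat_map i j C), TC = (\<lambda>x\<in>i ` Ob C. j (\<kappa> (inv i x)))\<rparr>"
  let ?e = "\<lparr>TS = ftr_id (cat_map k l D), TT = ftr_comp ?E ?G, TC = (\<lambda>y\<in>k ` Ob D. l (\<epsilon> (inv k y)))\<rparr>"
  have cat: "category C" "category D" using E by (auto simp: functorial_def)
  have E': "is_functor ?E" and G': "is_functor ?G" using E G inj by (simp_all add: functor_het)
  note s = inj inj_eq [OF inj(1)] inj_eq [OF inj(2)] inj_eq [OF inj(3)] inj_eq [OF inj(4)] E' G'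
    functor_id functor_comp category_cat_map cat
  have k: "is_nat ?k"
    using E G by (intro is_nat.intro) (auto simp: s \<kappa> \<kappa>_nat functorial_def cat_rules)
  have e: "is_nat ?e"
    using E G by (intro is_nat.intro) (auto simp: s \<epsilon> \<epsilon>_nat functorial_def cat_rules)
  have ik: "iso2 CAT ?k"
    using k \<kappa> by (auto simp: iso2_CAT_iff s iso_arr_cat_map)
  have ie: "iso2 CAT ?e"
    using e \<epsilon> by (auto simp: iso2_CAT_iff s iso_arr_cat_map)
  show ?thesis
    unfolding equivalence1_def
    using E' G' ik ie Z.inv2_simps [OF ik] Z.inv2_simps [OF ie]
    by (intro conjI exI [of _ ?G] exI [of _ "inv2 CAT ?k"] exI [of _ "inv2 CAT ?e"]) (simp_all add: CAT_simps)
qed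

lemma strict_psf_simps [simp]:
  "P0 (strict_psf K L F0 F1 F2) = restrict F0 (Obj K)" "P1 (strict_psf K L F0 F1 F2) = restrict F1 (Cell1 K)"
  "P2 (strict_psf K L F0 F1 F2) = restrict F2 (Cell2 K)"
  "PC (strict_psf K L F0 F1 F2) = restrict (\<lambda>(g, f). Id2 L (F1 (Comp1 K g f))) (composable K)"
  "PI (strict_psf K L F0 F1 F2) = restrict (\<lambda>a. Id2 L (F1 (Id1 K a))) (Obj K)"
  by (simp_all add: strict_psf_def)

lemma hom_comp_simps [simp]:
  "P0 (hom_comp_psf K H A B) = (\<lambda>(a, b)\<in>Obj (opprod K). homcat H (P0 A a) (P0 B b))"
  "P1 (hom_comp_psf K H A B) = (\<lambda>(u, v)\<in>Cell1 (opprod K). hom_ftr H (P1 A u) (P1 B v))"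
  "P2 (hom_comp_psf K H A B) = (\<lambda>(\<phi>, \<psi>)\<in>Cell2 (opprod K). hom_ntr H (P2 A \<phi>) (P2 B \<psi>))"
  "PC (hom_comp_psf K H A B) = (\<lambda>((u', v'), (u, v))\<in>composable (opprod K). hom_ntr H (PC A (u, u')) (PC B (v', v)))"
  "PI (hom_comp_psf K H A B) = (\<lambda>(a, b)\<in>Obj (opprod K). hom_ntr H (PI A a) (PI B b))"
  "NS (hom_comp_psn K H \<gamma> \<delta>) = hom_comp_psf K H (NT \<gamma>) (NS \<delta>)" "NT (hom_comp_psn K H \<gamma> \<delta>) = hom_comp_psf K H (NS \<gamma>) (NT \<delta>)"
  "N1 (hom_comp_psn K H \<gamma> \<delta>) = (\<lambda>(a, b)\<in>Obj (opprod K). hom_ftr H (N1 \<gamma> a) (N1 \<delta> b))"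
  "N2 (hom_comp_psn K H \<gamma> \<delta>) = (\<lambda>(u, v)\<in>Cell1 (opprod K). hom_ntr H (inv2 H (N2 \<gamma> u)) (N2 \<delta> v))"
  "MS (hom_comp_mdf K H m m') = hom_comp_psn K H (MS m) (MS m')" "MT (hom_comp_mdf K H m m') = hom_comp_psn K H (MT m) (MT m')"
  "MC (hom_comp_mdf K H m m') = (\<lambda>(a, b)\<in>Obj (opprod K). hom_ntr H (MC m a) (MC m' b))"
  by (simp_all add: hom_comp_psf_def hom_comp_psn_def hom_comp_mdf_def)

lemmas map_simps [simp] =
  post_simps [where ?Q0.0 = "cat_map i j" and ?Q1.0 = "ftr_map i j" and ?Q2.0 = "ntr_map i j", folded map_eq_post] for i j

section \<open>The pseudoend in elementary terms\<close>

type_synonym ('o, 'f, 'c, 'x, 'y) pe_psf =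
  "('o \<times> 'o, 'f \<times> 'f, 'c \<times> 'c, ('f + 'x, 'c + 'y) cat, ('f + 'x, 'c + 'y) ftr, ('f + 'x, 'c + 'y) ntr) psf"
type_synonym ('o, 'f, 'c, 'x, 'y) pe_psn =
  "('o \<times> 'o, 'f \<times> 'f, 'c \<times> 'c, ('f + 'x, 'c + 'y) cat, ('f + 'x, 'c + 'y) ftr, ('f + 'x, 'c + 'y) ntr) psn"
type_synonym ('o, 'f, 'c, 'x, 'y) pe_mdf =
  "('o \<times> 'o, 'f \<times> 'f, 'c \<times> 'c, ('f + 'x, 'c + 'y) cat, ('f + 'x, 'c + 'y) ftr, ('f + 'x, 'c + 'y) ntr) mdf"

text \<open>Inside \<open>PE K\<close>, cells of \<open>K\<close> carry the tag \<open>Inl\<close>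
  and values of the integrand the tag \<open>Inr\<close>. Feeding in \<open>Inl u\<close> and
  stripping the tag with \<open>projr\<close> recovers an untagged value; the three definitions
  below decode the other data in the same way.\<close>

definition wedge_ob :: "('o, 'f, 'c) two_cat \<Rightarrow>
    ('o, 'f, 'c, 'x, 'y) pe_psn
    \<Rightarrow> 'f \<Rightarrow> 'x" where
  "wedge_ob K x u = projr (FO (N1 x (Src K u, Trg K u)) (Inl u))"

definition wedge_ar :: "('o, 'f, 'c) two_cat \<Rightarrow>
    ('o, 'f, 'c, 'x, 'y) pe_psn
    \<Rightarrow> 'c \<Rightarrow> 'y" where
  "wedge_ar K x \<mu> = projr (FA (N1 x (Src K (Dom2 K \<mu>), Trg K (Dom2 K \<mu>))) (Inl \<mu>))"

definition wedge_cell ::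
    "('o, 'f, 'c, 'x, 'y) pe_psn
    \<Rightarrow> 'f \<Rightarrow> 'f \<Rightarrow> 'f \<Rightarrow> 'y" where
  "wedge_cell x f g u = projr (TC (N2 x (f, g)) (Inl u))"

definition wedge_mdf :: "('o, 'f, 'c) two_cat \<Rightarrow>
    ('o, 'f, 'c, 'x, 'y) pe_mdf
    \<Rightarrow> 'f \<Rightarrow> 'y" where
  "wedge_mdf K \<xi> u = projr (TC (MC \<xi> (Src K u, Trg K u)) (Inl u))"

text \<open>Objects of the pseudoend of \<open>L(A-, B-)\<close> in elementary terms: a 1-cell \<open>X u : A a \<rightarrow> B b\<close> for each
  \<open>u : a \<rightarrow> b\<close> and a 2-cell \<open>\<theta> f g u : B g \<odot> X u \<odot> A f \<Rightarrow> X (g \<odot> u \<odot> f)\<close>, subject to coherence.\<close>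

locale pseudoend_object = two_categories K L
  for K :: "('o, 'f, 'c) two_cat" and L :: "('p, 'g, 'd) two_cat" (structure) +
  fixes A B :: "('o, 'f, 'c, 'p, 'g, 'd) psf"
    and x :: "('o, 'f, 'c, 'g, 'd) pe_psn"
  assumes psf_A: "pseudofunctor K L A" and psf_B: "pseudofunctor K L B"
    and ob_x: "x \<in> Ob (pseudoend K (hom_comp_psf K L A B))"
begin

abbreviation "X \<equiv> wedge_ob K x"
abbreviation "X2 \<equiv> wedge_ar K x"
abbreviation "\<theta> \<equiv> wedge_cell x"

lemmas [simp] = psf_rules [OF psf_A] psf_rules [OF psf_B]

lemma psn_x: "pseudonat (opprod K) CAT x"
  and NS_x: "NS x = hom_PE K" and NT_x: "NT x = psf_map Inr Inr (opprod K) (hom_comp_psf K L A B)"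
  using ob_x by (simp_all add: pseudoend_def PS_simps)

lemma N1_x:
  assumes "a \<in> Obj K" "b \<in> Obj K"
  shows "is_functor (N1 x (a, b))" "FS (N1 x (a, b)) = cat_map Inl Inl (homcat K a b)"
    "FT (N1 x (a, b)) = cat_map Inr Inr (homcat L (P0 A a) (P0 B b))"
  using assms pseudonat.n1_in [OF psn_x, of "(a, b)"] pseudonat.n1_src [OF psn_x, of "(a, b)"]
    pseudonat.n1_trg [OF psn_x, of "(a, b)"]
  by (simp_all add: CAT_simps NS_x NT_x hom_psf_def)

lemma X_simps [simp]:
    "u \<in> Cell1 K \<Longrightarrow> X u \<in> Cell1 L" "u \<in> Cell1 K \<Longrightarrow> Src L (X u) = P0 A (Src K u)"
    "u \<in> Cell1 K \<Longrightarrow> Trg L (X u) = P0 B (Trg K u)"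
  and FO_x: "\<lbrakk>u \<in> Cell1 K; a = Src K u; b = Trg K u\<rbrakk> \<Longrightarrow> FO (N1 x (a, b)) (Inl u) = Inr (X u)"
  using is_functor.fo_in [OF N1_x(1), of "Src K u" "Trg K u" "Inl u"]
  by (auto simp: N1_x wedge_ob_def)

lemma X2_rules:
  assumes m: "\<mu> \<in> Cell2 K"
  shows "\<lbrakk>a = Src K (Dom2 K \<mu>); b = Trg K (Dom2 K \<mu>)\<rbrakk> \<Longrightarrow> FA (N1 x (a, b)) (Inl \<mu>) = Inr (X2 \<mu>)"
    "X2 \<mu> \<in> Cell2 L" "Dom2 L (X2 \<mu>) = X (Dom2 K \<mu>)" "Cod2 L (X2 \<mu>) = X (Cod2 K \<mu>)"
proof -
  let ?F = "N1 x (Src K (Dom2 K \<mu>), Trg K (Dom2 K \<mu>))"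
  have "FA ?F (Inl \<mu>) \<in> Ar (FT ?F)" "Dom (FT ?F) (FA ?F (Inl \<mu>)) = FO ?F (Inl (Dom2 K \<mu>))"
    "Cod (FT ?F) (FA ?F (Inl \<mu>)) = FO ?F (Inl (Cod2 K \<mu>))"
    using is_functor.fa_in [OF N1_x(1), of _ _ "Inl \<mu>"] is_functor.fa_dom [OF N1_x(1), of _ _ "Inl \<mu>"]
      is_functor.fa_cod [OF N1_x(1), of _ _ "Inl \<mu>"] m
    by (simp_all add: N1_x)
  then show "\<lbrakk>a = Src K (Dom2 K \<mu>); b = Trg K (Dom2 K \<mu>)\<rbrakk> \<Longrightarrow> FA (N1 x (a, b)) (Inl \<mu>) = Inr (X2 \<mu>)"
    "X2 \<mu> \<in> Cell2 L" "Dom2 L (X2 \<mu>) = X (Dom2 K \<mu>)" "Cod2 L (X2 \<mu>) = X (Cod2 K \<mu>)"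
    using m by (auto simp: N1_x wedge_ar_def FO_x)
qed

lemmas FA_x = X2_rules(1) and X2_simps [simp] = X2_rules(2-4)

lemma X2_id [simp]: "u \<in> Cell1 K \<Longrightarrow> X2 (Id2 K u) = \<iota> (X u)"
  using is_functor.fa_idn [OF N1_x(1), of "Src K u" "Trg K u" "Inl u"] by (simp add: N1_x FO_x FA_x)

lemma N2_x:
  assumes "f \<in> Cell1 K" "g \<in> Cell1 K"
  shows "is_nat (N2 x (f, g))" "iso2 CAT (N2 x (f, g))"
    "TS (N2 x (f, g)) = ftr_comp (ftr_map Inr Inr (hom_ftr L (P1 A f) (P1 B g))) (N1 x (Trg K f, Src K g))"
    "TT (N2 x (f, g)) = ftr_comp (N1 x (Src K f, Trg K g)) (ftr_map Inl Inl (hom_ftr K f g))"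
proof -
  interpret C: two_category "CAT :: ('f + 'g, 'c + 'd) CAT"
    by (rule two_category_CAT)
  show iso: "iso2 CAT (N2 x (f, g))"
    using assms pseudonat.n2_iso [OF psn_x, of "(f, g)"] by simp
  then show "is_nat (N2 x (f, g))"
    using C.iso2_cell2 [OF iso] by (simp add: CAT_simps)
  show "TS (N2 x (f, g)) = ftr_comp (ftr_map Inr Inr (hom_ftr L (P1 A f) (P1 B g))) (N1 x (Trg K f, Src K g))"
    "TT (N2 x (f, g)) = ftr_comp (N1 x (Src K f, Trg K g)) (ftr_map Inl Inl (hom_ftr K f g))"
    using assms pseudonat.n2_dom [OF psn_x, of "(f, g)"] pseudonat.n2_cod [OF psn_x, of "(f, g)"]
    by (simp_all add: CAT_simps NS_x NT_x hom_psf_def)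
qed

lemma \<theta>_rules:
  assumes fgu: "f \<in> Cell1 K" "g \<in> Cell1 K" "u \<in> Cell1 K" "Src K u = Trg K f" "Trg K u = Src K g"
  shows "TC (N2 x (f, g)) (Inl u) = Inr (\<theta> f g u)" "iso2 L (\<theta> f g u)" "\<theta> f g u \<in> Cell2 L"
    "Dom2 L (\<theta> f g u) = P1 B g \<odot> X u \<odot> P1 A f" "Cod2 L (\<theta> f g u) = X (Comp1 K g (Comp1 K u f))"
proof -
  note n = N2_x [OF fgu(1,2)]
  let ?C = "homcat L (P0 A (Src K f)) (P0 B (Trg K g))"
  have u: "Inl u \<in> Ob (FS (TS (N2 x (f, g))))" using fgu by (simp add: n N1_x)
  have T: "FT (TS (N2 x (f, g))) = cat_map Inr Inr ?C" using fgu by (simp add: n)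
  obtain t where t: "TC (N2 x (f, g)) (Inl u) = Inr t" "t \<in> Ar ?C"
    using is_nat.tc_in [OF n(1) u] by (auto simp: T)
  then have \<theta>: "\<theta> f g u = t" by (simp add: wedge_cell_def)
  show "TC (N2 x (f, g)) (Inl u) = Inr (\<theta> f g u)" "\<theta> f g u \<in> Cell2 L"
    using t by (simp_all add: \<theta>)
  show "Dom2 L (\<theta> f g u) = P1 B g \<odot> X u \<odot> P1 A f" "Cod2 L (\<theta> f g u) = X (Comp1 K g (Comp1 K u f))"
    using is_nat.tc_dom [OF n(1) u] is_nat.tc_cod [OF n(1) u] fgu t by (simp_all add: \<theta> T n N1_x FO_x)
  show "iso2 L (\<theta> f g u)"
    using n(2) u t(2) unfolding iso2_CAT_iff [OF n(1)] T \<theta>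
    by (metis t(1) iso_arr_cat_map inj_Inr L.category_homcat iso_arr_homcat L.two_category_axioms)
qed

lemmas TC_x = \<theta>_rules(1) and \<theta>_simps [simp] = \<theta>_rules(2-5)

text \<open>The pseudonaturality axioms of \<open>x\<close> are equations between natural
  transformations; reading them at the single object \<open>Inl u\<close> gives equations of 2-cells
  in \<open>L\<close>. \<open>\<theta>_comp\<close> arises in the same way.\<close>

lemma \<theta>_natural:
  assumes "\<phi> \<in> Cell2 K" "\<psi> \<in> Cell2 K" "u \<in> Cell1 K" "Src K u = Trg K (Dom2 K \<phi>)" "Trg K u = Src K (Dom2 K \<psi>)"
  shows "\<theta> (Cod2 K \<phi>) (Cod2 K \<psi>) u \<cdot> P2 B \<psi> \<star> \<iota> (X u) \<star> P2 A \<phi>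
    = X2 (HComp K \<psi> (HComp K (Id2 K u) \<phi>)) \<cdot> \<theta> (Dom2 K \<phi>) (Dom2 K \<psi>) u"
  using assms arg_cong [OF pseudonat.n2_nat [OF psn_x, of "(\<phi>, \<psi>)"], of "\<lambda>t. TC t (Inl u)"]
  by (simp add: CAT_simps NS_x NT_x hom_psf_def N1_x N2_x FO_x FA_x TC_x)

lemma \<theta>_comp:
  assumes "f \<in> Cell1 K" "f' \<in> Cell1 K" "g \<in> Cell1 K" "g' \<in> Cell1 K" "u \<in> Cell1 K"
    "Src K f = Trg K f'" "Src K g' = Trg K g" "Src K u = Trg K f" "Trg K u = Src K g"
  shows "\<theta> (Comp1 K f f') (Comp1 K g' g) u \<cdot> PC B (g', g) \<star> \<iota> (X u) \<star> PC A (f, f')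
    = \<theta> f' g' (Comp1 K g (Comp1 K u f)) \<cdot> \<iota> (P1 B g') \<star> \<theta> f g u \<star> \<iota> (P1 A f')"
  using assms arg_cong [OF pseudonat.n2_comp [OF psn_x, of "(f', g')" "(f, g)"], of "\<lambda>t. TC t (Inl u)"]
  by (simp add: CAT_simps NS_x NT_x hom_psf_def N1_x N2_x FO_x FA_x TC_x)

end

text \<open>Taking \<open>f\<close> or \<open>g\<close> to be an identity and cancelling it with \<open>PI\<close>, the cells \<open>\<theta> f g u\<close> restrict to
  \<open>B g \<odot> X u \<Rightarrow> X (g \<odot> u)\<close> and \<open>X u \<odot> A f \<Rightarrow> X (u \<odot> f)\<close>, from which they can be recovered.\<close>

definition left_act where
  "left_act K L A B x g u = VComp L (wedge_cell x (Id1 K (Src K u)) g u)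
     (HComp L (Id2 L (P1 B g)) (HComp L (Id2 L (wedge_ob K x u)) (PI A (Src K u))))"

definition right_act where
  "right_act K L A B x u f = VComp L (wedge_cell x f (Id1 K (Trg K u)) u)
     (HComp L (PI B (Trg K u)) (HComp L (Id2 L (wedge_ob K x u)) (Id2 L (P1 A f))))"

definition eval_psn where
  "eval_psn K L A B x = \<lparr>NS = A, NT = B, N1 = (\<lambda>a\<in>Obj K. wedge_ob K x (Id1 K a)),
     N2 = (\<lambda>u\<in>Cell1 K. VComp L (inv2 L (right_act K L A B x (Id1 K (Trg K u)) u))
                                  (left_act K L A B x u (Id1 K (Src K u))))\<rparr>"

definition eval_mdf where
  "eval_mdf K L A B \<xi> = \<lparr>MS = eval_psn K L A B (MS \<xi>), MT = eval_psn K L A B (MT \<xi>),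
     MC = (\<lambda>a\<in>Obj K. wedge_mdf K \<xi> (Id1 K a))\<rparr>"

lemma eval_simps [simp]:
  "NS (eval_psn K L A B x) = A" "NT (eval_psn K L A B x) = B"
  "N1 (eval_psn K L A B x) = (\<lambda>a\<in>Obj K. wedge_ob K x (Id1 K a))"
  "MS (eval_mdf K L A B \<xi>) = eval_psn K L A B (MS \<xi>)" "MT (eval_mdf K L A B \<xi>) = eval_psn K L A B (MT \<xi>)"
  "MC (eval_mdf K L A B \<xi>) = (\<lambda>a\<in>Obj K. wedge_mdf K \<xi> (Id1 K a))"
  by (simp_all add: eval_psn_def eval_mdf_def)

context pseudoend_object
begin

abbreviation "lam \<equiv> left_act K L A B x"
abbreviation "rho \<equiv> right_act K L A B x"

lemma lam_simps [simp]:
  assumes "g \<in> Cell1 K" "u \<in> Cell1 K" "Src K g = Trg K u"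
  shows "iso2 L (lam g u)" "lam g u \<in> Cell2 L" "Dom2 L (lam g u) = P1 B g \<odot> X u" "Cod2 L (lam g u) = X (Comp1 K g u)"
  using assms by (simp_all add: left_act_def)

lemma rho_simps [simp]:
  assumes "u \<in> Cell1 K" "f \<in> Cell1 K" "Src K u = Trg K f"
  shows "iso2 L (rho u f)" "rho u f \<in> Cell2 L" "Dom2 L (rho u f) = X u \<odot> P1 A f" "Cod2 L (rho u f) = X (Comp1 K u f)"
  using assms by (simp_all add: right_act_def)

text \<open>The pair \<open>(f, g)\<close> factors as \<open>(f, id)\<close> followed by
  \<open>(id, g)\<close>, and \<open>\<theta>_comp\<close> splits \<open>\<theta> f g u\<close>
  accordingly, up to cells \<open>PC\<close> for composites with identities. The unit cells in
  \<open>?R\<close> cancel these by the right unit laws of A and B.\<close>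

lemma theta_lam_rho:
  assumes c: "f \<in> Cell1 K" "g \<in> Cell1 K" "u \<in> Cell1 K" "Src K u = Trg K f" "Trg K u = Src K g"
  shows "\<theta> f g u = lam g (Comp1 K u f) \<cdot> \<iota> (P1 B g) \<star> rho u f"
proof -
  let ?Bg = "P1 B g" and ?Af = "P1 A f" and ?b = "Src K g" and ?a = "Src K f"
  let ?R = "(\<iota> ?Bg \<star> PI B ?b) \<star> \<iota> (X u) \<star> \<iota> ?Af \<star> PI A ?a"
  have "(PC B (g, Id1 K ?b) \<star> \<iota> (X u) \<star> PC A (f, Id1 K ?a)) \<cdot> ?R
    = (PC B (g, Id1 K ?b) \<cdot> \<iota> ?Bg \<star> PI B ?b) \<star> \<iota> (X u) \<star> (PC A (f, Id1 K ?a) \<cdot> \<iota> ?Af \<star> PI A ?a)"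
    using c by (simp add: L.hcomp_vcomp del: L.hcomp_assoc L.hcomp_id2_merge)
  then have 1: "(PC B (g, Id1 K ?b) \<star> \<iota> (X u) \<star> PC A (f, Id1 K ?a)) \<cdot> ?R = \<iota> (?Bg \<odot> X u \<odot> ?Af)"
    using c by (simp add: pseudofunctor.pi_right [OF psf_A] pseudofunctor.pi_right [OF psf_B] del: L.hcomp_assoc)
  have "\<theta> f g u = (\<theta> f g u \<cdot> PC B (g, Id1 K ?b) \<star> \<iota> (X u) \<star> PC A (f, Id1 K ?a)) \<cdot> ?R"
    using c by (subst L.vcomp_assoc) (simp_all add: 1 del: L.hcomp_assoc L.hcomp_id2_merge)
  also have "\<dots> = (\<theta> (Id1 K ?a) g (Comp1 K u f) \<cdot> \<iota> ?Bg \<star> \<theta> f (Id1 K ?b) u \<star> \<iota> (P1 A (Id1 K ?a))) \<cdot> ?R"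
    using \<theta>_comp [of f "Id1 K ?a" "Id1 K ?b" g u] c by simp
  also have "\<dots> = \<theta> (Id1 K ?a) g (Comp1 K u f) \<cdot> \<iota> ?Bg \<star> rho u f \<star> PI A ?a"
    using c L.whisker_both [of "\<theta> f (Id1 K ?b) u" "PI B ?b \<star> \<iota> (X u \<odot> ?Af)" "\<iota> ?Bg" "PI A ?a"]
    by (simp add: right_act_def)
  also have "\<dots> = lam g (Comp1 K u f) \<cdot> \<iota> ?Bg \<star> rho u f"
    using c L.unit_right [of "\<iota> ?Bg \<star> rho u f" "PI A ?a"] by (simp add: left_act_def)
  finally show ?thesis .
qed

text \<open>The opposite factorisation, with \<open>g\<close> applied first, cancelled by the left
  unit laws. Comparison with \<open>theta_lam_rho\<close> shows that the left and right actions
  commute, which is how the pair is used in \<open>pseudonat_eval\<close> and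
  \<open>rho_theta\<close>.\<close>

lemma theta_rho_lam:
  assumes c: "f \<in> Cell1 K" "g \<in> Cell1 K" "u \<in> Cell1 K" "Src K u = Trg K f" "Trg K u = Src K g"
  shows "\<theta> f g u = rho (Comp1 K g u) f \<cdot> lam g u \<star> \<iota> (P1 A f)"
proof -
  let ?Bg = "P1 B g" and ?Af = "P1 A f" and ?b = "Trg K g" and ?a = "Trg K f"
  let ?R = "(PI B ?b \<star> \<iota> ?Bg) \<star> \<iota> (X u) \<star> PI A ?a \<star> \<iota> ?Af"
  have "(PC B (Id1 K ?b, g) \<star> \<iota> (X u) \<star> PC A (Id1 K ?a, f)) \<cdot> ?R
    = (PC B (Id1 K ?b, g) \<cdot> PI B ?b \<star> \<iota> ?Bg) \<star> \<iota> (X u) \<star> (PC A (Id1 K ?a, f) \<cdot> PI A ?a \<star> \<iota> ?Af)"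
    using c by (simp add: L.hcomp_vcomp del: L.hcomp_assoc L.hcomp_id2_merge)
  then have 1: "(PC B (Id1 K ?b, g) \<star> \<iota> (X u) \<star> PC A (Id1 K ?a, f)) \<cdot> ?R = \<iota> (?Bg \<odot> X u \<odot> ?Af)"
    using c by (simp add: pseudofunctor.pi_left [OF psf_A] pseudofunctor.pi_left [OF psf_B] del: L.hcomp_assoc)
  have "\<theta> f g u = (\<theta> f g u \<cdot> PC B (Id1 K ?b, g) \<star> \<iota> (X u) \<star> PC A (Id1 K ?a, f)) \<cdot> ?R"
    using c by (subst L.vcomp_assoc) (simp_all add: 1 del: L.hcomp_assoc L.hcomp_id2_merge)
  also have "\<dots> = (\<theta> f (Id1 K ?b) (Comp1 K g u) \<cdot> \<iota> (P1 B (Id1 K ?b)) \<star> \<theta> (Id1 K ?a) g u \<star> \<iota> ?Af) \<cdot> ?R"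
    using \<theta>_comp [of "Id1 K ?a" f g "Id1 K ?b" u] c by simp
  also have "\<dots> = \<theta> f (Id1 K ?b) (Comp1 K g u) \<cdot> PI B ?b \<star> lam g u \<star> \<iota> ?Af"
    using c L.whisker_both [of "\<theta> (Id1 K ?a) g u" "\<iota> (?Bg \<odot> X u) \<star> PI A ?a" "PI B ?b" "\<iota> ?Af"]
    by (simp add: left_act_def)
  also have "\<dots> = rho (Comp1 K g u) f \<cdot> lam g u \<star> \<iota> ?Af"
    using c L.unit_left [of "lam g u \<star> \<iota> ?Af" "PI B ?b"] by (simp add: right_act_def)
  finally show ?thesis .
qed

text \<open>By the left unit law at an identity, one unit cell may be replaced by two followed by
  the comparison cell. This supplies the extra unit needed when two actions are composed.\<close>

lemma PI_PI:
  assumes "pseudofunctor K L F" "a \<in> Obj K"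
  shows "PC F (Id1 K a, Id1 K a) \<cdot> PI F a \<star> PI F a = PI F a"
proof -
  note [simp] = psf_rules [OF assms(1)]
  have "PC F (Id1 K a, Id1 K a) \<cdot> PI F a \<star> PI F a
    = (PC F (Id1 K a, Id1 K a) \<cdot> PI F a \<star> \<iota> (P1 F (Id1 K a))) \<cdot> PI F a"
    using assms(2) L.unit_left [of "PI F a" "PI F a"] by simp
  then show ?thesis
    using assms pseudofunctor.pi_left [OF assms(1), of "Id1 K a"] by (simp del: L.vcomp_assoc)
qed

text \<open>This is \<open>\<theta>_comp\<close> with identities in the contravariant variable. The
  single unit \<open>PI A\<close> contained in \<open>lam\<close> is doubled by
  \<open>PI_PI\<close>, one copy for each of the two successive actions. \<open>rho_rho\<close> is
  the mirror image.\<close>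

lemma lam_lam:
  assumes c: "g' \<in> Cell1 K" "g \<in> Cell1 K" "u \<in> Cell1 K" "Src K g' = Trg K g" "Src K g = Trg K u"
  shows "lam g' (Comp1 K g u) \<cdot> \<iota> (P1 B g') \<star> lam g u = lam (Comp1 K g' g) u \<cdot> PC B (g', g) \<star> \<iota> (X u)"
proof -
  let ?a = "Src K u" and ?g = "Comp1 K g' g" let ?i = "Id1 K ?a"
  let ?R = "\<iota> (P1 B g' \<odot> P1 B g) \<star> \<iota> (X u) \<star> PI A ?a \<star> PI A ?a"
  have 1: "(PC B (g', g) \<star> \<iota> (X u) \<star> PC A (?i, ?i)) \<cdot> ?R = PC B (g', g) \<star> \<iota> (X u) \<star> PI A ?a"
    using c by (simp add: L.hcomp_vcomp PI_PI psf_A del: L.hcomp_assoc L.hcomp_id2_merge)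
  have "lam ?g u \<cdot> PC B (g', g) \<star> \<iota> (X u) = \<theta> ?i ?g u \<cdot> PC B (g', g) \<star> \<iota> (X u) \<star> PI A ?a"
    using c L.unit_right [of "PC B (g', g) \<star> \<iota> (X u)" "PI A ?a"] by (simp add: left_act_def)
  also have "\<dots> = (\<theta> ?i ?g u \<cdot> PC B (g', g) \<star> \<iota> (X u) \<star> PC A (?i, ?i)) \<cdot> ?R"
    using c by (subst L.vcomp_assoc) (simp_all add: 1 del: L.hcomp_assoc L.hcomp_id2_merge)
  also have "\<dots> = (\<theta> ?i g' (Comp1 K g u) \<cdot> \<iota> (P1 B g') \<star> \<theta> ?i g u \<star> \<iota> (P1 A ?i)) \<cdot> ?R"
    using \<theta>_comp [of ?i ?i g g' u] c by simp
  also have "\<dots> = \<theta> ?i g' (Comp1 K g u) \<cdot> \<iota> (P1 B g') \<star> lam g u \<star> PI A ?a"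
    using c L.whisker_both [of "\<theta> ?i g u" "\<iota> (P1 B g \<odot> X u) \<star> PI A ?a" "\<iota> (P1 B g')" "PI A ?a"]
    by (simp add: left_act_def)
  also have "\<dots> = lam g' (Comp1 K g u) \<cdot> \<iota> (P1 B g') \<star> lam g u"
    using c L.unit_right [of "\<iota> (P1 B g') \<star> lam g u" "PI A ?a"] by (simp add: left_act_def [of K L A B x g'])
  finally show ?thesis by simp
qed

lemma rho_rho:
  assumes c: "u \<in> Cell1 K" "f \<in> Cell1 K" "f' \<in> Cell1 K" "Src K u = Trg K f" "Src K f = Trg K f'"
  shows "rho (Comp1 K u f) f' \<cdot> rho u f \<star> \<iota> (P1 A f') = rho u (Comp1 K f f') \<cdot> \<iota> (X u) \<star> PC A (f, f')"
proof -
  let ?b = "Trg K u" and ?f = "Comp1 K f f'" let ?i = "Id1 K ?b"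
  let ?R = "(PI B ?b \<star> PI B ?b) \<star> \<iota> (X u) \<star> \<iota> (P1 A f \<odot> P1 A f')"
  have 1: "(PC B (?i, ?i) \<star> \<iota> (X u) \<star> PC A (f, f')) \<cdot> ?R = PI B ?b \<star> \<iota> (X u) \<star> PC A (f, f')"
    using c by (simp add: L.hcomp_vcomp PI_PI psf_B del: L.hcomp_normalize)
  have "rho u ?f \<cdot> \<iota> (X u) \<star> PC A (f, f') = \<theta> ?f ?i u \<cdot> PI B ?b \<star> \<iota> (X u) \<star> PC A (f, f')"
    using c L.unit_left [of "\<iota> (X u) \<star> PC A (f, f')" "PI B ?b"] by (simp add: right_act_def)
  also have "\<dots> = (\<theta> ?f ?i u \<cdot> PC B (?i, ?i) \<star> \<iota> (X u) \<star> PC A (f, f')) \<cdot> ?R"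
    using c by (subst L.vcomp_assoc) (simp_all add: 1 del: L.hcomp_normalize)
  also have "\<dots> = (\<theta> f' ?i (Comp1 K u f) \<cdot> \<iota> (P1 B ?i) \<star> \<theta> f ?i u \<star> \<iota> (P1 A f')) \<cdot> ?R"
    using \<theta>_comp [of f f' ?i ?i u] c by simp
  also have "\<dots> = \<theta> f' ?i (Comp1 K u f) \<cdot> PI B ?b \<star> rho u f \<star> \<iota> (P1 A f')"
    using c L.whisker_both [of "\<theta> f ?i u" "PI B ?b \<star> \<iota> (X u \<odot> P1 A f)" "PI B ?b" "\<iota> (P1 A f')"]
    by (simp add: right_act_def)
  also have "\<dots> = rho (Comp1 K u f) f' \<cdot> rho u f \<star> \<iota> (P1 A f')"
    using c L.unit_left [of "rho u f \<star> \<iota> (P1 A f')" "PI B ?b"] by (simp add: right_act_def [of K L A B x _ f'])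
  finally show ?thesis by simp
qed

lemma lam_natural:
  assumes c: "\<psi> \<in> Cell2 K" "u \<in> Cell1 K" "Src K (Dom2 K \<psi>) = Trg K u"
  shows "lam (Cod2 K \<psi>) u \<cdot> P2 B \<psi> \<star> \<iota> (X u) = X2 (HComp K \<psi> (Id2 K u)) \<cdot> lam (Dom2 K \<psi>) u"
proof -
  let ?a = "Src K u" let ?i = "Id1 K ?a"
  have "lam (Cod2 K \<psi>) u \<cdot> P2 B \<psi> \<star> \<iota> (X u) = \<theta> ?i (Cod2 K \<psi>) u \<cdot> P2 B \<psi> \<star> \<iota> (X u) \<star> PI A ?a"
    using c L.unit_right [of "P2 B \<psi> \<star> \<iota> (X u)" "PI A ?a"] by (simp add: left_act_def)
  also have "\<dots> = (\<theta> ?i (Cod2 K \<psi>) u \<cdot> P2 B \<psi> \<star> \<iota> (X u) \<star> \<iota> (P1 A ?i)) \<cdot> \<iota> (P1 B (Dom2 K \<psi>)) \<star> \<iota> (X u) \<star> PI A ?a"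
    using c by (simp add: L.hcomp_vcomp del: L.hcomp_normalize)
  also have "\<dots> = (X2 (HComp K \<psi> (Id2 K u)) \<cdot> \<theta> ?i (Dom2 K \<psi>) u) \<cdot> \<iota> (P1 B (Dom2 K \<psi>)) \<star> \<iota> (X u) \<star> PI A ?a"
    using \<theta>_natural [of "Id2 K ?i" \<psi> u] c by simp
  finally show ?thesis using c by (simp add: left_act_def)
qed

lemma rho_natural:
  assumes c: "\<phi> \<in> Cell2 K" "u \<in> Cell1 K" "Src K u = Trg K (Dom2 K \<phi>)"
  shows "rho u (Cod2 K \<phi>) \<cdot> \<iota> (X u) \<star> P2 A \<phi> = X2 (HComp K (Id2 K u) \<phi>) \<cdot> rho u (Dom2 K \<phi>)"
proof -
  let ?b = "Trg K u" let ?i = "Id1 K ?b"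
  have "rho u (Cod2 K \<phi>) \<cdot> \<iota> (X u) \<star> P2 A \<phi> = \<theta> (Cod2 K \<phi>) ?i u \<cdot> PI B ?b \<star> \<iota> (X u) \<star> P2 A \<phi>"
    using c L.unit_left [of "\<iota> (X u) \<star> P2 A \<phi>" "PI B ?b"] by (simp add: right_act_def)
  also have "\<dots> = (\<theta> (Cod2 K \<phi>) ?i u \<cdot> \<iota> (P1 B ?i) \<star> \<iota> (X u) \<star> P2 A \<phi>) \<cdot> PI B ?b \<star> \<iota> (X u) \<star> \<iota> (P1 A (Dom2 K \<phi>))"
    using c by (simp add: L.hcomp_vcomp del: L.hcomp_normalize)
  also have "\<dots> = (X2 (HComp K (Id2 K u) \<phi>) \<cdot> \<theta> (Dom2 K \<phi>) ?i u) \<cdot> PI B ?b \<star> \<iota> (X u) \<star> \<iota> (P1 A (Dom2 K \<phi>))"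
    using \<theta>_natural [of \<phi> "Id2 K ?i" u] c by simp
  finally show ?thesis using c by (simp add: right_act_def)
qed

text \<open>Both sides are \<open>\<theta>\<close> at three identities, applied to the units of B
  and A placed on the two sides of \<open>X (Id1 K a)\<close>.\<close>

lemma lam_rho_unit:
  assumes c: "a \<in> Obj K"
  shows "lam (Id1 K a) (Id1 K a) \<cdot> PI B a \<star> \<iota> (X (Id1 K a)) = rho (Id1 K a) (Id1 K a) \<cdot> \<iota> (X (Id1 K a)) \<star> PI A a"
  using c L.unit_right [of "PI B a \<star> \<iota> (X (Id1 K a))" "PI A a"] L.unit_left [of "\<iota> (X (Id1 K a)) \<star> PI A a" "PI B a"]
  by (simp add: left_act_def right_act_def)

abbreviation "E \<equiv> eval_psn K L A B x"

text \<open>Coherence arguments about \<open>N2 E u\<close> use this equation in place of its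
  definition by an inverse; it determines the cell because \<open>rho\<close> is invertible.\<close>

lemma rho_N2:
  assumes "u \<in> Cell1 K"
  shows "rho (Id1 K (Trg K u)) u \<cdot> N2 E u = lam u (Id1 K (Src K u))"
  using assms by (simp add: eval_psn_def L.inv2_vcomp_eq)

lemma N2_eval [simp]:
  assumes "u \<in> Cell1 K"
  shows "iso2 L (N2 E u)" "N2 E u \<in> Cell2 L" "Dom2 L (N2 E u) = P1 B u \<odot> X (Id1 K (Src K u))"
    "Cod2 L (N2 E u) = X (Id1 K (Trg K u)) \<odot> P1 A u"
  using assms by (simp_all add: eval_psn_def)

lemma N2_eval_unique:
  assumes "u \<in> Cell1 K" "\<alpha> \<in> Cell2 L" "Cod2 L \<alpha> = X (Id1 K (Trg K u)) \<odot> P1 A u"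
    "rho (Id1 K (Trg K u)) u \<cdot> \<alpha> = lam u (Id1 K (Src K u))"
  shows "N2 E u = \<alpha>"
  by (rule L.iso2_cancel_left [of "rho (Id1 K (Trg K u)) u"]) (use assms in \<open>simp_all add: rho_N2\<close>)

text \<open>Each axiom is composed with an invertible \<open>rho\<close> to remove the inverse in
  \<open>N2 E\<close>. What is left is naturality of the two actions, their compatibility with
  composition and with each other, and their agreement on units.\<close>

lemma pseudonat_eval: "pseudonat K L E"
proof (rule pseudonat.intro, goal_cases)
  case \<alpha>: (11 \<alpha>)
  let ?a = "Src K (Dom2 K \<alpha>)" and ?b = "Trg K (Dom2 K \<alpha>)" and ?u = "Dom2 K \<alpha>" and ?v = "Cod2 K \<alpha>"
  let ?i = "Id1 K ?a" and ?j = "Id1 K ?b"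
  have "N2 E ?v \<cdot> P2 B \<alpha> \<star> \<iota> (X ?i) = \<iota> (X ?j) \<star> P2 A \<alpha> \<cdot> N2 E ?u"
  proof (rule L.iso2_cancel_left [of "rho ?j ?v"])
    have "rho ?j ?v \<cdot> N2 E ?v \<cdot> P2 B \<alpha> \<star> \<iota> (X ?i) = lam ?v ?i \<cdot> P2 B \<alpha> \<star> \<iota> (X ?i)"
      using \<alpha> rho_N2 [of ?v] by (simp flip: L.vcomp_assoc)
    also have "\<dots> = X2 \<alpha> \<cdot> lam ?u ?i"
      using \<alpha> lam_natural [of \<alpha> ?i] by simp
    also have "\<dots> = (X2 \<alpha> \<cdot> rho ?j ?u) \<cdot> N2 E ?u"
      using \<alpha> rho_N2 [of ?u] by simp
    also have "\<dots> = rho ?j ?v \<cdot> \<iota> (X ?j) \<star> P2 A \<alpha> \<cdot> N2 E ?u"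
      using \<alpha> rho_natural [of \<alpha> ?j, symmetric] by simp
    finally show "rho ?j ?v \<cdot> N2 E ?v \<cdot> P2 B \<alpha> \<star> \<iota> (X ?i) = rho ?j ?v \<cdot> \<iota> (X ?j) \<star> P2 A \<alpha> \<cdot> N2 E ?u" .
  qed (use \<alpha> in simp_all)
  then show ?case
    using \<alpha> by simp
next
  case (12 g f)
  then have gf: "g \<in> Cell1 K" "f \<in> Cell1 K" "Src K g = Trg K f" by simp_all
  let ?h = "Comp1 K g f" and ?i = "Id1 K (Src K f)" and ?j = "Id1 K (Trg K f)" and ?k = "Id1 K (Trg K g)"
  have "N2 E ?h \<cdot> PC B (g, f) \<star> \<iota> (X ?i) = \<iota> (X ?k) \<star> PC A (g, f) \<cdot> N2 E g \<star> \<iota> (P1 A f) \<cdot> \<iota> (P1 B g) \<star> N2 E f"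
  proof (rule L.iso2_cancel_left [of "rho ?k ?h"])
    have "rho ?k ?h \<cdot> \<iota> (X ?k) \<star> PC A (g, f) \<cdot> N2 E g \<star> \<iota> (P1 A f) \<cdot> \<iota> (P1 B g) \<star> N2 E f
      = (rho g f \<cdot> rho ?k g \<star> \<iota> (P1 A f)) \<cdot> N2 E g \<star> \<iota> (P1 A f) \<cdot> \<iota> (P1 B g) \<star> N2 E f"
      using gf rho_rho [of ?k g f] by simp
    also have "\<dots> = rho g f \<cdot> (rho ?k g \<cdot> N2 E g) \<star> \<iota> (P1 A f) \<cdot> \<iota> (P1 B g) \<star> N2 E f"
      using gf by (simp add: L.whisker_right)
    also have "\<dots> = (rho g f \<cdot> lam g ?j \<star> \<iota> (P1 A f)) \<cdot> \<iota> (P1 B g) \<star> N2 E f"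
      using gf rho_N2 [of g] by simp
    \<comment> \<open>The left action by \<open>g\<close> and the right action by \<open>f\<close>
      commute on \<open>X ?j\<close>.\<close>
    also have "\<dots> = (lam g f \<cdot> \<iota> (P1 B g) \<star> rho ?j f) \<cdot> \<iota> (P1 B g) \<star> N2 E f"
      using gf theta_lam_rho [of f g ?j] theta_rho_lam [of f g ?j] by simp
    also have "\<dots> = lam g f \<cdot> \<iota> (P1 B g) \<star> (rho ?j f \<cdot> N2 E f)"
      using gf by (simp add: L.whisker_left)
    also have "\<dots> = lam ?h ?i \<cdot> PC B (g, f) \<star> \<iota> (X ?i)"
      using gf rho_N2 [of f] lam_lam [of g f ?i] by simp
    also have "\<dots> = rho ?k ?h \<cdot> N2 E ?h \<cdot> PC B (g, f) \<star> \<iota> (X ?i)"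
      using gf rho_N2 [of ?h] by (simp flip: L.vcomp_assoc)
    finally show "rho ?k ?h \<cdot> N2 E ?h \<cdot> PC B (g, f) \<star> \<iota> (X ?i)
      = rho ?k ?h \<cdot> \<iota> (X ?k) \<star> PC A (g, f) \<cdot> N2 E g \<star> \<iota> (P1 A f) \<cdot> \<iota> (P1 B g) \<star> N2 E f" by simp
  qed (use gf in simp_all)
  then show ?case
    using gf by simp
next
  case a: (13 a)
  let ?i = "Id1 K a"
  have "N2 E ?i \<cdot> PI B a \<star> \<iota> (X ?i) = \<iota> (X ?i) \<star> PI A a"
  proof (rule L.iso2_cancel_left [of "rho ?i ?i"])
    have "rho ?i ?i \<cdot> N2 E ?i \<cdot> PI B a \<star> \<iota> (X ?i) = lam ?i ?i \<cdot> PI B a \<star> \<iota> (X ?i)"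
      using a rho_N2 [of ?i] by (simp flip: L.vcomp_assoc)
    then show "rho ?i ?i \<cdot> N2 E ?i \<cdot> PI B a \<star> \<iota> (X ?i) = rho ?i ?i \<cdot> \<iota> (X ?i) \<star> PI A a"
      using a by (simp add: lam_rho_unit)
  qed (use a in simp_all)
  then show ?case
    using a by simp
qed (auto simp: psf_A psf_B eval_psn_def)

end

locale pseudoend_arrow = two_categories K L
  for K :: "('o, 'f, 'c) two_cat" and L :: "('p, 'g, 'd) two_cat" (structure) +
  fixes A B :: "('o, 'f, 'c, 'p, 'g, 'd) psf"
    and \<xi> :: "('o, 'f, 'c, 'g, 'd) pe_mdf"
  assumes psf_A: "pseudofunctor K L A" and psf_B: "pseudofunctor K L B"
    and ar_\<xi>: "\<xi> \<in> Ar (pseudoend K (hom_comp_psf K L A B))"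
begin

lemma mdf_\<xi>: "modification (opprod K) CAT \<xi>"
  using ar_\<xi> by (simp add: pseudoend_def PS_simps)

sublocale x: pseudoend_object K L A B "MS \<xi>"
  using ar_\<xi> psf_A psf_B modification.src_psn [OF mdf_\<xi>] modification.par_ns [OF mdf_\<xi>] modification.par_nt [OF mdf_\<xi>]
  by (intro pseudoend_object.intro pseudoend_object_axioms.intro two_categories_axioms) (simp_all add: pseudoend_def PS_simps)

sublocale y: pseudoend_object K L A B "MT \<xi>"
  using ar_\<xi> psf_A psf_B modification.trg_psn [OF mdf_\<xi>] modification.par_ns [OF mdf_\<xi>] modification.par_nt [OF mdf_\<xi>]
  by (intro pseudoend_object.intro pseudoend_object_axioms.intro two_categories_axioms) (simp_all add: pseudoend_def PS_simps)

abbreviation "Z \<equiv> wedge_mdf K \<xi>"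

lemma MC_\<xi>:
  assumes "a \<in> Obj K" "b \<in> Obj K"
  shows "is_nat (MC \<xi> (a, b))" "TS (MC \<xi> (a, b)) = N1 (MS \<xi>) (a, b)" "TT (MC \<xi> (a, b)) = N1 (MT \<xi>) (a, b)"
  using assms modification.mc_in [OF mdf_\<xi>, of "(a, b)"] modification.mc_dom [OF mdf_\<xi>, of "(a, b)"]
    modification.mc_cod [OF mdf_\<xi>, of "(a, b)"] by (simp_all add: CAT_simps)

lemma Z_rules:
  assumes u: "u \<in> Cell1 K"
  shows "\<lbrakk>a = Src K u; b = Trg K u\<rbrakk> \<Longrightarrow> TC (MC \<xi> (a, b)) (Inl u) = Inr (Z u)"
    "Z u \<in> Cell2 L" "Dom2 L (Z u) = x.X u" "Cod2 L (Z u) = y.X u"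
proof -
  let ?a = "Src K u" and ?b = "Trg K u"
  let ?C = "homcat L (P0 A ?a) (P0 B ?b)"
  have n: "is_nat (MC \<xi> (?a, ?b))" "TS (MC \<xi> (?a, ?b)) = N1 (MS \<xi>) (?a, ?b)" "TT (MC \<xi> (?a, ?b)) = N1 (MT \<xi>) (?a, ?b)"
    using u by (simp_all add: MC_\<xi>)
  have i: "Inl u \<in> Ob (FS (TS (MC \<xi> (?a, ?b))))" using u by (simp add: n x.N1_x)
  obtain t where t: "TC (MC \<xi> (?a, ?b)) (Inl u) = Inr t" "t \<in> Ar ?C"
    using is_nat.tc_in [OF n(1) i] u by (auto simp: n x.N1_x)
  have "Dom2 L t = x.X u" "Cod2 L t = y.X u"
    using is_nat.tc_dom [OF n(1) i] is_nat.tc_cod [OF n(1) i] u t by (simp_all add: n x.N1_x x.FO_x y.FO_x)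
  then show "\<lbrakk>a = Src K u; b = Trg K u\<rbrakk> \<Longrightarrow> TC (MC \<xi> (a, b)) (Inl u) = Inr (Z u)"
    "Z u \<in> Cell2 L" "Dom2 L (Z u) = x.X u" "Cod2 L (Z u) = y.X u"
    using t by (auto simp: wedge_mdf_def)
qed

lemmas TC_\<xi> = Z_rules(1) and Z_simps [simp] = Z_rules(2-4)

lemma Z_theta:
  assumes "f \<in> Cell1 K" "g \<in> Cell1 K" "u \<in> Cell1 K" "Src K u = Trg K f" "Trg K u = Src K g"
  shows "y.\<theta> f g u \<cdot> \<iota> (P1 B g) \<star> Z u \<star> \<iota> (P1 A f) = Z (Comp1 K g (Comp1 K u f)) \<cdot> x.\<theta> f g u"
  using assms arg_cong [OF modification.mc_nat [OF mdf_\<xi>, of "(f, g)"], of "\<lambda>t. TC t (Inl u)"]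
  by (simp add: CAT_simps x.NS_x x.NT_x hom_psf_def x.N1_x x.N2_x x.FO_x x.FA_x x.TC_x y.N1_x y.N2_x y.FO_x y.FA_x y.TC_x
    TC_\<xi> MC_\<xi>)

lemma Z_lam:
  assumes "g \<in> Cell1 K" "u \<in> Cell1 K" "Src K g = Trg K u"
  shows "y.lam g u \<cdot> \<iota> (P1 B g) \<star> Z u = Z (Comp1 K g u) \<cdot> x.lam g u"
proof -
  let ?a = "Src K u" let ?i = "Id1 K ?a"
  have "y.lam g u \<cdot> \<iota> (P1 B g) \<star> Z u = y.\<theta> ?i g u \<cdot> \<iota> (P1 B g) \<star> Z u \<star> PI A ?a"
    using assms L.unit_right [of "\<iota> (P1 B g) \<star> Z u" "PI A ?a"] by (simp add: left_act_def)
  also have "\<dots> = (y.\<theta> ?i g u \<cdot> \<iota> (P1 B g) \<star> Z u \<star> \<iota> (P1 A ?i)) \<cdot> \<iota> (P1 B g) \<star> \<iota> (x.X u) \<star> PI A ?a"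
    using assms by (simp add: L.hcomp_vcomp del: L.hcomp_normalize)
  also have "\<dots> = Z (Comp1 K g u) \<cdot> x.lam g u"
    using assms Z_theta [of ?i g u] by (simp add: left_act_def)
  finally show ?thesis .
qed

lemma Z_rho:
  assumes "u \<in> Cell1 K" "f \<in> Cell1 K" "Src K u = Trg K f"
  shows "y.rho u f \<cdot> Z u \<star> \<iota> (P1 A f) = Z (Comp1 K u f) \<cdot> x.rho u f"
proof -
  let ?b = "Trg K u" let ?i = "Id1 K ?b"
  have "y.rho u f \<cdot> Z u \<star> \<iota> (P1 A f) = y.\<theta> f ?i u \<cdot> PI B ?b \<star> Z u \<star> \<iota> (P1 A f)"
    using assms L.unit_left [of "Z u \<star> \<iota> (P1 A f)" "PI B ?b"] by (simp add: right_act_def)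
  also have "\<dots> = (y.\<theta> f ?i u \<cdot> \<iota> (P1 B ?i) \<star> Z u \<star> \<iota> (P1 A f)) \<cdot> PI B ?b \<star> \<iota> (x.X u) \<star> \<iota> (P1 A f)"
    using assms by (simp add: L.hcomp_vcomp del: L.hcomp_normalize)
  also have "\<dots> = Z (Comp1 K u f) \<cdot> x.rho u f"
    using assms Z_theta [of f ?i u] by (simp add: right_act_def)
  finally show ?thesis .
qed

text \<open>After composing with \<open>y.rho\<close>, \<open>Z_lam\<close> carries the component at
  the identity of the source of \<open>u\<close> to \<open>Z u\<close>, and \<open>Z_rho\<close>
  carries that on to the component at the identity of the target.\<close>

lemma modification_eval: "modification K L (eval_mdf K L A B \<xi>)"
proof (rule modification.intro, goal_cases)
  case u: (9 u)
  let ?i = "Id1 K (Src K u)" and ?j = "Id1 K (Trg K u)"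
  have "N2 y.E u \<cdot> \<iota> (P1 B u) \<star> Z ?i = Z ?j \<star> \<iota> (P1 A u) \<cdot> N2 x.E u"
  proof (rule L.iso2_cancel_left [of "y.rho ?j u"])
    have "y.rho ?j u \<cdot> N2 y.E u \<cdot> \<iota> (P1 B u) \<star> Z ?i = y.lam u ?i \<cdot> \<iota> (P1 B u) \<star> Z ?i"
      using u y.rho_N2 [of u] by (simp flip: L.vcomp_assoc)
    also have "\<dots> = (Z u \<cdot> x.rho ?j u) \<cdot> N2 x.E u"
      using u Z_lam [of u ?i] x.rho_N2 [of u] by simp
    also have "\<dots> = y.rho ?j u \<cdot> Z ?j \<star> \<iota> (P1 A u) \<cdot> N2 x.E u"
      using u Z_rho [of ?j u, symmetric] by simp
    finally show "y.rho ?j u \<cdot> N2 y.E u \<cdot> \<iota> (P1 B u) \<star> Z ?i = y.rho ?j u \<cdot> Z ?j \<star> \<iota> (P1 A u) \<cdot> N2 x.E u" .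
  qed (use u in simp_all)
  then show ?case
    using u by simp
qed (auto simp: x.pseudonat_eval y.pseudonat_eval)

end

context two_categories
begin

lemma pseudoend_objectI:
  "\<lbrakk>pseudofunctor K L A; pseudofunctor K L B; x \<in> Ob (pseudoend K (hom_comp_psf K L A B))\<rbrakk>
    \<Longrightarrow> pseudoend_object K L A B x"
  by (intro pseudoend_object.intro pseudoend_object_axioms.intro two_categories_axioms)

lemma pseudoend_arrowI:
  "\<lbrakk>pseudofunctor K L A; pseudofunctor K L B; \<xi> \<in> Ar (pseudoend K (hom_comp_psf K L A B))\<rbrakk>
    \<Longrightarrow> pseudoend_arrow K L A B \<xi>"
  by (intro pseudoend_arrow.intro pseudoend_arrow_axioms.intro two_categories_axioms)

end

lemma PS_sel [simp]:
  "MS (Id2 (PS K L) n) = n" "MT (Id2 (PS K L) n) = n" "MC (Id2 (PS K L) n) = (\<lambda>a\<in>Obj K. Id2 L (N1 n a))"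
  "MS (VComp (PS K L) m' m) = MS m" "MT (VComp (PS K L) m' m) = MT m'"
  "MC (VComp (PS K L) m' m) = (\<lambda>a\<in>Obj K. VComp L (MC m' a) (MC m a))"
  "MS (HComp (PS K L) m' m) = psn_comp K L (MS m') (MS m)" "MT (HComp (PS K L) m' m) = psn_comp K L (MT m') (MT m)"
  "MC (HComp (PS K L) m' m) = (\<lambda>a\<in>Obj K. HComp L (MC m' a) (MC m a))"
  by (simp_all add: PS_simps)

lemma pseudoend_simps [simp]:
  "Dom (pseudoend K T) = MS" "Cod (pseudoend K T) = MT" "Idn (pseudoend K T) = Id2 (PE K)"
  "Cmp (pseudoend K T) = VComp (PE K)"
  by (simp_all add: pseudoend_def PS_simps(6,7))

section \<open>Functoriality and naturality of the evaluation\<close>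

abbreviation target_psf :: "('o, 'f, 'c) two_cat \<Rightarrow> ('p, 'g, 'd) two_cat
    \<Rightarrow> ('o, 'f, 'c, 'p, 'g, 'd) psf \<Rightarrow> ('o, 'f, 'c, 'p, 'g, 'd) psf
    \<Rightarrow> ('o, 'f, 'c, 'g, 'd) pe_psf" where
  "target_psf K H A B \<equiv> psf_map Inr Inr (opprod K) (hom_comp_psf K H A B)"
abbreviation target_psn :: "('o, 'f, 'c) two_cat \<Rightarrow> ('p, 'g, 'd) two_cat
    \<Rightarrow> ('o, 'f, 'c, 'p, 'g, 'd) psn \<Rightarrow> ('o, 'f, 'c, 'p, 'g, 'd) psn
    \<Rightarrow> ('o, 'f, 'c, 'g, 'd) pe_psn" where
  "target_psn K H \<gamma> \<delta> \<equiv> psn_map Inr Inr (opprod K) (hom_comp_psn K H \<gamma> \<delta>)"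
abbreviation target_mdf :: "('o, 'f, 'c) two_cat \<Rightarrow> ('p, 'g, 'd) two_cat
    \<Rightarrow> ('o, 'f, 'c, 'p, 'g, 'd) mdf \<Rightarrow> ('o, 'f, 'c, 'p, 'g, 'd) mdf
    \<Rightarrow> ('o, 'f, 'c, 'g, 'd) pe_mdf" where
  "target_mdf K H m m' \<equiv> mdf_map Inr Inr (opprod K) (hom_comp_mdf K H m m')"

context two_categories
begin

lemma two_category_PE: "two_category (PE K)"
  by (intro two_categories.two_category_PS two_categories.intro two_category_opprod K.two_category_axioms two_category_CAT)

lemma target_simps:
  "pseudofunctor K L A \<Longrightarrow> pseudofunctor K L B \<Longrightarrow> pseudofunctor (opprod K) CAT (target_psf K L A B)"
  "pseudonat K L \<gamma> \<Longrightarrow> pseudonat K L \<delta> \<Longrightarrow> pseudonat (opprod K) CAT (target_psn K L \<gamma> \<delta>)"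
  "modification K L m \<Longrightarrow> modification K L m' \<Longrightarrow> modification (opprod K) CAT (target_mdf K L m m')"
proof -
  interpret T: strict_two_functor "opprod (PS K L)" "PE K" "\<lambda>(A, B). target_psf K L A B"
    "\<lambda>(\<gamma>, \<delta>). target_psn K L \<gamma> \<delta>" "\<lambda>(m, m'). target_mdf K L m m'"
    by (rule strict_two_functor_hom_comp)
  show "pseudofunctor K L A \<Longrightarrow> pseudofunctor K L B \<Longrightarrow> pseudofunctor (opprod K) CAT (target_psf K L A B)"
    "pseudonat K L \<gamma> \<Longrightarrow> pseudonat K L \<delta> \<Longrightarrow> pseudonat (opprod K) CAT (target_psn K L \<gamma> \<delta>)"
    "modification K L m \<Longrightarrow> modification K L m' \<Longrightarrow> modification (opprod K) CAT (target_mdf K L m m')"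
    using T.q0_in [of "(A, B)"] T.q1_in [of "(\<gamma>, \<delta>)"] T.q2_in [of "(m, m')"] by (simp_all add: PS_simps)
qed

lemma category_pseudoend: "category (pseudoend K (hom_comp_psf K L A B))"
  unfolding pseudoend_def by (rule two_category.category_homcat [OF two_category_PE])

lemma wedge_mdf_id:
  assumes "pseudoend_object K L A B x" "u \<in> Cell1 K"
  shows "wedge_mdf K (Id2 (PE K) x) u = \<iota> (wedge_ob K x u)"
proof -
  interpret x: pseudoend_object K L A B x by fact
  show ?thesis using assms(2) by (simp add: wedge_mdf_def CAT_simps x.N1_x x.FO_x)
qed

lemma wedge_mdf_vcomp:
  assumes "pseudoend_arrow K L A B \<zeta>" "pseudoend_arrow K L A B \<xi>" "u \<in> Cell1 K"
  shows "wedge_mdf K (VComp (PE K) \<zeta> \<xi>) u = wedge_mdf K \<zeta> u \<cdot> wedge_mdf K \<xi> u"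
proof -
  interpret x: pseudoend_arrow K L A B \<xi> by fact
  interpret z: pseudoend_arrow K L A B \<zeta> by fact
  show ?thesis
    using assms(3) by (simp add: wedge_mdf_def [of K "VComp (PE K) \<zeta> \<xi>"] CAT_simps x.MC_\<xi> x.x.N1_x x.TC_\<xi> z.TC_\<xi>)
qed

lemma functorial_eval:
  assumes AB: "pseudofunctor K L A" "pseudofunctor K L B"
  shows "functorial (pseudoend K (hom_comp_psf K L A B)) (homcat (PS K L) A B) (eval_psn K L A B) (eval_mdf K L A B)"
proof -
  let ?C = "pseudoend K (hom_comp_psf K L A B)"
  interpret PS: two_category "PS K L" by (rule two_category_PS)
  note C = category_pseudoend [of A B]
  note ob = pseudoend_objectI [OF AB] and ar = pseudoend_arrowI [OF AB]
  have id: "eval_mdf K L A B (Id2 (PE K) x) = Id2 (PS K L) (eval_psn K L A B x)" if x: "x \<in> Ob ?C" for x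
  proof (rule mdf_eqI [of K L])
    have "Id2 (PE K) x \<in> Ar ?C" using category.idn_in [OF C x] by simp
    then show "modification K L (eval_mdf K L A B (Id2 (PE K) x))"
      by (rule pseudoend_arrow.modification_eval [OF ar])
  qed (simp_all add: modification_id pseudoend_object.pseudonat_eval [OF ob [OF x]] wedge_mdf_id [OF ob [OF x]])
  have cmp: "eval_mdf K L A B (VComp (PE K) \<zeta> \<xi>) = VComp (PS K L) (eval_mdf K L A B \<zeta>) (eval_mdf K L A B \<xi>)"
    if x: "\<zeta> \<in> Ar ?C" "\<xi> \<in> Ar ?C" "MS \<zeta> = MT \<xi>" for \<zeta> \<xi>
  proof (rule mdf_eqI [of K L])
    have "VComp (PE K) \<zeta> \<xi> \<in> Ar ?C" using category.cmp_in [OF C x(1,2)] x(3) by simp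
    then show "modification K L (eval_mdf K L A B (VComp (PE K) \<zeta> \<xi>))"
      by (rule pseudoend_arrow.modification_eval [OF ar])
    show "modification K L (VComp (PS K L) (eval_mdf K L A B \<zeta>) (eval_mdf K L A B \<xi>))"
      using x by (intro modification_vcomp pseudoend_arrow.modification_eval ar) simp_all
  qed (simp_all add: wedge_mdf_vcomp [OF ar ar] x)
  show ?thesis
    unfolding functorial_def
    using C PS.category_homcat pseudoend_object.pseudonat_eval [OF ob] pseudoend_arrow.modification_eval [OF ar] id cmp
    by (simp add: PS_simps(1-9))
qed

end

text \<open>Whiskering of an object of the pseudoend by \<open>\<gamma>\<close> before and
  \<open>\<delta>\<close> after. Besides the naturality of evaluation it also describes the
  quasi-inverse, where \<open>\<gamma>\<close> is an identity and \<open>x\<close> is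
  \<open>hom_action\<close>.\<close>

locale pseudoend_post = two_categories K L
  for K :: "('o, 'f, 'c) two_cat" and L :: "('p, 'g, 'd) two_cat" (structure) +
  fixes \<gamma> \<delta> :: "('o, 'f, 'c, 'p, 'g, 'd) psn"
    and x :: "('o, 'f, 'c, 'g, 'd) pe_psn"
  assumes psn_\<gamma>: "pseudonat K L \<gamma>" and psn_\<delta>: "pseudonat K L \<delta>"
    and ob_x: "x \<in> Ob (pseudoend K (hom_comp_psf K L (NT \<gamma>) (NS \<delta>)))"
begin

lemmas [simp] = psn_rules [OF psn_\<gamma>] psn_rules [OF psn_\<delta>]

abbreviation "y \<equiv> psn_comp (opprod K) CAT (target_psn K L \<gamma> \<delta>) x"

sublocale x: pseudoend_object K L "NT \<gamma>" "NS \<delta>" x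
  by (intro pseudoend_objectI ob_x) simp_all

lemma psn_y: "y \<in> Ob (pseudoend K (hom_comp_psf K L (NS \<gamma>) (NT \<delta>)))"
proof -
  interpret PE: two_category "PE K" by (rule two_category_PE)
  have "Comp1 (PE K) (target_psn K L \<gamma> \<delta>) x \<in> Cell1 (PE K)"
    by (rule PE.cell1_simps) (simp_all add: PS_simps x.psn_x x.NT_x target_simps psn_\<gamma> psn_\<delta>)
  then show ?thesis
    by (simp add: pseudoend_def PS_simps x.NS_x)
qed

sublocale y: pseudoend_object K L "NS \<gamma>" "NT \<delta>" y
  by (intro pseudoend_objectI psn_y) simp_all

lemma X_post [simp]: "u \<in> Cell1 K \<Longrightarrow> y.X u = N1 \<delta> (Trg K u) \<odot> x.X u \<odot> N1 \<gamma> (Src K u)"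
  by (simp add: wedge_ob_def [of K y] CAT_simps x.N1_x x.FO_x)

lemma X2_post: "\<mu> \<in> Cell2 K \<Longrightarrow>
    y.X2 \<mu> = \<iota> (N1 \<delta> (Trg K (Dom2 K \<mu>))) \<star> x.X2 \<mu> \<star> \<iota> (N1 \<gamma> (Src K (Dom2 K \<mu>)))"
  by (simp add: wedge_ar_def [of K y] CAT_simps x.N1_x x.FA_x)

lemma theta_post:
  assumes "f \<in> Cell1 K" "g \<in> Cell1 K" "u \<in> Cell1 K" "Src K u = Trg K f" "Trg K u = Src K g"
  shows "y.\<theta> f g u = \<iota> (N1 \<delta> (Trg K g)) \<star> x.\<theta> f g u \<star> \<iota> (N1 \<gamma> (Src K f)) \<cdot> N2 \<delta> g \<star> \<iota> (x.X u) \<star> inv2 L (N2 \<gamma> f)"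
  using assms by (simp add: wedge_cell_def [of y] CAT_simps x.N1_x x.N2_x x.FO_x x.TC_x)

text \<open>The left action uses \<open>\<theta>\<close> at an identity in the contravariant
  variable. The square of \<open>\<gamma>\<close> thus occurs only at an identity, where the unit
  axiom trades it for a unit cell, and only the square of \<open>\<delta>\<close> survives.\<close>

lemma lam_post:
  assumes c: "g \<in> Cell1 K" "u \<in> Cell1 K" "Src K g = Trg K u"
  shows "y.lam g u = \<iota> (N1 \<delta> (Trg K g)) \<star> x.lam g u \<star> \<iota> (N1 \<gamma> (Src K u)) \<cdot> N2 \<delta> g \<star> \<iota> (x.X u \<odot> N1 \<gamma> (Src K u))"
proof -
  let ?a = "Src K u" let ?i = "Id1 K ?a"
  have "inv2 L (N2 \<gamma> ?i) \<cdot> \<iota> (N1 \<gamma> ?a) \<star> PI (NS \<gamma>) ?a = inv2 L (N2 \<gamma> ?i) \<cdot> N2 \<gamma> ?i \<cdot> PI (NT \<gamma>) ?a \<star> \<iota> (N1 \<gamma> ?a)"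
    using c by (simp add: pseudonat.n2_id [OF psn_\<gamma>])
  then have 1: "inv2 L (N2 \<gamma> ?i) \<cdot> \<iota> (N1 \<gamma> ?a) \<star> PI (NS \<gamma>) ?a = PI (NT \<gamma>) ?a \<star> \<iota> (N1 \<gamma> ?a)"
    using c by (simp flip: L.vcomp_assoc)
  have "N2 \<delta> g \<star> \<iota> (x.X u) \<star> inv2 L (N2 \<gamma> ?i) \<cdot> \<iota> (P1 (NT \<delta>) g \<odot> N1 \<delta> (Trg K u)) \<star> \<iota> (x.X u) \<star> \<iota> (N1 \<gamma> ?a) \<star> PI (NS \<gamma>) ?a
    = N2 \<delta> g \<star> \<iota> (x.X u) \<star> (inv2 L (N2 \<gamma> ?i) \<cdot> \<iota> (N1 \<gamma> ?a) \<star> PI (NS \<gamma>) ?a)"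
    using c by (simp add: L.hcomp_vcomp del: L.hcomp_normalize)
  also have "\<dots> = \<iota> (N1 \<delta> (Trg K g) \<odot> P1 (NS \<delta>) g) \<star> \<iota> (x.X u) \<star> PI (NT \<gamma>) ?a \<star> \<iota> (N1 \<gamma> ?a) \<cdot> N2 \<delta> g \<star> \<iota> (x.X u \<odot> N1 \<gamma> ?a)"
    using c by (subst L.hcomp_whisker(1)) (simp_all add: 1 del: L.hcomp_id2_merge)
  finally show ?thesis
    using c by (simp add: theta_post left_act_def L.whisker_left L.whisker_right)
qed

text \<open>Dually to \<open>lam_post\<close>, the unit axiom of \<open>\<delta>\<close> removes the
  square of \<open>\<delta>\<close>; the square of \<open>\<gamma>\<close> stays, in inverted
  form.\<close>

lemma rho_post:
  assumes c: "u \<in> Cell1 K" "f \<in> Cell1 K" "Src K u = Trg K f"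
  shows "y.rho u f = \<iota> (N1 \<delta> (Trg K u)) \<star> x.rho u f \<star> \<iota> (N1 \<gamma> (Src K f)) \<cdot> \<iota> (N1 \<delta> (Trg K u) \<odot> x.X u) \<star> inv2 L (N2 \<gamma> f)"
proof -
  let ?b = "Trg K u" and ?a = "Src K f" let ?i = "Id1 K ?b"
  have "N2 \<delta> ?i \<star> \<iota> (x.X u) \<star> inv2 L (N2 \<gamma> f) \<cdot> (PI (NT \<delta>) ?b \<star> \<iota> (N1 \<delta> ?b)) \<star> \<iota> (x.X u) \<star> \<iota> (N1 \<gamma> (Trg K f) \<odot> P1 (NS \<gamma>) f)
    = (\<iota> (N1 \<delta> ?b) \<star> PI (NS \<delta>) ?b) \<star> \<iota> (x.X u) \<star> inv2 L (N2 \<gamma> f)"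
    using c by (simp add: L.hcomp_vcomp pseudonat.n2_id [OF psn_\<delta>] del: L.hcomp_normalize)
  also have "\<dots> = (\<iota> (N1 \<delta> ?b) \<star> PI (NS \<delta>) ?b) \<star> \<iota> (x.X u \<odot> P1 (NT \<gamma>) f \<odot> N1 \<gamma> ?a) \<cdot> \<iota> (N1 \<delta> ?b \<odot> x.X u) \<star> inv2 L (N2 \<gamma> f)"
    using c by (subst L.hcomp_whisker(2)) simp_all
  finally show ?thesis
    using c by (simp add: theta_post right_act_def L.whisker_left L.whisker_right)
qed

text \<open>The inverted square of \<open>\<gamma>\<close> in \<open>rho_post\<close> cancels the
  square of \<open>\<gamma>\<close> in the composite on the right. The two transformations are
  therefore equal and not merely isomorphic, which makes evaluation strictly natural on
  objects.\<close>

lemma eval_post: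
  "eval_psn K L (NS \<gamma>) (NT \<delta>) y = psn_comp K L \<delta> (psn_comp K L (eval_psn K L (NT \<gamma>) (NS \<delta>) x) \<gamma>)"
proof (rule psn_eqI [of K L])
  show "pseudonat K L (psn_comp K L \<delta> (psn_comp K L (eval_psn K L (NT \<gamma>) (NS \<delta>) x) \<gamma>))"
    by (intro pseudonat_comp psn_\<gamma> psn_\<delta> x.pseudonat_eval) simp_all
  fix u assume u: "u \<in> Cell1 K"
  let ?a = "Src K u" and ?b = "Trg K u" let ?j = "Id1 K ?b"
  have 1: "\<iota> (N1 \<delta> ?b \<odot> x.X ?j) \<star> inv2 L (N2 \<gamma> u) \<cdot> \<iota> (N1 \<delta> ?b \<odot> x.X ?j) \<star> N2 \<gamma> u = \<iota> (N1 \<delta> ?b \<odot> x.X ?j \<odot> P1 (NT \<gamma>) u \<odot> N1 \<gamma> ?a)"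
    using u by (simp flip: L.whisker_left)
  have 2: "\<iota> (N1 \<delta> ?b) \<star> x.rho ?j u \<star> \<iota> (N1 \<gamma> ?a) \<cdot> \<iota> (N1 \<delta> ?b) \<star> N2 x.E u \<star> \<iota> (N1 \<gamma> ?a)
    = \<iota> (N1 \<delta> ?b) \<star> x.lam u (Id1 K ?a) \<star> \<iota> (N1 \<gamma> ?a)"
    using u by (simp add: x.rho_N2 flip: L.whisker_left L.whisker_right)
  show "N2 y.E u = N2 (psn_comp K L \<delta> (psn_comp K L x.E \<gamma>)) u"
  proof (rule y.N2_eval_unique)
    show "y.rho ?j u \<cdot> N2 (psn_comp K L \<delta> (psn_comp K L x.E \<gamma>)) u = y.lam u (Id1 K ?a)"
      using u by (simp add: rho_post lam_post L.whisker_left L.vcomp_reassoc [OF 1] L.vcomp_reassoc [OF 2])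
  qed (use u in simp_all)
qed (simp_all add: y.pseudonat_eval)

end

lemma (in two_categories) pseudoend_postI:
  "\<lbrakk>pseudonat K L \<gamma>; pseudonat K L \<delta>; x \<in> Ob (pseudoend K (hom_comp_psf K L (NT \<gamma>) (NS \<delta>)))\<rbrakk>
    \<Longrightarrow> pseudoend_post K L \<gamma> \<delta> x"
  by (intro pseudoend_post.intro pseudoend_post_axioms.intro two_categories_axioms)

text \<open>Whiskering acts on the cells of an arrow by horizontal composition with components of
  \<open>m'\<close> and \<open>m\<close>. Specialised to identities this gives the components of the
  evaluated modification, while sources and targets agree by \<open>eval_post\<close> for
  \<open>MS\<close> and \<open>MT\<close>.\<close>

lemma (in two_categories) eval_mdf_post:
  assumes m: "modification K L m" and m': "modification K L m'"
    and \<xi>: "\<xi> \<in> Ar (pseudoend K (hom_comp_psf K L (NT (MS m)) (NS (MS m'))))"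
  defines "\<zeta> \<equiv> HComp (PE K) (target_mdf K L m m') \<xi>"
  shows "\<zeta> \<in> Ar (pseudoend K (hom_comp_psf K L (NS (MS m)) (NT (MS m'))))"
    and "u \<in> Cell1 K \<Longrightarrow> wedge_mdf K \<zeta> u = MC m' (Trg K u) \<star> wedge_mdf K \<xi> u \<star> MC m (Src K u)"
    and "eval_mdf K L (NS (MS m)) (NT (MS m')) \<zeta>
      = HComp (PS K L) m' (HComp (PS K L) (eval_mdf K L (NT (MS m)) (NS (MS m')) \<xi>) m)"
proof -
  interpret PE: two_category "PE K" by (rule two_category_PE)
  note r = mdf_rules psn_rules psf_rules m m'
  interpret x: pseudoend_arrow K L "NT (MS m)" "NS (MS m')" \<xi>
    by (intro pseudoend_arrowI \<xi>) (simp_all add: r)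
  have "\<zeta> \<in> Cell2 (PE K)"
    unfolding \<zeta>_def
    by (rule PE.hcomp_simps) (simp_all add: PS_simps x.mdf_\<xi> x.x.NT_x target_simps r)
  then show \<zeta>: "\<zeta> \<in> Ar (pseudoend K (hom_comp_psf K L (NS (MS m)) (NT (MS m'))))"
    by (simp add: \<zeta>_def pseudoend_def PS_simps x.x.NS_x)
  interpret z: pseudoend_arrow K L "NS (MS m)" "NT (MS m')" \<zeta>
    by (intro pseudoend_arrowI \<zeta>) (simp_all add: r)
  show Z: "wedge_mdf K \<zeta> u = MC m' (Trg K u) \<star> wedge_mdf K \<xi> u \<star> MC m (Src K u)" if "u \<in> Cell1 K" for u
    using that
    by (simp add: \<zeta>_def wedge_mdf_def [of K "\<lparr>MS = _, MT = _, MC = _\<rparr>"] PS_simps CAT_simps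
        x.MC_\<xi> x.TC_\<xi> x.x.N1_x x.y.N1_x x.x.FO_x x.y.FO_x r L.hcomp_vcomp
        del: L.hcomp_id2_merge L.hcomp_assoc)
  interpret s: pseudoend_post K L "MS m" "MS m'" "MS \<xi>"
    by (intro pseudoend_postI x.x.ob_x) (simp_all add: r)
  interpret t: pseudoend_post K L "MT m" "MT m'" "MT \<xi>"
    using x.y.ob_x by (intro pseudoend_postI) (simp_all add: r)
  have MS: "MS \<zeta> = s.y" "MT \<zeta> = t.y" by (simp_all add: \<zeta>_def PS_simps)
  show "eval_mdf K L (NS (MS m)) (NT (MS m')) \<zeta>
      = HComp (PS K L) m' (HComp (PS K L) (eval_mdf K L (NT (MS m)) (NS (MS m')) \<xi>) m)" (is "_ = ?R")
  proof (rule mdf_eqI [of K L])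
    have 1: "modification K L (HComp (PS K L) (eval_mdf K L (NT (MS m)) (NS (MS m')) \<xi>) m)"
      by (intro modification_hcomp m x.modification_eval) simp
    show "modification K L ?R"
      by (rule modification_hcomp [OF m' 1]) (simp add: PS_simps)
    show "MS (eval_mdf K L (NS (MS m)) (NT (MS m')) \<zeta>) = MS ?R"
      using s.eval_post by (simp add: MS PS_simps)
    show "MT (eval_mdf K L (NS (MS m)) (NT (MS m')) \<zeta>) = MT ?R"
      using t.eval_post by (simp add: MS PS_simps r)
  qed (use Z in \<open>simp_all add: z.modification_eval PS_simps\<close>)
qed

section \<open>The inverse equivalence\<close>

lemma CAT_eqI:
  fixes s t :: "('o, 'a) ntr"
  assumes "s \<in> Cell2 CAT" "t \<in> Cell2 CAT" "Dom2 CAT s = Dom2 CAT t" "Cod2 CAT s = Cod2 CAT t"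
    "\<And>x. x \<in> Ob (Src CAT (Dom2 CAT s)) \<Longrightarrow> TC s x = TC t x"
  shows "s = t"
  using assms by (intro ntr_eqI) (simp_all add: CAT_simps)

text \<open>A 2-cell of \<open>CAT\<close> with given boundary is determined by its components, so
  the axioms are needed only at objects \<open>x\<close>, and invertibility only for single arrows.
  The boundaries of the composites in the axioms are settled here once.\<close>

lemma pseudonat_CATI:
  fixes n :: "('o, 'f, 'c, ('x, 'y) cat, ('x, 'y) ftr, ('x, 'y) ntr) psn"
  assumes J: "two_category J"
    and S: "pseudofunctor J CAT (NS n)" and T: "pseudofunctor J CAT (NT n)"
    and ext: "N1 n \<in> extensional (Obj J)" "N2 n \<in> extensional (Cell1 J)"
    and n1: "\<And>a. a \<in> Obj J \<Longrightarrow> is_functor (N1 n a)" "\<And>a. a \<in> Obj J \<Longrightarrow> FS (N1 n a) = P0 (NS n) a"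
      "\<And>a. a \<in> Obj J \<Longrightarrow> FT (N1 n a) = P0 (NT n) a"
    and n2: "\<And>f. f \<in> Cell1 J \<Longrightarrow> is_nat (N2 n f)"
      "\<And>f. f \<in> Cell1 J \<Longrightarrow> TS (N2 n f) = ftr_comp (P1 (NT n) f) (N1 n (Src J f))"
      "\<And>f. f \<in> Cell1 J \<Longrightarrow> TT (N2 n f) = ftr_comp (N1 n (Trg J f)) (P1 (NS n) f)"
      "\<And>f x. f \<in> Cell1 J \<Longrightarrow> x \<in> Ob (P0 (NS n) (Src J f)) \<Longrightarrow> iso_arr (P0 (NT n) (Trg J f)) (TC (N2 n f) x)"
    and nat: "\<And>\<alpha> x. \<alpha> \<in> Cell2 J \<Longrightarrow> x \<in> Ob (P0 (NS n) (Src J (Dom2 J \<alpha>))) \<Longrightarrow>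
      TC (VComp CAT (N2 n (Cod2 J \<alpha>)) (HComp CAT (P2 (NT n) \<alpha>) (Id2 CAT (N1 n (Src J (Dom2 J \<alpha>)))))) x
      = TC (VComp CAT (HComp CAT (Id2 CAT (N1 n (Trg J (Dom2 J \<alpha>)))) (P2 (NS n) \<alpha>)) (N2 n (Dom2 J \<alpha>))) x"
    and comp: "\<And>g f x. g \<in> Cell1 J \<Longrightarrow> f \<in> Cell1 J \<Longrightarrow> Src J g = Trg J f \<Longrightarrow> x \<in> Ob (P0 (NS n) (Src J f)) \<Longrightarrow>
      TC (VComp CAT (N2 n (Comp1 J g f)) (HComp CAT (PC (NT n) (g, f)) (Id2 CAT (N1 n (Src J f))))) x
      = TC (VComp CAT (HComp CAT (Id2 CAT (N1 n (Trg J g))) (PC (NS n) (g, f)))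
          (VComp CAT (HComp CAT (N2 n g) (Id2 CAT (P1 (NS n) f))) (HComp CAT (Id2 CAT (P1 (NT n) g)) (N2 n f)))) x"
    and id: "\<And>a x. a \<in> Obj J \<Longrightarrow> x \<in> Ob (P0 (NS n) a) \<Longrightarrow>
      TC (VComp CAT (N2 n (Id1 J a)) (HComp CAT (PI (NT n) a) (Id2 CAT (N1 n a)))) x
      = TC (HComp CAT (Id2 CAT (N1 n a)) (PI (NS n) a)) x"
  shows "pseudonat J CAT n"
proof -
  interpret J: two_category J by (rule J)
  interpret C: two_category "CAT :: ('x, 'y) CAT" by (rule two_category_CAT)
  interpret JC: two_categories J "CAT :: ('x, 'y) CAT" ..
  note [simp] = JC.psf_rules [OF S] JC.psf_rules [OF T]
  have [simp]: "N1 n a \<in> Cell1 CAT" "Src CAT (N1 n a) = P0 (NS n) a" "Trg CAT (N1 n a) = P0 (NT n) a"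
    if "a \<in> Obj J" for a
    using that n1 by (simp_all add: CAT_simps)
  have FT: "FT (P1 (NT n) f) = P0 (NT n) (Trg J f)" "FS (N1 n (Src J f)) = P0 (NS n) (Src J f)" if "f \<in> Cell1 J" for f
    using that n1(2) pseudofunctor.p1_trg [OF T that] by (simp_all add: CAT_simps)
  have [simp]: "N2 n f \<in> Cell2 CAT" "Dom2 CAT (N2 n f) = Comp1 CAT (P1 (NT n) f) (N1 n (Src J f))"
    "Cod2 CAT (N2 n f) = Comp1 CAT (N1 n (Trg J f)) (P1 (NS n) f)" "iso2 CAT (N2 n f)" if "f \<in> Cell1 J" for f
    using that n2 by (simp_all add: CAT_simps iso2_CAT_iff FT)
  show ?thesis
  proof (rule pseudonat.intro, goal_cases)
    case (11 \<alpha>)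
    then show ?case by (intro CAT_eqI nat) simp_all
  next
    case (12 g f)
    then show ?case by (intro CAT_eqI comp) simp_all
  next
    case (13 a)
    then show ?case by (intro CAT_eqI id) simp_all
  qed (use assms in simp_all)
qed

lemma modification_CATI:
  fixes m :: "('o, 'f, 'c, ('x, 'y) cat, ('x, 'y) ftr, ('x, 'y) ntr) mdf"
  assumes J: "two_category J"
    and S: "pseudonat J CAT (MS m)" and T: "pseudonat J CAT (MT m)"
    and par: "NS (MT m) = NS (MS m)" "NT (MT m) = NT (MS m)"
    and ext: "MC m \<in> extensional (Obj J)"
    and mc: "\<And>a. a \<in> Obj J \<Longrightarrow> is_nat (MC m a)" "\<And>a. a \<in> Obj J \<Longrightarrow> TS (MC m a) = N1 (MS m) a"
      "\<And>a. a \<in> Obj J \<Longrightarrow> TT (MC m a) = N1 (MT m) a"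
    and nat: "\<And>f x. f \<in> Cell1 J \<Longrightarrow> x \<in> Ob (P0 (NS (MS m)) (Src J f)) \<Longrightarrow>
      TC (VComp CAT (N2 (MT m) f) (HComp CAT (Id2 CAT (P1 (NT (MS m)) f)) (MC m (Src J f)))) x
        = TC (VComp CAT (HComp CAT (MC m (Trg J f)) (Id2 CAT (P1 (NS (MS m)) f))) (N2 (MS m) f)) x"
  shows "modification J CAT m"
proof -
  interpret J: two_category J by (rule J)
  interpret C: two_category "CAT :: ('x, 'y) CAT" by (rule two_category_CAT)
  interpret JC: two_categories J "CAT :: ('x, 'y) CAT" ..
  note [simp] = JC.psn_rules [OF S] JC.psn_rules [OF T] JC.psf_rules [OF JC.psn_rules(1) [OF S]] JC.psf_rules [OF JC.psn_rules(2) [OF S]] par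
  have [simp]: "MC m a \<in> Cell2 CAT" "Dom2 CAT (MC m a) = N1 (MS m) a" "Cod2 CAT (MC m a) = N1 (MT m) a"
    if "a \<in> Obj J" for a
    using that mc by (simp_all add: CAT_simps)
  show ?thesis
  proof (rule modification.intro, goal_cases)
    case (9 f)
    then show ?case by (intro CAT_eqI nat) simp_all
  qed (use assms in simp_all)
qed

text \<open>This object of the pseudoend of \<open>L(A-, A-)\<close> plays the part of the identity in the Yoneda lemma:
  postcomposing it with \<open>\<sigma> : A \<Rightarrow> B\<close> gives the object of the pseudoend of \<open>L(A-, B-)\<close> that corresponds to \<open>\<sigma>\<close>.\<close>

definition hom_action_ftr where
  "hom_action_ftr K L A a b = het_ftr Inl Inl Inr Inr (homcat K a b) (homcat L (P0 A a) (P0 A b)) (P1 A) (P2 A)"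

definition hom_action_cell where
  "hom_action_cell K L A f g u = VComp L (PC A (Comp1 K g u, f)) (HComp L (PC A (g, u)) (Id2 L (P1 A f)))"

definition hom_action_ntr where
  "hom_action_ntr K L A f g =
    \<lparr>TS = ftr_comp (ftr_map Inr Inr (hom_ftr L (P1 A f) (P1 A g))) (hom_action_ftr K L A (Trg K f) (Src K g)),
     TT = ftr_comp (hom_action_ftr K L A (Src K f) (Trg K g)) (ftr_map Inl Inl (hom_ftr K f g)),
     TC = (\<lambda>x\<in>Inl ` Ob (homcat K (Trg K f) (Src K g)). Inr (hom_action_cell K L A f g (projl x)))\<rparr>"

definition hom_action :: "('o, 'f, 'c) two_cat \<Rightarrow> ('p, 'g, 'd) two_cat \<Rightarrow> ('o, 'f, 'c, 'p, 'g, 'd) psf \<Rightarrow>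
    ('o, 'f, 'c, 'g, 'd) pe_psn" where
  "hom_action K L A = \<lparr>NS = hom_PE K, NT = target_psf K L A A,
     N1 = (\<lambda>(a, b)\<in>Obj (opprod K). hom_action_ftr K L A a b),
     N2 = (\<lambda>(f, g)\<in>Cell1 (opprod K). hom_action_ntr K L A f g)\<rparr>"

lemma hom_action_simps [simp]:
  "NS (hom_action K L A) = hom_PE K" "NT (hom_action K L A) = target_psf K L A A"
  "N1 (hom_action K L A) = (\<lambda>(a, b)\<in>Obj (opprod K). hom_action_ftr K L A a b)"
  "N2 (hom_action K L A) = (\<lambda>(f, g)\<in>Cell1 (opprod K). hom_action_ntr K L A f g)"
  by (simp_all add: hom_action_def)

context two_categories
begin

lemma hom_action_cell_simps:
  assumes "pseudofunctor K L A" "f \<in> Cell1 K" "g \<in> Cell1 K" "u \<in> Cell1 K" "Src K u = Trg K f" "Trg K u = Src K g"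
  shows "hom_action_cell K L A f g u \<in> Cell2 L" "iso2 L (hom_action_cell K L A f g u)"
    "Dom2 L (hom_action_cell K L A f g u) = P1 A g \<odot> P1 A u \<odot> P1 A f"
    "Cod2 L (hom_action_cell K L A f g u) = P1 A (Comp1 K g (Comp1 K u f))"
  using assms by (simp_all add: hom_action_cell_def psf_rules)

lemma hom_action_natural:
  assumes A: "pseudofunctor K L A" and c: "\<phi> \<in> Cell2 K" "\<psi> \<in> Cell2 K" "\<mu> \<in> Cell2 K"
    "Src K (Dom2 K \<mu>) = Trg K (Dom2 K \<phi>)" "Trg K (Dom2 K \<mu>) = Src K (Dom2 K \<psi>)"
  shows "hom_action_cell K L A (Cod2 K \<phi>) (Cod2 K \<psi>) (Cod2 K \<mu>) \<cdot> P2 A \<psi> \<star> P2 A \<mu> \<star> P2 A \<phi>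
    = P2 A (HComp K \<psi> (HComp K \<mu> \<phi>)) \<cdot> hom_action_cell K L A (Dom2 K \<phi>) (Dom2 K \<psi>) (Dom2 K \<mu>)"
proof -
  note [simp] = psf_rules [OF A]
  let ?f = "Dom2 K \<phi>" and ?f' = "Cod2 K \<phi>" and ?g = "Dom2 K \<psi>" and ?g' = "Cod2 K \<psi>" and ?u = "Dom2 K \<mu>" and ?u' = "Cod2 K \<mu>"
  have "PC A (?g', ?u') \<star> \<iota> (P1 A ?f') \<cdot> (P2 A \<psi> \<star> P2 A \<mu>) \<star> P2 A \<phi>
    = (PC A (?g', ?u') \<cdot> P2 A \<psi> \<star> P2 A \<mu>) \<star> P2 A \<phi>"
    using c by (simp add: L.hcomp_vcomp del: L.hcomp_assoc)
  also have "\<dots> = (P2 A (HComp K \<psi> \<mu>) \<cdot> PC A (?g, ?u)) \<star> (P2 A \<phi> \<cdot> \<iota> (P1 A ?f))"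
    using c by (simp add: pseudofunctor.pc_nat [OF A])
  also have "\<dots> = P2 A (HComp K \<psi> \<mu>) \<star> P2 A \<phi> \<cdot> PC A (?g, ?u) \<star> \<iota> (P1 A ?f)"
    using c by (simp add: L.interchange del: L.cell2_simps(9,10))
  finally have 1: "PC A (?g', ?u') \<star> \<iota> (P1 A ?f') \<cdot> P2 A \<psi> \<star> P2 A \<mu> \<star> P2 A \<phi>
    = P2 A (HComp K \<psi> \<mu>) \<star> P2 A \<phi> \<cdot> PC A (?g, ?u) \<star> \<iota> (P1 A ?f)" using c by simp
  have 2: "PC A (Comp1 K ?g' ?u', ?f') \<cdot> P2 A (HComp K \<psi> \<mu>) \<star> P2 A \<phi>
    = P2 A (HComp K \<psi> (HComp K \<mu> \<phi>)) \<cdot> PC A (Comp1 K ?g ?u, ?f)"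
    using pseudofunctor.pc_nat [OF A, of "HComp K \<psi> \<mu>" \<phi>] c by simp
  show ?thesis
    using c by (simp add: hom_action_cell_def 1 L.vcomp_reassoc [OF 2])
qed

text \<open>Both sides compare the five-fold composite of images under A with the image of the
  composite of \<open>g'\<close>, \<open>g\<close>, \<open>u\<close>, \<open>f\<close>,
  \<open>f'\<close>. Three instances of \<open>pc_assoc\<close> connect them: at
  \<open>(g', g, u)\<close>, at \<open>(g' g u, f, f')\<close> and at
  \<open>(g', g u, f)\<close>.\<close>

lemma hom_action_comp:
  assumes A: "pseudofunctor K L A" and c: "f \<in> Cell1 K" "f' \<in> Cell1 K" "g \<in> Cell1 K" "g' \<in> Cell1 K" "u \<in> Cell1 K"
    "Src K f = Trg K f'" "Src K g' = Trg K g" "Src K u = Trg K f" "Trg K u = Src K g"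
  shows "hom_action_cell K L A (Comp1 K f f') (Comp1 K g' g) u \<cdot> PC A (g', g) \<star> \<iota> (P1 A u) \<star> PC A (f, f')
    = hom_action_cell K L A f' g' (Comp1 K g (Comp1 K u f)) \<cdot> \<iota> (P1 A g') \<star> hom_action_cell K L A f g u \<star> \<iota> (P1 A f')"
proof -
  note [simp] = psf_rules [OF A]
  note assoc = pseudofunctor.pc_assoc [OF A]
  let ?gu = "Comp1 K g u" let ?ggu = "Comp1 K g' ?gu" let ?ff = "Comp1 K f f'" let ?gg = "Comp1 K g' g"
  have 1: "PC A (?gg, u) \<star> \<iota> (P1 A ?ff) \<cdot> PC A (g', g) \<star> \<iota> (P1 A u) \<star> PC A (f, f')
    = \<iota> (P1 A ?ggu) \<star> PC A (f, f') \<cdot> PC A (g', ?gu) \<star> \<iota> (P1 A f \<odot> P1 A f') \<cdot> \<iota> (P1 A g') \<star> PC A (g, u) \<star> \<iota> (P1 A f \<odot> P1 A f')"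
  proof -
    have "PC A (?gg, u) \<star> \<iota> (P1 A ?ff) \<cdot> (PC A (g', g) \<star> \<iota> (P1 A u)) \<star> PC A (f, f')
      = (PC A (?gg, u) \<cdot> PC A (g', g) \<star> \<iota> (P1 A u)) \<star> PC A (f, f')"
      using c by (simp add: L.hcomp_vcomp del: L.hcomp_assoc)
    also have "\<dots> = (PC A (g', ?gu) \<cdot> \<iota> (P1 A g') \<star> PC A (g, u)) \<star> PC A (f, f')"
      using c assoc [of g' g u] by simp
    also have "\<dots> = \<iota> (P1 A ?ggu) \<star> PC A (f, f') \<cdot> (PC A (g', ?gu) \<cdot> \<iota> (P1 A g') \<star> PC A (g, u)) \<star> \<iota> (P1 A f \<odot> P1 A f')"
      using c by (subst L.hcomp_whisker(1)) simp_all
    finally show ?thesis using c by (simp add: L.whisker_right)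
  qed
  have 2: "PC A (?ggu, ?ff) \<cdot> \<iota> (P1 A ?ggu) \<star> PC A (f, f') = PC A (Comp1 K ?ggu f, f') \<cdot> PC A (?ggu, f) \<star> \<iota> (P1 A f')"
    using c assoc [of ?ggu f f'] by simp
  have "PC A (?ggu, f) \<star> \<iota> (P1 A f') \<cdot> PC A (g', ?gu) \<star> \<iota> (P1 A f \<odot> P1 A f')
    = (PC A (?ggu, f) \<cdot> PC A (g', ?gu) \<star> \<iota> (P1 A f)) \<star> \<iota> (P1 A f')"
    using c by (simp add: L.whisker_right)
  also have "\<dots> = (PC A (g', Comp1 K ?gu f) \<cdot> \<iota> (P1 A g') \<star> PC A (?gu, f)) \<star> \<iota> (P1 A f')"
    using c assoc [of g' ?gu f] by simp
  also have "\<dots> = PC A (g', Comp1 K ?gu f) \<star> \<iota> (P1 A f') \<cdot> \<iota> (P1 A g') \<star> PC A (?gu, f) \<star> \<iota> (P1 A f')"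
    using c by (simp add: L.whisker_right)
  finally have 3: "PC A (?ggu, f) \<star> \<iota> (P1 A f') \<cdot> PC A (g', ?gu) \<star> \<iota> (P1 A f \<odot> P1 A f')
    = PC A (g', Comp1 K ?gu f) \<star> \<iota> (P1 A f') \<cdot> \<iota> (P1 A g') \<star> PC A (?gu, f) \<star> \<iota> (P1 A f')" .
  have "PC A (?ggu, ?ff) \<cdot> PC A (?gg, u) \<star> \<iota> (P1 A ?ff) \<cdot> PC A (g', g) \<star> \<iota> (P1 A u) \<star> PC A (f, f')
    = PC A (Comp1 K ?ggu f, f') \<cdot> PC A (g', Comp1 K ?gu f) \<star> \<iota> (P1 A f') \<cdot> \<iota> (P1 A g') \<star> PC A (?gu, f) \<star> \<iota> (P1 A f') \<cdot>
      \<iota> (P1 A g') \<star> PC A (g, u) \<star> \<iota> (P1 A f \<odot> P1 A f')"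
    using c 3 [simplified] by (simp add: 1 L.vcomp_reassoc [OF 2, simplified] L.vcomp_reassoc [OF 3, simplified])
  then show ?thesis
    using c by (simp add: hom_action_cell_def L.whisker_left L.whisker_right)
qed

lemma hom_action_id:
  assumes A: "pseudofunctor K L A" and u: "u \<in> Cell1 K"
  shows "hom_action_cell K L A (Id1 K (Src K u)) (Id1 K (Trg K u)) u \<cdot> PI A (Trg K u) \<star> \<iota> (P1 A u) \<star> PI A (Src K u) = \<iota> (P1 A u)"
proof -
  note [simp] = psf_rules [OF A]
  let ?i = "Id1 K (Src K u)" and ?j = "Id1 K (Trg K u)"
  have "PC A (?j, u) \<star> \<iota> (P1 A ?i) \<cdot> (PI A (Trg K u) \<star> \<iota> (P1 A u)) \<star> PI A (Src K u) = \<iota> (P1 A u) \<star> PI A (Src K u)"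
    using u by (simp add: L.hcomp_vcomp pseudofunctor.pi_left [OF A] del: L.hcomp_assoc)
  then show ?thesis
    using u by (simp add: hom_action_cell_def pseudofunctor.pi_right [OF A])
qed

lemma functor_hom_action:
  assumes A: "pseudofunctor K L A" and ab: "a \<in> Obj K" "b \<in> Obj K"
  shows "is_functor (hom_action_ftr K L A a b)"
  unfolding hom_action_ftr_def using assms
  by (intro functor_het) (auto simp: functorial_def K.category_homcat L.category_homcat psf_rules)

lemma hom_action_ftr_simps [simp]:
  "FS (hom_action_ftr K L A a b) = cat_map Inl Inl (homcat K a b)"
  "FT (hom_action_ftr K L A a b) = cat_map Inr Inr (homcat L (P0 A a) (P0 A b))"
  "u \<in> Cell1 K \<Longrightarrow> Src K u = a \<Longrightarrow> Trg K u = b \<Longrightarrow> FO (hom_action_ftr K L A a b) (Inl u) = Inr (P1 A u)"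
  "\<mu> \<in> Cell2 K \<Longrightarrow> Src K (Dom2 K \<mu>) = a \<Longrightarrow> Trg K (Dom2 K \<mu>) = b \<Longrightarrow> FA (hom_action_ftr K L A a b) (Inl \<mu>) = Inr (P2 A \<mu>)"
  by (auto simp: hom_action_ftr_def)

lemma nat_hom_action:
  assumes A: "pseudofunctor K L A" and c: "f \<in> Cell1 K" "g \<in> Cell1 K"
  shows "is_nat (hom_action_ntr K L A f g)"
proof (rule is_nat.intro, goal_cases)
  note [simp] = psf_rules [OF A] hom_action_cell_simps [OF A]
  case 1
  show ?case using c
    by (auto simp: hom_action_ntr_def functor_hom_action [OF A] L.functor_hom_ftr intro!: functor_comp functor_map)
  case 2
  show ?case using c
    by (auto simp: hom_action_ntr_def functor_hom_action [OF A] K.functor_hom_ftr intro!: functor_comp functor_map)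
next
  note [simp] = psf_rules [OF A] hom_action_cell_simps [OF A]
  case (9 m)
  then obtain \<mu> where m: "m = Inl \<mu>" "\<mu> \<in> Cell2 K" "Src K (Dom2 K \<mu>) = Trg K f" "Trg K (Dom2 K \<mu>) = Src K g"
    by (auto simp: hom_action_ntr_def)
  show ?case
    using m c hom_action_natural [OF A, of "Id2 K f" "Id2 K g" \<mu>] by (simp add: hom_action_ntr_def)
qed (use c A in \<open>auto simp: hom_action_ntr_def psf_rules hom_action_cell_simps\<close>)

lemma hom_action_ntr_simps [simp]:
  "TS (hom_action_ntr K L A f g) = ftr_comp (ftr_map Inr Inr (hom_ftr L (P1 A f) (P1 A g))) (hom_action_ftr K L A (Trg K f) (Src K g))"
  "TT (hom_action_ntr K L A f g) = ftr_comp (hom_action_ftr K L A (Src K f) (Trg K g)) (ftr_map Inl Inl (hom_ftr K f g))"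
  "u \<in> Cell1 K \<Longrightarrow> Src K u = Trg K f \<Longrightarrow> Trg K u = Src K g \<Longrightarrow>
    TC (hom_action_ntr K L A f g) (Inl u) = Inr (hom_action_cell K L A f g u)"
  by (auto simp: hom_action_ntr_def)

lemma pseudonat_hom_action:
  assumes A: "pseudofunctor K L A"
  shows "pseudonat (opprod K) CAT (hom_action K L A)"
proof (rule pseudonat_CATI, goal_cases)
  case 1
  show ?case by (intro two_category_opprod K.two_category_axioms)
next
  case 2
  show ?case using hom_PE_obj by (simp add: PS_simps)
next
  case 3
  show ?case by (simp add: target_simps A)
next
  case (12 p x)
  then obtain f g u where c: "p = (f, g)" "x = Inl u" "f \<in> Cell1 K" "g \<in> Cell1 K" "u \<in> Cell1 K" "Src K u = Trg K f" "Trg K u = Src K g"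
    by (cases p) (auto simp: hom_psf_def)
  then show ?case
    by (simp add: iso_arr_cat_map L.category_homcat iso_arr_homcat [OF L.two_category_axioms]
       psf_rules [OF A] hom_action_cell_simps [OF A])
next
  case (13 p x)
  then obtain \<phi> \<psi> u where c: "p = (\<phi>, \<psi>)" "x = Inl u" "\<phi> \<in> Cell2 K" "\<psi> \<in> Cell2 K" "u \<in> Cell1 K"
    "Src K u = Trg K (Dom2 K \<phi>)" "Trg K u = Src K (Dom2 K \<psi>)"
    by (cases p) (auto simp: hom_psf_def)
  then show ?case
    using hom_action_natural [OF A, of \<phi> \<psi> "Id2 K u"]
    by (simp add: CAT_simps hom_psf_def psf_rules [OF A] hom_action_cell_simps [OF A])
next
  case (14 q p x)
  then obtain f g f' g' u where c: "q = (f', g')" "p = (f, g)" "x = Inl u"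
    "f \<in> Cell1 K" "f' \<in> Cell1 K" "g \<in> Cell1 K" "g' \<in> Cell1 K" "u \<in> Cell1 K"
    "Src K f = Trg K f'" "Src K g' = Trg K g" "Src K u = Trg K f" "Trg K u = Src K g"
    by (cases p, cases q) (auto simp: hom_psf_def)
  then show ?case
    using hom_action_comp [OF A, of f f' g g' u]
    by (simp add: CAT_simps hom_psf_def psf_rules [OF A] hom_action_cell_simps [OF A])
next
  case (15 p x)
  then obtain a b u where c: "p = (a, b)" "x = Inl u" "u \<in> Cell1 K" "a = Src K u" "b = Trg K u"
    by (cases p) (auto simp: hom_psf_def)
  then show ?case
    using hom_action_id [OF A, of u]
    by (simp add: CAT_simps hom_psf_def psf_rules [OF A] hom_action_cell_simps [OF A])
qed (auto simp: hom_psf_def functor_hom_action [OF A] nat_hom_action [OF A])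

lemma hom_action_ob: "pseudofunctor K L A \<Longrightarrow> hom_action K L A \<in> Ob (pseudoend K (hom_comp_psf K L A A))"
  by (simp add: pseudoend_def PS_simps pseudonat_hom_action)

end

context two_categories
begin

text \<open>Every object of the hom category from a to b is some \<open>u\<close>, so the cells
  indexed by all \<open>u\<close> determine the arrow. Equations in the pseudoend thereby become
  equations of 2-cells in \<open>L\<close>.\<close>

lemma pseudoend_arrow_eqI:
  assumes "pseudoend_arrow K L A B \<zeta>" "pseudoend_arrow K L A B \<xi>" "MS \<zeta> = MS \<xi>" "MT \<zeta> = MT \<xi>"
    and "\<And>u. u \<in> Cell1 K \<Longrightarrow> wedge_mdf K \<zeta> u = wedge_mdf K \<xi> u"
  shows "\<zeta> = \<xi>"
proof -
  interpret x: pseudoend_arrow K L A B \<xi> by fact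
  interpret z: pseudoend_arrow K L A B \<zeta> by fact
  show ?thesis
  proof (rule mdf_eqI [OF z.mdf_\<xi> x.mdf_\<xi> assms(3,4)])
    fix p assume "p \<in> Obj (opprod K)"
    then obtain a b where p: "p = (a, b)" "a \<in> Obj K" "b \<in> Obj K" by auto
    show "MC \<zeta> p = MC \<xi> p"
    proof (rule ntr_eqI)
      fix w assume "w \<in> Ob (FS (TS (MC \<zeta> p)))"
      then obtain u where "w = Inl u" "u \<in> Cell1 K" "a = Src K u" "b = Trg K u"
        using p by (auto simp: z.MC_\<xi> z.x.N1_x)
      then show "TC (MC \<zeta> p) w = TC (MC \<xi> p) w"
        using p assms(5) by (simp add: x.TC_\<xi> z.TC_\<xi>)
    qed (use p assms(3,4) in \<open>simp_all add: x.MC_\<xi> z.MC_\<xi>\<close>)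
  qed
qed

end

definition act_psn where
  "act_psn K L A \<sigma> = Comp1 (PE K) (target_psn K L (psn_id K L A) \<sigma>) (hom_action K L A)"

definition act_mdf where
  "act_mdf K L A m = HComp (PE K) (target_mdf K L (Id2 (PS K L) (psn_id K L A)) m) (Id2 (PE K) (hom_action K L A))"

text \<open>Evaluating \<open>hom_action\<close> gives a transformation with components A(id) rather
  than identities; the cells \<open>PI A\<close> measure exactly this discrepancy.\<close>

definition unit_mdf where
  "unit_mdf K L A = \<lparr>MS = psn_id K L A, MT = eval_psn K L A A (hom_action K L A), MC = (\<lambda>a\<in>Obj K. PI A a)\<rparr>"

definition counit_mdf where
  "counit_mdf K L A B x = \<lparr>MS = act_psn K L A (eval_psn K L A B x), MT = x,
     MC = (\<lambda>(a, b)\<in>Obj (opprod K). \<lparr>TS = N1 (act_psn K L A (eval_psn K L A B x)) (a, b), TT = N1 x (a, b),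
       TC = (\<lambda>w\<in>Inl ` Ob (homcat K a b). Inr (right_act K L A B x (Id1 K b) (projl w)))\<rparr>)\<rparr>"

context two_categories
begin

context
  fixes A :: "('o, 'f, 'c, 'p, 'g, 'd) psf"
  assumes A: "pseudofunctor K L A"
begin

interpretation h: pseudoend_object K L A A "hom_action K L A"
  by (intro pseudoend_objectI A hom_action_ob)

lemma pseudoend_object_hom_action: "pseudoend_object K L A A (hom_action K L A)" ..

lemma wedge_hom_action [simp]:
  "u \<in> Cell1 K \<Longrightarrow> h.X u = P1 A u" "\<mu> \<in> Cell2 K \<Longrightarrow> h.X2 \<mu> = P2 A \<mu>"
  "\<lbrakk>f \<in> Cell1 K; g \<in> Cell1 K; u \<in> Cell1 K; Src K u = Trg K f; Trg K u = Src K g\<rbrakk>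
    \<Longrightarrow> h.\<theta> f g u = hom_action_cell K L A f g u"
  by (simp_all add: wedge_ob_def wedge_ar_def wedge_cell_def)

text \<open>The unit contained in \<open>left_act\<close> cancels against the outer comparison cell
  of \<open>hom_action_cell\<close> by the right unit law. Together with
  \<open>rho_hom_action\<close> this identifies both actions on \<open>hom_action\<close> with the
  composition cells of A.\<close>

lemma lam_hom_action:
  assumes c: "g \<in> Cell1 K" "u \<in> Cell1 K" "Src K g = Trg K u"
  shows "h.lam g u = PC A (g, u)"
proof -
  let ?a = "Src K u" let ?i = "Id1 K ?a" and ?gu = "Comp1 K g u"
  have "PC A (g, u) \<star> \<iota> (P1 A ?i) \<cdot> \<iota> (P1 A g \<odot> P1 A u) \<star> PI A ?a = PC A (g, u) \<star> PI A ?a"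
    using c L.hcomp_whisker(2) [of "PC A (g, u)" "PI A ?a"] by simp
  also have "\<dots> = \<iota> (P1 A ?gu) \<star> PI A ?a \<cdot> PC A (g, u)"
    using c by (simp add: L.unit_right)
  finally have "h.lam g u = (PC A (?gu, ?i) \<cdot> \<iota> (P1 A ?gu) \<star> PI A ?a) \<cdot> PC A (g, u)"
    using c by (simp add: left_act_def hom_action_cell_def)
  then show ?thesis
    using c pseudofunctor.pi_right [OF A, of ?gu] by (simp del: L.vcomp_assoc)
qed

lemma rho_hom_action:
  assumes c: "u \<in> Cell1 K" "f \<in> Cell1 K" "Src K u = Trg K f"
  shows "h.rho u f = PC A (u, f)"
proof -
  let ?b = "Trg K u" let ?i = "Id1 K ?b"
  have "PC A (?i, u) \<star> \<iota> (P1 A f) \<cdot> PI A ?b \<star> \<iota> (P1 A u \<odot> P1 A f)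
    = (PC A (?i, u) \<cdot> PI A ?b \<star> \<iota> (P1 A u)) \<star> \<iota> (P1 A f)"
    using c by (simp add: L.whisker_right)
  then show ?thesis
    using c by (simp add: right_act_def hom_action_cell_def pseudofunctor.pi_left [OF A])
qed

text \<open>Composing with the invertible cell \<open>PC A (?j, u)\<close> turns both sides into an
  identity, one by the right and the other by the left unit law of A.\<close>

lemma modification_unit: "modification K L (unit_mdf K L A)"
proof (rule modification.intro, goal_cases)
  case u: (9 u)
  let ?a = "Src K u" and ?b = "Trg K u" let ?i = "Id1 K ?a" and ?j = "Id1 K ?b"
  have "N2 h.E u \<cdot> \<iota> (P1 A u) \<star> PI A ?a = PI A ?b \<star> \<iota> (P1 A u)"
  proof (rule L.iso2_cancel_left [of "PC A (?j, u)"])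
    have "PC A (?j, u) \<cdot> N2 h.E u \<cdot> \<iota> (P1 A u) \<star> PI A ?a = PC A (u, ?i) \<cdot> \<iota> (P1 A u) \<star> PI A ?a"
      using u h.rho_N2 [of u] by (simp add: rho_hom_action lam_hom_action flip: L.vcomp_assoc)
    then show "PC A (?j, u) \<cdot> N2 h.E u \<cdot> \<iota> (P1 A u) \<star> PI A ?a = PC A (?j, u) \<cdot> PI A ?b \<star> \<iota> (P1 A u)"
      using u by (simp add: pseudofunctor.pi_left [OF A] pseudofunctor.pi_right [OF A])
  qed (use u in simp_all)
  then show ?case
    using u by (simp add: unit_mdf_def)
qed (simp_all add: unit_mdf_def pseudonat_id A h.pseudonat_eval)

lemma iso2_unit: "iso2 (PS K L) (unit_mdf K L A)"
  unfolding iso2_PS_iff [OF modification_unit] by (simp add: unit_mdf_def)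

text \<open>With an identity in the contravariant variable, \<open>eval_post\<close> computes the
  evaluation of the quasi-inverse with no further coherence argument: what separates it from
  \<open>\<sigma>\<close> is only the evaluation of \<open>hom_action\<close>.\<close>

lemma act_post:
  assumes "pseudonat K L \<sigma>" "NS \<sigma> = A"
  shows "pseudoend_post K L (psn_id K L A) \<sigma> (hom_action K L A)"
    and "act_psn K L A \<sigma> = psn_comp (opprod K) CAT (target_psn K L (psn_id K L A) \<sigma>) (hom_action K L A)"
    and "act_psn K L A \<sigma> \<in> Ob (pseudoend K (hom_comp_psf K L A (NT \<sigma>)))"
    and "eval_psn K L A (NT \<sigma>) (act_psn K L A \<sigma>) = psn_comp K L \<sigma> h.E"
proof -
  show 1: "pseudoend_post K L (psn_id K L A) \<sigma> (hom_action K L A)"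
    using assms A by (intro pseudoend_postI)
      (simp_all add: pseudonat_id hom_action_ob)
  show 2: "act_psn K L A \<sigma> = psn_comp (opprod K) CAT (target_psn K L (psn_id K L A) \<sigma>) (hom_action K L A)"
    by (simp add: act_psn_def PS_simps(9))
  interpret p: pseudoend_post K L "psn_id K L A" \<sigma> "hom_action K L A" by (rule 1)
  show "act_psn K L A \<sigma> \<in> Ob (pseudoend K (hom_comp_psf K L A (NT \<sigma>)))"
    using p.psn_y by (simp add: 2)
  show "eval_psn K L A (NT \<sigma>) (act_psn K L A \<sigma>) = psn_comp K L \<sigma> h.E"
    using p.eval_post h.pseudonat_eval assms(2) by (simp add: 2 psn_comp_id)
qed

lemma act_mdf:
  assumes m: "modification K L m" "NS (MS m) = A"
  shows "act_mdf K L A m \<in> Ar (pseudoend K (hom_comp_psf K L A (NT (MS m))))"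
    and "u \<in> Cell1 K \<Longrightarrow> wedge_mdf K (act_mdf K L A m) u = MC m (Trg K u) \<star> \<iota> (P1 A u)"
    and "eval_mdf K L A (NT (MS m)) (act_mdf K L A m) = HComp (PS K L) m (Id2 (PS K L) h.E)"
    and "MS (act_mdf K L A m) = act_psn K L A (MS m)" "MT (act_mdf K L A m) = act_psn K L A (MT m)"
proof -
  interpret PS: two_category "PS K L" by (rule two_category_PS)
  let ?i = "Id2 (PS K L) (psn_id K L A)" and ?h = "Id2 (PE K) (hom_action K L A)"
  have i: "modification K L ?i" by (simp add: modification_id pseudonat_id A)
  have h: "?h \<in> Ar (pseudoend K (hom_comp_psf K L A A))"
    using category.idn_in [OF category_pseudoend hom_action_ob [OF A]] by simp
  have h': "?h \<in> Ar (pseudoend K (hom_comp_psf K L (NT (MS ?i)) (NS (MS m))))"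
    using h m by simp
  note p = eval_mdf_post [OF i m(1) h', folded act_mdf_def, simplified]
  note F = functorial_eval [OF A A, unfolded functorial_def]
  have e: "eval_mdf K L A A ?h = Id2 (PS K L) h.E"
    using F hom_action_ob [OF A] by (simp add: homcat_simps(5))
  show "act_mdf K L A m \<in> Ar (pseudoend K (hom_comp_psf K L A (NT (MS m))))"
    using p(1) by simp
  show "wedge_mdf K (act_mdf K L A m) u = MC m (Trg K u) \<star> \<iota> (P1 A u)" if "u \<in> Cell1 K"
    using p(2) [OF that] that A by (simp add: wedge_mdf_id [OF pseudoend_object_hom_action] psf_rules)
  have "HComp (PS K L) (Id2 (PS K L) h.E) ?i = Id2 (PS K L) h.E"
    using PS.hcomp_simps(2) [of "Id2 (PS K L) h.E" A] h.pseudonat_eval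
    by (simp add: PS_simps(1-9) modification_id)
  then show "eval_mdf K L A (NT (MS m)) (act_mdf K L A m) = HComp (PS K L) m (Id2 (PS K L) h.E)"
    using p(3) m(2) by (simp add: e)
  show "MS (act_mdf K L A m) = act_psn K L A (MS m)" "MT (act_mdf K L A m) = act_psn K L A (MT m)"
    by (simp_all add: act_mdf_def act_psn_def PS_simps(9))
qed

text \<open>\<open>act_mdf\<close> is the horizontal composite of an expression 2-functorial in
  \<open>m\<close> with a fixed identity cell, so functoriality comes from the 2-functor
  \<open>T\<close> and interchange.\<close>

lemma functorial_act:
  assumes B: "pseudofunctor K L B"
  shows "functorial (homcat (PS K L) A B) (pseudoend K (hom_comp_psf K L A B)) (act_psn K L A) (act_mdf K L A)"
proof -
  interpret PS: two_category "PS K L" by (rule two_category_PS)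
  interpret PE: two_category "PE K" by (rule two_category_PE)
  interpret T: strict_two_functor "opprod (PS K L)" "PE K" "\<lambda>(A, B). target_psf K L A B"
    "\<lambda>(\<gamma>, \<delta>). target_psn K L \<gamma> \<delta>" "\<lambda>(m, m'). target_mdf K L m m'"
    by (rule strict_two_functor_hom_comp)
  let ?i = "psn_id K L A" and ?h = "hom_action K L A"
  have i: "?i \<in> Cell1 (PS K L)" "Src (PS K L) ?i = A" "Trg (PS K L) ?i = A"
    by (simp_all add: PS_simps pseudonat_id A)
  have h: "?h \<in> Cell1 (PE K)" "Trg (PE K) ?h = target_psf K L A A"
    by (simp_all add: PS_simps(1-9) pseudonat_hom_action A)
  have t: "target_psn K L ?i \<sigma> \<in> Cell1 (PE K)" "Src (PE K) (target_psn K L ?i \<sigma>) = target_psf K L A A"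
    if "\<sigma> \<in> Cell1 (PS K L)" "Src (PS K L) \<sigma> = A" for \<sigma>
    using T.q1_in [of "(?i, \<sigma>)"] T.q1_src [of "(?i, \<sigma>)"] i that by simp_all
  have t2: "target_mdf K L (Id2 (PS K L) ?i) m \<in> Cell2 (PE K)"
     "Dom2 (PE K) (target_mdf K L (Id2 (PS K L) ?i) m) = target_psn K L ?i (Dom2 (PS K L) m)"
     "Cod2 (PE K) (target_mdf K L (Id2 (PS K L) ?i) m) = target_psn K L ?i (Cod2 (PS K L) m)"
    if "m \<in> Cell2 (PS K L)" for m
    using T.q2_in [of "(Id2 (PS K L) ?i, m)"] T.q2_dom [of "(Id2 (PS K L) ?i, m)"] T.q2_cod [of "(Id2 (PS K L) ?i, m)"] i that
    by simp_all
  have id: "act_mdf K L A (Id2 (PS K L) \<sigma>) = Id2 (PE K) (act_psn K L A \<sigma>)"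
    if "\<sigma> \<in> Cell1 (PS K L)" "Src (PS K L) \<sigma> = A" for \<sigma>
    using T.q2_id [of "(?i, \<sigma>)"] i h t [OF that] that by (simp add: act_mdf_def act_psn_def)
  have vcomp: "act_mdf K L A (VComp (PS K L) m' m) = VComp (PE K) (act_mdf K L A m') (act_mdf K L A m)"
    if m: "m \<in> Cell2 (PS K L)" "m' \<in> Cell2 (PS K L)" "Dom2 (PS K L) m' = Cod2 (PS K L) m" "Src (PS K L) (Dom2 (PS K L) m) = A" for m m'
  proof -
    have "target_mdf K L (Id2 (PS K L) ?i) (VComp (PS K L) m' m)
      = VComp (PE K) (target_mdf K L (Id2 (PS K L) ?i) m') (target_mdf K L (Id2 (PS K L) ?i) m)"
      using T.q2_vcomp [of "(Id2 (PS K L) ?i, m')" "(Id2 (PS K L) ?i, m)"] i m by simp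
    then show ?thesis
      using m h t t2 by (simp add: act_mdf_def PE.hcomp_vcomp)
  qed
  have ar: "act_mdf K L A m \<in> Ar (pseudoend K (hom_comp_psf K L A B))"
    if "modification K L m" "NS (MS m) = A" "NT (MS m) = B" for m
    using act_mdf(1) [OF that(1,2)] that(3) by simp
  have ob: "act_psn K L A \<sigma> \<in> Ob (pseudoend K (hom_comp_psf K L A B))"
    if "pseudonat K L \<sigma>" "NS \<sigma> = A" "NT \<sigma> = B" for \<sigma>
    using act_post(3) [OF that(1,2)] that(3) by simp
  show ?thesis
    unfolding functorial_def
    using PS.category_homcat category_pseudoend ob ar id vcomp act_mdf(4,5)
    by (simp add: PS_simps(1-9))
qed

end

end

section \<open>Comparison of an object with the one rebuilt from its evaluation\<close>

context pseudoend_object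
begin

interpretation p: pseudoend_post K L "psn_id K L A" E "hom_action K L A"
  by (rule act_post) (simp_all add: psf_A pseudonat_eval)

lemma act_psn_eval: "act_psn K L A E = p.y"
  by (simp add: act_psn_def PS_simps(9))

interpretation y: pseudoend_object K L A B "act_psn K L A E"
  using act_post(3) [OF psf_A pseudonat_eval]
  by (intro pseudoend_objectI psf_A psf_B) simp

lemma X_act_eval [simp]:
  "u \<in> Cell1 K \<Longrightarrow> y.X u = X (Id1 K (Trg K u)) \<odot> P1 A u"
  "\<mu> \<in> Cell2 K \<Longrightarrow> y.X2 \<mu> = \<iota> (X (Id1 K (Trg K (Dom2 K \<mu>)))) \<star> P2 A \<mu>"
  unfolding act_psn_eval by (simp_all add: p.X2_post wedge_hom_action [OF psf_A])

text \<open>This becomes the modification axiom of the counit. Right actions are rearranged by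
  \<open>rho_rho\<close>; then the defining equation of \<open>N2 E g\<close> converts the right
  action by \<open>g\<close> into the left one, which is commuted past the right action by
  \<open>u\<close>.\<close>

lemma rho_theta:
  assumes c: "f \<in> Cell1 K" "g \<in> Cell1 K" "u \<in> Cell1 K" "Src K u = Trg K f" "Trg K u = Src K g"
  shows "rho (Id1 K (Trg K g)) (Comp1 K g (Comp1 K u f)) \<cdot> y.\<theta> f g u
    = \<theta> f g u \<cdot> \<iota> (P1 B g) \<star> rho (Id1 K (Trg K u)) u \<star> \<iota> (P1 A f)"
proof -
  let ?b = "Src K g" let ?j = "Id1 K ?b" and ?k = "Id1 K (Trg K g)" and ?gu = "Comp1 K g u"
  let ?N = "N2 E g \<star> \<iota> (P1 A u \<odot> P1 A f)"
  have y: "y.\<theta> f g u = \<iota> (X ?k) \<star> (PC A (?gu, f) \<cdot> PC A (g, u) \<star> \<iota> (P1 A f)) \<cdot> ?N"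
    unfolding act_psn_eval using c by (simp add: p.theta_post wedge_hom_action [OF psf_A] hom_action_cell_def L.inv2_distrib)
  have 1: "rho ?k (Comp1 K g (Comp1 K u f)) \<cdot> \<iota> (X ?k) \<star> PC A (?gu, f) = rho ?gu f \<cdot> rho ?k ?gu \<star> \<iota> (P1 A f)"
    using rho_rho [of ?k ?gu f] c by simp
  have "rho ?k ?gu \<star> \<iota> (P1 A f) \<cdot> \<iota> (X ?k) \<star> PC A (g, u) \<star> \<iota> (P1 A f)
    = (rho ?k ?gu \<cdot> \<iota> (X ?k) \<star> PC A (g, u)) \<star> \<iota> (P1 A f)"
    using c by (simp add: L.whisker_right)
  also have "\<dots> = (rho g u \<cdot> rho ?k g \<star> \<iota> (P1 A u)) \<star> \<iota> (P1 A f)"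
    using rho_rho [of ?k g u] c by simp
  finally have 2: "rho ?k ?gu \<star> \<iota> (P1 A f) \<cdot> \<iota> (X ?k) \<star> PC A (g, u) \<star> \<iota> (P1 A f)
    = rho g u \<star> \<iota> (P1 A f) \<cdot> rho ?k g \<star> \<iota> (P1 A u \<odot> P1 A f)"
    using c by (simp add: L.whisker_right)
  have 3: "rho ?k g \<star> \<iota> (P1 A u \<odot> P1 A f) \<cdot> ?N = lam g ?j \<star> \<iota> (P1 A u \<odot> P1 A f)"
    using c rho_N2 [of g] by (simp flip: L.whisker_right)
  have "rho ?k (Comp1 K g (Comp1 K u f)) \<cdot> y.\<theta> f g u = rho ?gu f \<cdot> rho g u \<star> \<iota> (P1 A f) \<cdot> lam g ?j \<star> \<iota> (P1 A u \<odot> P1 A f)"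
    unfolding y using c by (simp add: L.whisker_left 3 L.vcomp_reassoc [OF 1] L.vcomp_reassoc [OF 2])
  also have "\<dots> = rho ?gu f \<cdot> (rho g u \<cdot> lam g ?j \<star> \<iota> (P1 A u)) \<star> \<iota> (P1 A f)"
    using c by (simp add: L.whisker_right)
  also have "\<dots> = rho ?gu f \<cdot> (lam g u \<cdot> \<iota> (P1 B g) \<star> rho ?j u) \<star> \<iota> (P1 A f)"
    using c theta_lam_rho [of u g ?j] theta_rho_lam [of u g ?j] by simp
  also have "\<dots> = (rho ?gu f \<cdot> lam g u \<star> \<iota> (P1 A f)) \<cdot> \<iota> (P1 B g) \<star> rho ?j u \<star> \<iota> (P1 A f)"
    using c by (simp add: L.whisker_right)
  finally show ?thesis using c theta_rho_lam [of f g u] by simp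
qed

lemma counit_simps [simp]:
  "MS (counit_mdf K L A B x) = act_psn K L A E" "MT (counit_mdf K L A B x) = x"
  "a \<in> Obj K \<Longrightarrow> b \<in> Obj K \<Longrightarrow> TS (MC (counit_mdf K L A B x) (a, b)) = N1 (act_psn K L A E) (a, b)"
  "a \<in> Obj K \<Longrightarrow> b \<in> Obj K \<Longrightarrow> TT (MC (counit_mdf K L A B x) (a, b)) = N1 x (a, b)"
  "u \<in> Cell1 K \<Longrightarrow> a = Src K u \<Longrightarrow> b = Trg K u \<Longrightarrow> TC (MC (counit_mdf K L A B x) (a, b)) (Inl u) = Inr (rho (Id1 K b) u)"
  by (simp_all add: counit_mdf_def)

lemma nat_counit:
  assumes ab: "a \<in> Obj K" "b \<in> Obj K"
  shows "is_nat (MC (counit_mdf K L A B x) (a, b))" (is "is_nat ?t")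
proof (rule is_nat.intro)
  have S: "FS (TS ?t) = cat_map Inl Inl (homcat K a b)" "FT (TS ?t) = cat_map Inr Inr (homcat L (P0 A a) (P0 B b))"
    using ab y.N1_x [of a b] by simp_all
  show "is_functor (TS ?t)" "is_functor (TT ?t)" "FS (TT ?t) = FS (TS ?t)" "FT (TT ?t) = FT (TS ?t)"
    using ab y.N1_x [of a b] by (simp_all add: N1_x)
  show "TC ?t \<in> extensional (Ob (FS (TS ?t)))"
    unfolding S using ab by (simp add: counit_mdf_def)
  fix w assume "w \<in> Ob (FS (TS ?t))"
  then obtain u where u: "w = Inl u" "u \<in> Cell1 K" "a = Src K u" "b = Trg K u" by (auto simp: S)
  then show "TC ?t w \<in> Ar (FT (TS ?t))" "Dom (FT (TS ?t)) (TC ?t w) = FO (TS ?t) w" "Cod (FT (TS ?t)) (TC ?t w) = FO (TT ?t) w"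
    by (simp_all add: S y.N1_x y.FO_x FO_x)
next
  have S: "FS (TS ?t) = cat_map Inl Inl (homcat K a b)" "FT (TS ?t) = cat_map Inr Inr (homcat L (P0 A a) (P0 B b))"
    using ab y.N1_x [of a b] by simp_all
  fix w assume "w \<in> Ar (FS (TS ?t))"
  then obtain \<mu> where m: "w = Inl \<mu>" "\<mu> \<in> Cell2 K" "a = Src K (Dom2 K \<mu>)" "b = Trg K (Dom2 K \<mu>)" by (auto simp: S)
  then show "Cmp (FT (TS ?t)) (TC ?t (Cod (FS (TS ?t)) w)) (FA (TS ?t) w)
    = Cmp (FT (TS ?t)) (FA (TT ?t) w) (TC ?t (Dom (FS (TS ?t)) w))"
    using rho_natural [of \<mu> "Id1 K b"]
    by (simp add: S y.N1_x y.FA_x FA_x)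
qed

lemma modification_counit: "modification (opprod K) CAT (counit_mdf K L A B x)"
proof (rule modification_CATI, goal_cases)
  case 1
  show ?case by (intro two_category_opprod K.two_category_axioms)
next
  case (10 q w)
  then obtain f g u where c: "q = (f, g)" "w = Inl u" "f \<in> Cell1 K" "g \<in> Cell1 K" "u \<in> Cell1 K" "Src K u = Trg K f" "Trg K u = Src K g"
    by (cases q) (auto simp: hom_psf_def y.NS_x)
  then show ?case
    using rho_theta [of f g u]
    by (simp add: CAT_simps y.NS_x y.NT_x NS_x NT_x hom_psf_def N1_x y.N1_x y.FO_x y.FA_x N2_x y.N2_x FO_x FA_x TC_x y.TC_x)
qed (auto simp: psn_x y.psn_x NS_x NT_x nat_counit y.NS_x y.NT_x, auto simp: counit_mdf_def)

lemma counit_arrow: "pseudoend_arrow K L A B (counit_mdf K L A B x)"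
  by (intro pseudoend_arrowI psf_A psf_B)
    (simp add: pseudoend_def PS_simps(1-9) modification_counit y.NS_x y.NT_x)

lemma wedge_mdf_counit: "u \<in> Cell1 K \<Longrightarrow> wedge_mdf K (counit_mdf K L A B x) u = rho (Id1 K (Trg K u)) u"
  by (simp add: wedge_mdf_def)

lemma iso2_counit: "iso2 (PE K) (counit_mdf K L A B x)"
proof -
  interpret oc: two_categories "opprod K" "CAT :: ('f + 'g, 'c + 'd) CAT"
    by (intro two_categories.intro two_category_opprod K.two_category_axioms two_category_CAT)
  show ?thesis
    unfolding oc.iso2_PS_iff [OF modification_counit]
  proof
    fix q assume "q \<in> Obj (opprod K)"
    then obtain a b where q: "q = (a, b)" "a \<in> Obj K" "b \<in> Obj K" by auto
    have "iso_arr (FT (N1 (act_psn K L A E) (a, b))) (TC (MC (counit_mdf K L A B x) (a, b)) w)"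
      if w: "w \<in> Ob (FS (N1 (act_psn K L A E) (a, b)))" for w
    proof -
      obtain u where "w = Inl u" "u \<in> Cell1 K" "a = Src K u" "b = Trg K u"
        using w q y.N1_x [of a b] by auto
      then show ?thesis
        using q y.N1_x [of a b]
        by (simp add: iso_arr_cat_map L.category_homcat iso_arr_homcat [OF L.two_category_axioms])
    qed
    then show "iso2 CAT (MC (counit_mdf K L A B x) q)"
      using q by (simp add: iso2_CAT_iff nat_counit)
  qed
qed

end

lemma (in two_categories) equivalence_eval:
  fixes k0 :: "_ \<Rightarrow> 'z" and k1 :: "_ \<Rightarrow> 'w"
  assumes A: "pseudofunctor K L A" and B: "pseudofunctor K L B"
    and inj: "inj i" "inj j" "inj k0" "inj k1"
  shows "equivalence1 CAT (het_ftr i j k0 k1 (pseudoend K (hom_comp_psf K L A B)) (homcat (PS K L) A B)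
    (eval_psn K L A B) (eval_mdf K L A B))"
proof (rule equivalence1_het [OF functorial_eval [OF A B] functorial_act [OF A B] inj])
  let ?C = "pseudoend K (hom_comp_psf K L A B)" and ?D = "homcat (PS K L) A B"
  interpret PS: two_category "PS K L" by (rule two_category_PS)
  note ob = pseudoend_objectI [OF A B] and ar = pseudoend_arrowI [OF A B]
  note ua = modification_unit [OF A] iso2_unit [OF A]
  interpret h: pseudoend_object K L A A "hom_action K L A" by (rule pseudoend_object_hom_action [OF A])
  \<comment> \<open>Evaluating \<open>act_psn\<close> at \<open>\<sigma>\<close> gives
    \<open>\<sigma>\<close> after \<open>h.E\<close>, so the unit whiskered by
    \<open>\<sigma>\<close> has the required target and is natural in \<open>\<sigma>\<close> by
    interchange.\<close>
  let ?u = "\<lambda>\<sigma>. HComp (PS K L) (Id2 (PS K L) \<sigma>) (unit_mdf K L A)"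
  have u: "unit_mdf K L A \<in> Cell2 (PS K L)" "Dom2 (PS K L) (unit_mdf K L A) = Id1 (PS K L) A"
    "Cod2 (PS K L) (unit_mdf K L A) = h.E" "h.E \<in> Cell1 (PS K L)" "Src (PS K L) h.E = A" "Trg (PS K L) h.E = A" "A \<in> Obj (PS K L)"
    using ua(1) A h.pseudonat_eval by (simp_all add: PS_simps(1-9) unit_mdf_def)
  show "counit_mdf K L A B x \<in> Ar ?C \<and> Dom ?C (counit_mdf K L A B x) = act_psn K L A (eval_psn K L A B x) \<and>
      Cod ?C (counit_mdf K L A B x) = x \<and> iso_arr ?C (counit_mdf K L A B x)" if "x \<in> Ob ?C" for x
  proof -
    interpret x: pseudoend_object K L A B x by (rule ob [OF that])
    have 1: "counit_mdf K L A B x \<in> Ar ?C" by (rule pseudoend_arrow.ar_\<xi> [OF x.counit_arrow])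
    then have "iso_arr ?C (counit_mdf K L A B x)"
      using x.iso2_counit unfolding pseudoend_def by (simp add: iso_arr_homcat [OF two_category_PE])
    with 1 show ?thesis by simp
  qed
  show "Cmp ?C (counit_mdf K L A B (Cod ?C \<xi>)) (act_mdf K L A (eval_mdf K L A B \<xi>)) = Cmp ?C \<xi> (counit_mdf K L A B (Dom ?C \<xi>))"
    if x: "\<xi> \<in> Ar ?C" for \<xi>
  proof -
    interpret x: pseudoend_arrow K L A B \<xi> by (rule ar [OF x])
    let ?m = "act_mdf K L A (eval_mdf K L A B \<xi>)"
    note m = act_mdf [OF A x.modification_eval, simplified]
    have m': "pseudoend_arrow K L A B ?m" by (rule ar [OF m(1)])
    note c = x.x.counit_arrow x.y.counit_arrow
    have D: "MS ?m = MS (counit_mdf K L A B (MS \<xi>))" "MT ?m = MS (counit_mdf K L A B (MT \<xi>))"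
      using m(4,5) by simp_all
    show ?thesis
    proof (rule pseudoend_arrow_eqI [of A B])
      show "pseudoend_arrow K L A B (Cmp ?C (counit_mdf K L A B (Cod ?C \<xi>)) ?m)"
        using D by (intro ar category.cmp_in [OF category_pseudoend] m(1) pseudoend_arrow.ar_\<xi> [OF c(2)] | simp)+
      show "pseudoend_arrow K L A B (Cmp ?C \<xi> (counit_mdf K L A B (Dom ?C \<xi>)))"
        by (intro ar category.cmp_in [OF category_pseudoend] x pseudoend_arrow.ar_\<xi> [OF c(1)] | simp)+
      fix u assume u: "u \<in> Cell1 K"
      \<comment> \<open>The cells of the counit are right actions on \<open>X\<close> at an
        identity, so naturality in \<open>\<xi>\<close> is \<open>Z_rho\<close> there.\<close>
      show "wedge_mdf K (Cmp ?C (counit_mdf K L A B (Cod ?C \<xi>)) ?m) u = wedge_mdf K (Cmp ?C \<xi> (counit_mdf K L A B (Dom ?C \<xi>))) u"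
        using u x.Z_rho [of "Id1 K (Trg K u)" u] m(2)
        by (simp add: wedge_mdf_vcomp [OF c(2) m'] wedge_mdf_vcomp [OF x.pseudoend_arrow_axioms c(1)]
            x.x.wedge_mdf_counit x.y.wedge_mdf_counit)
    qed (simp_all add: D)
  qed
  show "?u \<sigma> \<in> Ar ?D \<and> Dom ?D (?u \<sigma>) = \<sigma> \<and> Cod ?D (?u \<sigma>) = eval_psn K L A B (act_psn K L A \<sigma>) \<and> iso_arr ?D (?u \<sigma>)"
    if "\<sigma> \<in> Ob ?D" for \<sigma>
  proof -
    have s: "\<sigma> \<in> Cell1 (PS K L)" "Src (PS K L) \<sigma> = A" "Trg (PS K L) \<sigma> = B" using that by simp_all
    have s': "pseudonat K L \<sigma>" "NS \<sigma> = A" "NT \<sigma> = B" using s by (simp_all add: PS_simps(1-9))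
    have 1: "?u \<sigma> \<in> Ar ?D" "Dom ?D (?u \<sigma>) = \<sigma>" "Cod ?D (?u \<sigma>) = Comp1 (PS K L) \<sigma> h.E"
      using s u by simp_all
    have "iso_arr ?D (?u \<sigma>)"
      using s u ua by (simp add: iso_arr_homcat [OF two_category_PS])
    with 1 show ?thesis using act_post(4) [OF A s'(1,2)] s'(3) by (simp add: PS_simps(9))
  qed
  show "Cmp ?D (?u (Cod ?D m)) m = Cmp ?D (eval_mdf K L A B (act_mdf K L A m)) (?u (Dom ?D m))" if "m \<in> Ar ?D" for m
  proof -
    have m: "m \<in> Cell2 (PS K L)" "Src (PS K L) (Dom2 (PS K L) m) = A" "Trg (PS K L) (Dom2 (PS K L) m) = B"
      using that by simp_all
    have m': "modification K L m" "NS (MS m) = A" "NT (MS m) = B" using m by (simp_all add: PS_simps(1-9))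
    have "eval_mdf K L A B (act_mdf K L A m) = HComp (PS K L) m (Id2 (PS K L) h.E)"
      using act_mdf(3) [OF A m'(1,2)] m'(3) by simp
    then show ?thesis
      using m u by (simp add: PS.unit_right PS.hcomp_vcomp)
  qed
qed

section \<open>Strict naturality and assembly of the pseudonatural equivalence\<close>

lemma psf_post_strict:
  assumes "strict_two_functor J K F0 F1 F2" "strict_two_functor K L Q0 Q1 Q2"
  shows "psf_post J Q0 Q1 Q2 (strict_psf J K F0 F1 F2)
    = strict_psf J L (\<lambda>a. Q0 (F0 a)) (\<lambda>f. Q1 (F1 f)) (\<lambda>\<alpha>. Q2 (F2 \<alpha>))"
proof -
  interpret F: strict_two_functor J K F0 F1 F2 by fact
  interpret Q: strict_two_functor K L Q0 Q1 Q2 by fact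
  show ?thesis
    by (auto simp: psf_post_def strict_psf_def intro!: restrict_ext)
qed

text \<open>A family that is natural on the nose between 2-functors is completed by identity cells:
  \<open>nat1\<close> gives them the right codomain, \<open>nat2\<close> is their naturality in
  2-cells, and the remaining axioms compare identities.\<close>

lemma pseudonat_strict:
  assumes Q: "strict_two_functor K L Q0 Q1 Q2" and R: "strict_two_functor K L R0 R1 R2"
    and N: "\<And>a. a \<in> Obj K \<Longrightarrow> N a \<in> Cell1 L" "\<And>a. a \<in> Obj K \<Longrightarrow> Src L (N a) = Q0 a"
      "\<And>a. a \<in> Obj K \<Longrightarrow> Trg L (N a) = R0 a"
    and nat1: "\<And>f. f \<in> Cell1 K \<Longrightarrow> Comp1 L (R1 f) (N (Src K f)) = Comp1 L (N (Trg K f)) (Q1 f)"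
    and nat2: "\<And>\<alpha>. \<alpha> \<in> Cell2 K \<Longrightarrow> HComp L (R2 \<alpha>) (Id2 L (N (Src K (Dom2 K \<alpha>))))
      = HComp L (Id2 L (N (Trg K (Dom2 K \<alpha>)))) (Q2 \<alpha>)"
  shows "\<exists>n. pseudonat K L n \<and> NS n = strict_psf K L Q0 Q1 Q2 \<and> NT n = strict_psf K L R0 R1 R2 \<and>
    N1 n = restrict N (Obj K)"
proof -
  interpret Q: strict_two_functor K L Q0 Q1 Q2 by fact
  interpret R: strict_two_functor K L R0 R1 R2 by fact
  have nat1': "Comp1 L (N b) (Q1 f) = Comp1 L (R1 f) (N (Src K f))" if "f \<in> Cell1 K" "b = Trg K f" for f b
    using nat1 that by simp
  have comp: "Comp1 L (R1 g) (Comp1 L (N (Trg K f)) (Q1 f)) = Comp1 L (R1 g) (Comp1 L (R1 f) (N (Src K f)))"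
    if "g \<in> Cell1 K" "f \<in> Cell1 K" "Src K g = Trg K f" for g f
    using nat1 that by simp
  have comp': "Comp1 L (N (Trg K g)) (Comp1 L (Q1 g) (Q1 f)) = Comp1 L (R1 g) (Comp1 L (R1 f) (N (Src K f)))"
    if "g \<in> Cell1 K" "f \<in> Cell1 K" "Src K g = Trg K f" for g f
    using nat1' [of "Comp1 K g f"] that N by simp
  have "pseudonat K L \<lparr>NS = strict_psf K L Q0 Q1 Q2, NT = strict_psf K L R0 R1 R2,
    N1 = restrict N (Obj K), N2 = (\<lambda>f\<in>Cell1 K. Id2 L (Comp1 L (R1 f) (N (Src K f))))\<rparr>"
  proof (rule pseudonat.intro, goal_cases)
    case (11 \<alpha>)
    then show ?case
      using N nat2 [OF 11] nat1 [of "Dom2 K \<alpha>"] nat1 [of "Cod2 K \<alpha>"] by simp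
  next
    case (12 g f)
    then show ?case using N by (simp add: comp comp')
  next
    case (13 a)
    then show ?case using N by simp
  qed (use Q.pseudofunctor_strict R.pseudofunctor_strict N nat1 in simp_all)
  then show ?thesis by - (rule exI, rule conjI, assumption, simp)
qed

context two_categories
begin

abbreviation PEL :: "(('o, 'f, 'c, 'g, 'd) pe_psf,
    ('o, 'f, 'c, 'g, 'd) pe_psn,
    ('o, 'f, 'c, 'g, 'd) pe_mdf) two_cat"
  where "PEL \<equiv> PE K"

abbreviation "eval_ftr \<equiv> \<lambda>(A, B). het_ftr Inl Inl Inr Inr (pseudoend K (hom_comp_psf K L A B)) (homcat (PS K L) A B)
    (eval_psn K L A B) (eval_mdf K L A B)"

interpretation PE: two_category PEL by (rule two_category_PE)

interpretation PS: two_category "PS K L" by (rule two_category_PS)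

interpretation S: strict_two_functor "opprod (PS K L)" CAT "\<lambda>(A, B). pseudoend K (hom_comp_psf K L A B)"
     "\<lambda>(\<gamma>, \<delta>). pseudoend_ftr K (hom_comp_psn K L \<gamma> \<delta>)" "\<lambda>(m, m'). pseudoend_ntr K (hom_comp_mdf K L m m')"
    by (rule strict_two_functor_pseudoend_hom)

interpretation T: strict_two_functor "opprod (PS K L)" "PE K" "\<lambda>(A, B). target_psf K L A B"
    "\<lambda>(\<gamma>, \<delta>). target_psn K L \<gamma> \<delta>" "\<lambda>(m, m'). target_mdf K L m m'"
    by (rule strict_two_functor_hom_comp)

lemma functor_eval_ftr:
  "pseudofunctor K L A \<Longrightarrow> pseudofunctor K L B \<Longrightarrow> is_functor (eval_ftr (A, B))"
  by (simp add: functor_het functorial_eval)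

text \<open>The contravariant argument of the underlying \<open>hom_ftr\<close> is an identity, so
  it disappears and only postcomposition with \<open>target_psn\<close> remains.\<close>

lemma pseudoend_ftr_simps:
  assumes g: "pseudonat K L \<gamma>" and d: "pseudonat K L \<delta>"
  defines "F \<equiv> pseudoend_ftr K (hom_comp_psn K L \<gamma> \<delta>)"
  shows "is_functor F" "FS F = pseudoend K (hom_comp_psf K L (NT \<gamma>) (NS \<delta>))"
    "FT F = pseudoend K (hom_comp_psf K L (NS \<gamma>) (NT \<delta>))"
    "x \<in> Ob (FS F) \<Longrightarrow> FO F x = psn_comp (opprod K) CAT (target_psn K L \<gamma> \<delta>) x"
    "\<xi> \<in> Ar (FS F) \<Longrightarrow> FA F \<xi> = HComp (PE K) (target_mdf K L (Id2 (PS K L) \<gamma>) (Id2 (PS K L) \<delta>)) \<xi>"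
proof -
  have gd: "(\<gamma>, \<delta>) \<in> Cell1 (opprod (PS K L))" using g d by (simp add: PS_simps(1-9))
  show "is_functor F" and S: "FS F = pseudoend K (hom_comp_psf K L (NT \<gamma>) (NS \<delta>))"
    "FT F = pseudoend K (hom_comp_psf K L (NS \<gamma>) (NT \<delta>))"
    using S.q1_in [OF gd] S.q1_src [OF gd] S.q1_trg [OF gd] by (simp_all add: F_def CAT_simps(1-9) PS_simps(1-9))
  have h: "Trg PEL (Id1 PEL (hom_PE K)) = hom_PE K"
    by (simp add: hom_PE_obj)
  show "FO F x = psn_comp (opprod K) CAT (target_psn K L \<gamma> \<delta>) x" if "x \<in> Ob (FS F)"
  proof -
    have x: "x \<in> Cell1 (PE K)" "Src (PE K) x = hom_PE K" "Trg (PE K) x = target_psf K L (NT \<gamma>) (NS \<delta>)"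
      using that by (simp_all add: S pseudoend_def)
    have s: "Src (PE K) (target_psn K L \<gamma> \<delta>) = target_psf K L (NT \<gamma>) (NS \<delta>)" by (simp add: PS_simps(1-9))
    have "FO F x = Comp1 (PE K) (target_psn K L \<gamma> \<delta>) x"
      using x s h by (simp add: F_def pseudoend_ftr_def)
    then show ?thesis by (simp add: PS_simps(9))
  qed
  show "FA F \<xi> = HComp (PE K) (target_mdf K L (Id2 (PS K L) \<gamma>) (Id2 (PS K L) \<delta>)) \<xi>" if "\<xi> \<in> Ar (FS F)"
  proof -
    have x: "\<xi> \<in> Cell2 (PE K)" "Src (PE K) (Dom2 (PE K) \<xi>) = hom_PE K"
      "Trg (PE K) (Dom2 (PE K) \<xi>) = target_psf K L (NT \<gamma>) (NS \<delta>)"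
      using that by (simp_all add: S pseudoend_def)
    have s: "Src (PE K) (target_psn K L \<gamma> \<delta>) = target_psf K L (NT \<gamma>) (NS \<delta>)" by (simp add: PS_simps(1-9))
    have "FA F \<xi> = HComp (PE K) (Id2 (PE K) (target_psn K L \<gamma> \<delta>)) \<xi>"
      using x s h by (simp add: F_def pseudoend_ftr_def)
    then show ?thesis using T.q2_id [OF gd] by simp
  qed
qed

lemma pseudoend_ntr_simps:
  assumes m: "modification K L m" and m': "modification K L m'"
  defines "t \<equiv> pseudoend_ntr K (hom_comp_mdf K L m m')"
  shows "is_nat t" "TS t = pseudoend_ftr K (hom_comp_psn K L (MS m) (MS m'))"
    "TT t = pseudoend_ftr K (hom_comp_psn K L (MT m) (MT m'))"
    "x \<in> Ob (FS (TS t)) \<Longrightarrow> TC t x = HComp (PE K) (target_mdf K L m m') (Id2 (PE K) x)"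
proof -
  have mm: "(m, m') \<in> Cell2 (opprod (PS K L))" using m m' by (simp add: PS_simps(1-9))
  show "is_nat t" and S: "TS t = pseudoend_ftr K (hom_comp_psn K L (MS m) (MS m'))"
    "TT t = pseudoend_ftr K (hom_comp_psn K L (MT m) (MT m'))"
    using S.q2_in [OF mm] S.q2_dom [OF mm] S.q2_cod [OF mm] by (simp_all add: t_def CAT_simps(1-9) PS_simps(1-9))
  show "TC t x = HComp (PE K) (target_mdf K L m m') (Id2 (PE K) x)" if "x \<in> Ob (FS (TS t))"
  proof -
    have x: "x \<in> Cell1 (PE K)" "Src (PE K) x = hom_PE K" "Trg (PE K) x = target_psf K L (NT (MS m)) (NS (MS m'))"
      using that m m' by (simp_all add: S pseudoend_ftr_simps mdf_rules pseudoend_def)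
    have s: "Src (PE K) (Dom2 (PE K) (target_mdf K L m m')) = target_psf K L (NT (MS m)) (NS (MS m'))" by (simp add: PS_simps(1-9))
    have i: "Id1 PEL (hom_PE K) \<in> Cell1 PEL" "Trg PEL (Id1 PEL (hom_PE K)) = hom_PE K"
      by (simp_all add: hom_PE_obj)
    show ?thesis
      using x s i by (simp add: t_def pseudoend_ntr_def)
  qed
qed

text \<open>On objects this is \<open>eval_post\<close>; on arrows it is
  \<open>eval_mdf_post\<close> for the identity modifications of \<open>\<gamma>\<close> and
  \<open>\<delta>\<close>.\<close>

lemma eval_natural1:
  assumes g: "pseudonat K L \<gamma>" and d: "pseudonat K L \<delta>"
  shows "ftr_comp (ftr_map Inr Inr (hom_ftr (PS K L) \<gamma> \<delta>)) (eval_ftr (NT \<gamma>, NS \<delta>))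
      = ftr_comp (eval_ftr (NS \<gamma>, NT \<delta>)) (ftr_map Inl Inl (pseudoend_ftr K (hom_comp_psn K L \<gamma> \<delta>)))" (is "?l = ?r")
proof -
  note p = pseudoend_ftr_simps [OF g d]
  note gd = psn_rules(1,2) [OF g] psn_rules(1,2) [OF d]
  have gd1: "\<gamma> \<in> Cell1 (PS K L)" "\<delta> \<in> Cell1 (PS K L)" using g d by (simp_all add: PS_simps(1-9))
  have l: "is_functor ?l" "is_functor ?r"
    using gd by (auto intro!: functor_comp functor_map functor_eval_ftr [simplified] PS.functor_hom_ftr gd1 p(1)
       simp: p(2,3) PS_simps(1-9))
  show ?thesis
  proof (rule ftr_eqI [OF l])
    show "FS ?l = FS ?r" "FT ?l = FT ?r" by (simp_all add: p(2,3) PS_simps(1-9))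
  next
    fix w assume "w \<in> Ob (FS ?l)"
    then obtain x where w: "w = Inl x" and x: "x \<in> Ob (pseudoend K (hom_comp_psf K L (NT \<gamma>) (NS \<delta>)))" by auto
    interpret s: pseudoend_post K L \<gamma> \<delta> x
      by (intro pseudoend_postI g d x)
    show "FO ?l w = FO ?r w"
      using x s.psn_y s.eval_post s.x.pseudonat_eval by (simp add: w p PS_simps(1-9))
  next
    fix w assume "w \<in> Ar (FS ?l)"
    then obtain \<xi> where w: "w = Inl \<xi>" and x: "\<xi> \<in> Ar (pseudoend K (hom_comp_psf K L (NT \<gamma>) (NS \<delta>)))" by auto
    interpret x: pseudoend_arrow K L "NT \<gamma>" "NS \<delta>" \<xi>
      by (intro pseudoend_arrowI gd x)
    have i: "modification K L (Id2 (PS K L) \<gamma>)" "modification K L (Id2 (PS K L) \<delta>)" using g d by (simp_all add: modification_id)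
    show "FA ?l w = FA ?r w"
      using x eval_mdf_post(1,3) [OF i, of \<xi>] x.modification_eval by (simp add: w p PS_simps(1-9))
  qed
qed

text \<open>Read at an object \<open>x\<close>, both sides become the horizontal composite of
  \<open>m'\<close>, the identity cell on the evaluation of \<open>x\<close>, and \<open>m\<close>.
  The right side reaches this form by \<open>eval_mdf_post\<close> applied to the identity arrow of
  \<open>x\<close>.\<close>

lemma eval_natural2:
  assumes m: "modification K L m" and m': "modification K L m'"
  shows "HComp CAT (ntr_map Inr Inr (hom_ntr (PS K L) m m')) (Id2 CAT (eval_ftr (NT (MS m), NS (MS m'))))
      = HComp CAT (Id2 CAT (eval_ftr (NS (MS m), NT (MS m')))) (ntr_map Inl Inl (pseudoend_ntr K (hom_comp_mdf K L m m')))" (is "?l = ?r")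
proof -
  note r = mdf_rules [OF m] mdf_rules [OF m']
  note rr = psn_rules(1,2) [OF r(1)] psn_rules(1,2) [OF mdf_rules(1) [OF m']]
  note p = pseudoend_ntr_simps [OF m m']
  note q = pseudoend_ftr_simps [OF mdf_rules(1) [OF m] mdf_rules(1) [OF m']]
  note q' = pseudoend_ftr_simps(2,3) [OF mdf_rules(2) [OF m] mdf_rules(2) [OF m']]
  note f = functorial_eval [OF rr(2,3), unfolded functorial_def]
  have mm: "m \<in> Cell2 (PS K L)" "m' \<in> Cell2 (PS K L)" using m m' by (simp_all add: PS_simps(1-9))
  have n1: "is_nat (ntr_map Inr Inr (hom_ntr (PS K L) m m'))" by (intro nat_map PS.nat_hom_ntr mm) simp_all
  have n2: "is_nat (ntr_map Inl Inl (pseudoend_ntr K (hom_comp_mdf K L m m')))" by (intro nat_map p) simp_all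
  have "is_nat ?l"
    by (rule nat_hcomp [OF n1 nat_id [OF functor_eval_ftr]])
     (simp_all add: rr CAT_simps(10) PS_simps(1-9))
  moreover have "is_nat ?r"
    by (rule nat_hcomp [OF nat_id [OF functor_eval_ftr] n2])
     (simp_all add: rr CAT_simps(10) p q)
  ultimately show ?thesis
  proof (rule ntr_eqI)
    show "TS ?l = TS ?r"
      using eval_natural1 [OF mdf_rules(1) [OF m] mdf_rules(1) [OF m']] by (simp add: CAT_simps(10-12) p PS_simps(1-9))
    show "TT ?l = TT ?r"
      using eval_natural1 [OF mdf_rules(2) [OF m] mdf_rules(2) [OF m']] by (simp add: CAT_simps(10-12) p r PS_simps(1-9))
    fix w assume "w \<in> Ob (FS (TS ?l))"
    then obtain x where w: "w = Inl x" and x: "x \<in> Ob (pseudoend K (hom_comp_psf K L (NT (MS m)) (NS (MS m'))))"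
      by (auto simp: CAT_simps(10-12))
    interpret x: pseudoend_object K L "NT (MS m)" "NS (MS m')" x
      by (intro pseudoend_objectI rr x)
    have i: "Id2 (PE K) x \<in> Ar (pseudoend K (hom_comp_psf K L (NT (MS m)) (NS (MS m'))))"
      using category.idn_in [OF category_pseudoend x] by simp
    have e: "x.E \<in> Cell1 (PS K L)" "Src (PS K L) x.E = NT (MS m)" "Trg (PS K L) x.E = NS (MS m')"
      using x.pseudonat_eval by (simp_all add: PS_simps(1-9))
    have mt: "NS (MT m) = NS (MS m)" "NT (MT m) = NT (MS m)" "NS (MT m') = NS (MS m')" "NT (MT m') = NT (MS m')"
      using mdf_rules(3,4) [OF m] mdf_rules(3,4) [OF m'] by simp_all
    have ei: "eval_mdf K L (NT (MS m)) (NS (MS m')) (Id2 (PE K) x) = Id2 (PS K L) x.E"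
      using f x by simp
    have t: "HComp (PE K) (target_mdf K L m m') (Id2 (PE K) x) \<in> Ar (pseudoend K (hom_comp_psf K L (NS (MS m)) (NT (MS m'))))"
      by (rule eval_mdf_post(1) [OF m m' i])
    interpret t: pseudoend_post K L "MT m" "MT m'" x
      using x by (intro pseudoend_postI mdf_rules(2) [OF m] mdf_rules(2) [OF m'])
        (simp add: mt)
    have y: "FO (pseudoend_ftr K (hom_comp_psn K L (MT m) (MT m'))) x = t.y"
      "t.y \<in> Ob (pseudoend K (hom_comp_psf K L (NS (MS m)) (NT (MS m'))))"
      "eval_psn K L (NS (MS m)) (NT (MS m')) t.y = Comp1 (PS K L) (MT m') (Comp1 (PS K L) x.E (MT m))"
      using t.psn_y t.eval_post x pseudoend_ftr_simps(2,4) [OF mdf_rules(2) [OF m] mdf_rules(2) [OF m']]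
      by (simp_all add: mt PS_simps(9))
    \<comment> \<open>The rules of the 2-category \<open>PS K L\<close> are phrased with its own
      \<open>Src\<close>, \<open>Trg\<close>, \<open>Dom2\<close> and \<open>Cod2\<close>; rewriting
      the record fields into that form lets them apply.\<close>
    have d: "MS m = Dom2 (PS K L) m" "MS m' = Dom2 (PS K L) m'" "MT m = Cod2 (PS K L) m" "MT m' = Cod2 (PS K L) m'"
       "NS (Dom2 (PS K L) m) = Src (PS K L) (Dom2 (PS K L) m)" "NT (Dom2 (PS K L) m) = Trg (PS K L) (Dom2 (PS K L) m)"
       "NS (Dom2 (PS K L) m') = Src (PS K L) (Dom2 (PS K L) m')" "NT (Dom2 (PS K L) m') = Trg (PS K L) (Dom2 (PS K L) m')"
      by (simp_all add: PS_simps(1-9))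
    have "TC ?l w = Inr (HComp (PS K L) m' (HComp (PS K L) (Id2 (PS K L) x.E) m))"
      using x e mm unfolding d by (simp add: w CAT_simps(10-12))
    moreover have "TC ?r w = Inr (HComp (PS K L) m' (HComp (PS K L) (Id2 (PS K L) x.E) m))"
      using x e mm t y unfolding d by (simp add: w CAT_simps(10-12) p [unfolded d] q [unfolded d] q' [unfolded d] mt [unfolded d] eval_mdf_post(3) [OF m m' i, unfolded d] ei [unfolded d])
    ultimately show "TC ?l w = TC ?r w" by simp
  qed
qed

end

theorem proposition3p12:
  fixes \<AA> :: "('o, 'f, 'c) two_cat" and \<HH> :: "('p, 'g, 'd) two_cat"
  assumes "two_category \<AA>" and "two_category \<HH>"
  shows "\<exists>\<eta>. pseudonat_equivalence (prod2 (op2 (PS \<AA> \<HH>)) (PS \<AA> \<HH>)) CAT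
      (psf_map Inl Inl (prod2 (op2 (PS \<AA> \<HH>)) (PS \<AA> \<HH>)) (pseudoend_hom_psf \<AA> \<HH>))
      (psf_map Inr Inr (prod2 (op2 (PS \<AA> \<HH>)) (PS \<AA> \<HH>)) (hom_psf (PS \<AA> \<HH>))) \<eta>"
proof -
  interpret two_categories \<AA> \<HH> using assms by (rule two_categories.intro)
  let ?J = "opprod (PS \<AA> \<HH>)"
  note l = strict_two_functor_map [OF inj_Inl inj_Inl] and r = strict_two_functor_map [OF inj_Inr inj_Inr]
  note S = strict_two_functor_pseudoend_hom
  note T = two_category.strict_two_functor_hom [OF two_category_PS]
  \<comment> \<open>Tagging is itself a 2-functor, so it takes a 2-functor to one that again has
    identity coherence cells. This brings both ends of the transformation into the form of
    \<open>pseudonat_strict\<close>.\<close>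
  have Sl: "psf_map Inl Inl ?J (pseudoend_hom_psf \<AA> \<HH>) = strict_psf ?J CAT
      (\<lambda>p. cat_map Inl Inl (case p of (A, B) \<Rightarrow> pseudoend \<AA> (hom_comp_psf \<AA> \<HH> A B)))
      (\<lambda>p. ftr_map Inl Inl (case p of (\<gamma>, \<delta>) \<Rightarrow> pseudoend_ftr \<AA> (hom_comp_psn \<AA> \<HH> \<gamma> \<delta>)))
      (\<lambda>p. ntr_map Inl Inl (case p of (m, m') \<Rightarrow> pseudoend_ntr \<AA> (hom_comp_mdf \<AA> \<HH> m m')))"
    unfolding map_eq_post pseudoend_hom_psf_def by (rule psf_post_strict [OF S l])
  have Tr: "psf_map Inr Inr ?J (hom_psf (PS \<AA> \<HH>)) = strict_psf ?J CAT
      (\<lambda>p. cat_map Inr Inr (case p of (A, B) \<Rightarrow> homcat (PS \<AA> \<HH>) A B))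
      (\<lambda>p. ftr_map Inr Inr (case p of (\<gamma>, \<delta>) \<Rightarrow> hom_ftr (PS \<AA> \<HH>) \<gamma> \<delta>))
      (\<lambda>p. ntr_map Inr Inr (case p of (m, m') \<Rightarrow> hom_ntr (PS \<AA> \<HH>) m m'))"
    unfolding map_eq_post hom_psf_def by (rule psf_post_strict [OF T r])
  let ?E = "\<lambda>(A, B). het_ftr Inl Inl Inr Inr (pseudoend \<AA> (hom_comp_psf \<AA> \<HH> A B)) (homcat (PS \<AA> \<HH>) A B)
    (eval_psn \<AA> \<HH> A B) (eval_mdf \<AA> \<HH> A B)"
  have E: "?E (A, B) \<in> Cell1 CAT" "equivalence1 CAT (?E (A, B))" if "pseudofunctor \<AA> \<HH> A" "pseudofunctor \<AA> \<HH> B" for A B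
    using functor_het [OF functorial_eval [OF that] inj_Inl inj_Inl inj_Inr inj_Inr]
      equivalence_eval [OF that inj_Inl inj_Inl inj_Inr inj_Inr] by (simp_all add: CAT_simps)
  have "\<exists>\<eta>. pseudonat ?J CAT \<eta> \<and> NS \<eta> = psf_map Inl Inl ?J (pseudoend_hom_psf \<AA> \<HH>) \<and>
      NT \<eta> = psf_map Inr Inr ?J (hom_psf (PS \<AA> \<HH>)) \<and> N1 \<eta> = restrict ?E (Obj ?J)"
    \<comment> \<open>\<open>eval_natural1\<close> and \<open>eval_natural2\<close> are the strict
      naturality in 1-cells and in 2-cells, so the evaluation functors extend to a transformation
      completed by identity cells.\<close>
    unfolding Sl Tr using E eval_natural1 eval_natural2
    by (intro pseudonat_strict strict_two_functor_comp [OF S l] strict_two_functor_comp [OF T r])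
      (auto simp: PS_simps(1-9) CAT_simps(1-9))
  then show ?thesis
    unfolding pseudonat_equivalence_def using E(2) by (auto simp: PS_simps(1))
qed

end
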